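(* Let $n\ge6$ be even and let $G$ be of type $\mathbf{D}_n$ with cocharacter lattice $X_*(T)=\langle Q^\vee,\omega_n\rangle$. (1) The Tits section $\mathcal N_\circ$ is optimal. In fact $\mathcal N_\circ(s_i)^2\ne1$ for all $i$. Moreover, for any section $\mathcal S$ (satisfying the braid relations), $\mathcal S(s_i)$ has order $4$ for all $i$, so there is only one order profile of sections. (2) Two sections are $T$-conjugate if and only if they have the same value of $c$.
   Context: $F$ is an algebraically closed field, $G$ an almost-simple connected reductive group over $F$, $T$ a maximal torus, $N=N_G(T)$, $W=N/T$, $\pi:N\to W$ the projection. Let $\alpha_1,\dots,\alpha_n$ be the simple roots in Bourbaki numbering ($\alpha_i=e_i-e_{i+1}$ for $i<n$, $\alpha_n=e_{n-1}+e_n$), $s_i$ the corresponding reflections, $\alpha_i^\vee$ the simple coroots, $Q^\vee$ the coroot lattice, $\omega_i$ the fundamental coweights. Fix a realization of the root system: isomorphisms $u_\alpha:\mathbf G_a\to U_\alpha$ onto the root subgroups with $tu_\alpha(x)t^{-1}=u_\alpha(\alpha(t)x)$, such that $\sigma_\alpha=u_\alpha(1)u_{-\alpha}(-1)u_\alpha(1)\in N$ maps to $s_\alpha$ and $u_\alpha(x)u_{-\alpha}(-x^{-1})u_\alpha(x)=\alpha^\vee(x)\sigma_\alpha$ for $x\in F^\times$; put $\sigma_i=\sigma_{\alpha_i}$. A section is a map $\mathcal S:W\to N$ with $\pi\circ\mathcal S=\mathrm{id}$ satisfying the braid relations (equivalently $\mathcal S$ is multiplicative along reduced expressions). It is determined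 by $\mathcal S(s_i)=t_i\sigma_i$, $t_i\in T$. The Tits section $\mathcal N_\circ$ is the one with all $t_i=1$. The order profile of $\mathcal S$ is the Dynkin diagram with the node of each $\alpha_i$ labeled by the order of $\mathcal S(s_i)$. For two sections write $\mathcal S'<\mathcal S$ if the order of $\mathcal S'(s_i)$ is greater than the order of $\mathcal S(s_i)$ for all $i$; this translates to a partial order on order profiles, and a section is called optimal if it has the unique maximal order profile with respect to this partial order. Two sections $\mathcal S,\mathcal S'$ are $T$-conjugate if there is $t\in T$ with $t\mathcal S(w)t^{-1}=\mathcal S'(w)$ for all $w\in W$. Coordinates: the basis of $X_*(T)$ used is $\lambda_1=\omega_n$ and $\lambda_i=\alpha_i^\vee$ for $2\le i\le n$, and $(x_1,\dots,x_n)$ denotes $\lambda_1(x_1)\cdots\lambda_n(x_n)\in T$. The sections are exactly those given by $t_i$ of the following form, with $a_{i,i}\in F^\times$ arbitrary and $a,b,c\in F^\times$ with $c^2=1$, $a^3=b^2$, and $x=a^{-1}b$: $t_1$ has first coordinate $a^{-1}$; for $2\le k\le n-2$ its $k$-th coordinate is $a^{k/2}$ if $k$ is even and $b\,a^{(k-3)/2}$ if $k$ is odd; its $(n-1)$-th coordinate is $c\,x^{(n-2)/2}$ and its $n$-th coordinate is $c\,x^{n/2}$. For $2\le i\le n$, $t_i$ has $i$-th coordinate $a_{i,i}$, and for $k\ne i$ its $k$-th coordinate is $c$ if $k\in\{n-1,n\}$ and $1$ otherwise.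
   Formalization: The claims that the Tits section has N(s_i)^2 ≠ 1 and that every S(s_i) has order 4 are stated only for characteristic of F different from 2, since in characteristic 2 one has σ_i^2 = α_i^∨(-1) = 1; all other claims are stated in every characteristic. *)

theory Defs
  imports
    "HOL-Algebra.Group_Action"
    "HOL-Algebra.Generated_Groups"
    "HOL-Algebra.Multiplicative_Group"
    "HOL-Analysis.Determinants"
    "HOL-Computational_Algebra.Polynomial"
    "HOL-Library.Extended_Nat"
begin

section \<open>Linear algebraic groups over an algebraically closed field\<close>

text \<open>
  The field is algebraically closed wherever these notions are used, so a linear algebraic group
  is identified with its group of rational points: a Zariski closed subgroup of some general
  linear group.
\<close>

definition GL :: "('f::field ^ 'm ^ 'm) monoid" where
  "GL = \<lparr>carrier = {A. invertible A}, monoid.mult = (**), one = mat 1\<rparr>"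

abbreviation grp :: "('f::field ^ 'm ^ 'm) set \<Rightarrow> ('f ^ 'm ^ 'm) monoid" where
  "grp H \<equiv> GL\<lparr>carrier := H\<rparr>"

definition Gm :: "'f::field monoid" where
  "Gm = \<lparr>carrier = {x. x \<noteq> 0}, monoid.mult = (*), one = 1\<rparr>"

inductive_set polynomial_functions :: "('f::field ^ 'm ^ 'm \<Rightarrow> 'f) set" where
  const: "(\<lambda>_. c) \<in> polynomial_functions"
| entry: "(\<lambda>A. A $ i $ j) \<in> polynomial_functions"
| add: "p \<in> polynomial_functions \<Longrightarrow> q \<in> polynomial_functions
    \<Longrightarrow> (\<lambda>A. p A + q A) \<in> polynomial_functions"
| mult: "p \<in> polynomial_functions \<Longrightarrow> q \<in> polynomial_functions
    \<Longrightarrow> (\<lambda>A. p A * q A) \<in> polynomial_functions"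

definition zariski_closed :: "('f::field ^ 'm ^ 'm) set \<Rightarrow> bool" where
  "zariski_closed Z \<longleftrightarrow>
     (\<exists>P \<subseteq> polynomial_functions. Z = {A. invertible A \<and> (\<forall>p\<in>P. p A = 0)})"

definition zariski_connected :: "('f::field ^ 'm ^ 'm) set \<Rightarrow> bool" where
  "zariski_connected Z \<longleftrightarrow>
     \<not> (\<exists>A B. zariski_closed A \<and> zariski_closed B \<and> Z \<subseteq> A \<union> B \<and> A \<inter> B \<inter> Z = {}
            \<and> A \<inter> Z \<noteq> {} \<and> B \<inter> Z \<noteq> {})"

definition linear_algebraic_group :: "('f::field ^ 'm ^ 'm) set \<Rightarrow> bool" where
  "linear_algebraic_group G \<longleftrightarrow> subgroup G GL \<and> zariski_closed G"

text \<open>Regular functions on a closed subset of the general linear group are restrictions of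
  elements of the coordinate ring of the latter, the localization of the polynomial ring
  in the entries at the determinant.\<close>

definition regular_on :: "('f::field ^ 'm ^ 'm) set \<Rightarrow> ('f ^ 'm ^ 'm \<Rightarrow> 'f) \<Rightarrow> bool" where
  "regular_on Z f \<longleftrightarrow> (\<exists>p\<in>polynomial_functions. \<exists>k::nat. \<forall>A\<in>Z. f A = p A / det A ^ k)"

definition unipotent :: "'f::field ^ 'm ^ 'm \<Rightarrow> bool" where
  "unipotent A \<longleftrightarrow> (\<exists>k::nat. ((\<lambda>B. B ** (A - mat 1)) ^^ k) (mat 1) = 0)"

definition reductive :: "('f::field ^ 'm ^ 'm) set \<Rightarrow> bool" where
  "reductive G \<longleftrightarrow> linear_algebraic_group G \<and>
     (\<forall>U. linear_algebraic_group U \<and> zariski_connected U \<and> U \<lhd> grp G \<and> (\<forall>g\<in>U. unipotent g)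
        \<longrightarrow> U = {mat 1})"

definition almost_simple :: "('f::field ^ 'm ^ 'm) set \<Rightarrow> bool" where
  "almost_simple G \<longleftrightarrow> linear_algebraic_group G \<and> \<not> comm_group (grp G) \<and>
     (\<forall>H. linear_algebraic_group H \<and> zariski_connected H \<and> H \<lhd> grp G \<longrightarrow> H = {mat 1} \<or> H = G)"


section \<open>Tori, roots, root subgroups\<close>

text \<open>Characters are made extensional on \<open>T\<close>, so that distinct elements are distinct as
  characters of \<open>T\<close>.\<close>

definition characters :: "('f::field ^ 'm ^ 'm) set \<Rightarrow> ('f ^ 'm ^ 'm \<Rightarrow> 'f) set" where
  "characters T = {ch \<in> hom (grp T) Gm. regular_on T ch \<and> ch \<in> extensional T}"

text \<open>Regular functions of one nonzero variable are Laurent polynomials. The value of a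
  cocharacter at \<open>0\<close> is irrelevant.\<close>

definition cocharacters :: "('f::field ^ 'm ^ 'm) set \<Rightarrow> ('f \<Rightarrow> 'f ^ 'm ^ 'm) set" where
  "cocharacters T = {l \<in> hom Gm (grp T).
     \<forall>i j. \<exists>p (k::nat). \<forall>x. x \<noteq> 0 \<longrightarrow> l x $ i $ j = poly p x / x ^ k}"

text \<open>A torus is an algebraic group isomorphic to a power of the multiplicative group. An
  isomorphism is an \<open>r\<close>-tuple \<open>ch\<close> of characters, its inverse is the product of an \<open>r\<close>-tuple
  \<open>l\<close> of cocharacters.\<close>

definition torus :: "('f::field ^ 'm ^ 'm) set \<Rightarrow> bool" where
  "torus T \<longleftrightarrow> linear_algebraic_group T \<and> comm_group (grp T) \<and>
     (\<exists>(r::nat) ch l. (\<forall>i<r. ch i \<in> characters T \<and> l i \<in> cocharacters T)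
        \<and> (\<forall>i<r. \<forall>j<r. \<forall>x. x \<noteq> 0 \<longrightarrow> ch i (l j x) = (if i = j then x else 1))
        \<and> (\<forall>t\<in>T. t = finprod (grp T) (\<lambda>i. l i (ch i t)) {..<r}))"

definition maximal_torus :: "('f::field ^ 'm ^ 'm) set \<Rightarrow> ('f ^ 'm ^ 'm) set \<Rightarrow> bool" where
  "maximal_torus G T \<longleftrightarrow> torus T \<and> T \<subseteq> G \<and> (\<forall>T'. torus T' \<and> T \<subseteq> T' \<and> T' \<subseteq> G \<longrightarrow> T' = T)"

text \<open>The tangent space at the identity: \<open>X\<close> is tangent iff for every polynomial \<open>p\<close> vanishing on
  \<open>G\<close> the linear coefficient of \<open>p (1 + s X)\<close>, as a polynomial in \<open>s\<close>, is zero. Since the field is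
  infinite, the polynomial \<open>q\<close> exists and is unique.\<close>

definition lie_algebra :: "('f::field ^ 'm ^ 'm) set \<Rightarrow> ('f ^ 'm ^ 'm) set" where
  "lie_algebra G = {X. \<forall>p\<in>polynomial_functions. (\<forall>g\<in>G. p g = 0) \<longrightarrow>
     (\<forall>q. (\<forall>s. poly q s = p (mat 1 + map_matrix ((*) s) X)) \<longrightarrow> Polynomial.coeff q 1 = 0)}"

definition roots ::
    "('f::field ^ 'm ^ 'm) set \<Rightarrow> ('f ^ 'm ^ 'm) set \<Rightarrow> ('f ^ 'm ^ 'm \<Rightarrow> 'f) set" where
  "roots G T = {\<alpha> \<in> characters T. (\<exists>t\<in>T. \<alpha> t \<noteq> 1) \<and>
     (\<exists>X\<in>lie_algebra G. X \<noteq> 0 \<and> (\<forall>t\<in>T. t ** X ** matrix_inv t = map_matrix ((*) (\<alpha> t)) X))}"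

text \<open>Isomorphisms of algebraic groups from the additive group onto a closed subgroup \<open>U\<close>.\<close>

definition Ga_iso :: "('f::field ^ 'm ^ 'm) set \<Rightarrow> ('f \<Rightarrow> 'f ^ 'm ^ 'm) \<Rightarrow> bool" where
  "Ga_iso U u \<longleftrightarrow> linear_algebraic_group U \<and> range u = U
     \<and> (\<forall>x y. u (x + y) = u x ** u y)
     \<and> (\<forall>i j. \<exists>p. \<forall>x. u x $ i $ j = poly p x)
     \<and> (\<exists>f. regular_on U f \<and> (\<forall>x. f (u x) = x))"

definition root_parametrization ::
    "('f::field ^ 'm ^ 'm) set \<Rightarrow> ('f ^ 'm ^ 'm) set \<Rightarrow> ('f ^ 'm ^ 'm \<Rightarrow> 'f)
      \<Rightarrow> ('f ^ 'm ^ 'm) set \<Rightarrow> ('f \<Rightarrow> 'f ^ 'm ^ 'm) \<Rightarrow> bool" where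
  "root_parametrization G T \<alpha> U u \<longleftrightarrow> U \<subseteq> G \<and> Ga_iso U u
     \<and> (\<forall>t\<in>T. \<forall>x. t ** u x ** matrix_inv t = u (\<alpha> t * x))"

text \<open>The root subgroup of \<open>\<alpha>\<close> is by definition the unique subgroup admitting such a
  parametrization.\<close>

definition is_root_subgroup ::
    "('f::field ^ 'm ^ 'm) set \<Rightarrow> ('f ^ 'm ^ 'm) set \<Rightarrow> ('f ^ 'm ^ 'm \<Rightarrow> 'f)
      \<Rightarrow> ('f ^ 'm ^ 'm) set \<Rightarrow> bool" where
  "is_root_subgroup G T \<alpha> U \<longleftrightarrow> (\<exists>u. root_parametrization G T \<alpha> U u)
     \<and> (\<forall>U' u'. root_parametrization G T \<alpha> U' u' \<longrightarrow> U' = U)"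

text \<open>The coroot of \<open>\<alpha>\<close>: the cocharacter into the group generated by the root subgroups of
  \<open>\<alpha>\<close> and its inverse (written \<open>-\<alpha>\<close> additively) whose pairing with \<open>\<alpha>\<close> is 2.\<close>

definition is_coroot ::
    "('f::field ^ 'm ^ 'm) set \<Rightarrow> ('f ^ 'm ^ 'm) set \<Rightarrow> ('f ^ 'm ^ 'm \<Rightarrow> 'f)
      \<Rightarrow> ('f \<Rightarrow> 'f ^ 'm ^ 'm) \<Rightarrow> bool" where
  "is_coroot G T \<alpha> l \<longleftrightarrow> l \<in> cocharacters T
     \<and> (\<forall>x. x \<noteq> 0 \<longrightarrow> \<alpha> (l x) = x ^ 2)
     \<and> (\<exists>U U'. is_root_subgroup G T \<alpha> U
          \<and> is_root_subgroup G T (\<lambda>t\<in>T. inverse (\<alpha> t)) U'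
          \<and> (\<forall>x. x \<noteq> 0 \<longrightarrow> l x \<in> generate GL (U \<union> U')))"


section \<open>The Weyl group\<close>

definition torus_normalizer ::
    "('f::field ^ 'm ^ 'm) set \<Rightarrow> ('f ^ 'm ^ 'm) set \<Rightarrow> ('f ^ 'm ^ 'm) set" where
  "torus_normalizer G T = normalizer (grp G) T"

definition weyl_group ::
    "('f::field ^ 'm ^ 'm) set \<Rightarrow> ('f ^ 'm ^ 'm) set \<Rightarrow> ('f ^ 'm ^ 'm) set monoid" where
  "weyl_group G T = grp (torus_normalizer G T) Mod T"

definition weyl_proj :: "('f::field ^ 'm ^ 'm) set \<Rightarrow> 'f ^ 'm ^ 'm \<Rightarrow> ('f ^ 'm ^ 'm) set" where
  "weyl_proj T g = T #>\<^bsub>GL\<^esub> g"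

text \<open>The reflection in the root \<open>\<alpha>\<close> with coroot \<open>l\<close>, as an element of the Weyl group: all
  elements of the normalizer inducing this reflection. They form one coset of \<open>T\<close> as \<open>T\<close> is its
  own centralizer.\<close>

definition reflection ::
    "('f::field ^ 'm ^ 'm) set \<Rightarrow> ('f ^ 'm ^ 'm) set \<Rightarrow> ('f ^ 'm ^ 'm \<Rightarrow> 'f)
      \<Rightarrow> ('f \<Rightarrow> 'f ^ 'm ^ 'm) \<Rightarrow> ('f ^ 'm ^ 'm) set" where
  "reflection G T \<alpha> l = {g \<in> torus_normalizer G T.
     \<forall>t\<in>T. g ** t ** matrix_inv g = t ** matrix_inv (l (\<alpha> t))}"


section \<open>Type D\<close>

text \<open>Vectors of the standard lattice are integer functions supported on \<open>{1..n}\<close>; the root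
  system of type \<open>D\<^sub>n\<close> consists of the \<open>\<plusminus>e\<^sub>i \<plusminus> e\<^sub>j\<close>.\<close>

definition unit_vec :: "nat \<Rightarrow> nat \<Rightarrow> int" where
  "unit_vec i k = (if k = i then 1 else 0)"

definition D_roots :: "nat \<Rightarrow> (nat \<Rightarrow> int) set" where
  "D_roots n = {v. \<exists>i j a b. 1 \<le> i \<and> i < j \<and> j \<le> n \<and> a \<in> {1, -1} \<and> b \<in> {1, -1}
                 \<and> v = (\<lambda>k. a * unit_vec i k + b * unit_vec j k)}"

definition dot :: "nat \<Rightarrow> (nat \<Rightarrow> int) \<Rightarrow> (nat \<Rightarrow> int) \<Rightarrow> int" where
  "dot n v w = (\<Sum>k=1..n. v k * w k)"

definition simple :: "nat \<Rightarrow> nat \<Rightarrow> nat \<Rightarrow> int" where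
  "simple n i = (if i < n then (\<lambda>k. unit_vec i k - unit_vec (Suc i) k)
                 else (\<lambda>k. unit_vec (n - 1) k + unit_vec n k))"

text \<open>\<open>rt\<close> identifies the standard root system with the roots of \<open>G\<close>, i.e. it is a bijection
  preserving Cartan integers, and \<open>cor\<close> lists the coroots. All roots have square length 2, so
  the Cartan integers are the inner products.\<close>

definition type_D ::
    "nat \<Rightarrow> ('f::field ^ 'm ^ 'm) set \<Rightarrow> ('f ^ 'm ^ 'm) set
      \<Rightarrow> ((nat \<Rightarrow> int) \<Rightarrow> 'f ^ 'm ^ 'm \<Rightarrow> 'f) \<Rightarrow> ((nat \<Rightarrow> int) \<Rightarrow> 'f \<Rightarrow> 'f ^ 'm ^ 'm) \<Rightarrow> bool" where
  "type_D n G T rt cor \<longleftrightarrow> bij_betw rt (D_roots n) (roots G T)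
     \<and> (\<forall>v\<in>D_roots n. is_coroot G T (rt v) (cor v))
     \<and> (\<forall>v\<in>D_roots n. \<forall>w\<in>D_roots n. \<forall>x. x \<noteq> 0 \<longrightarrow> rt v (cor w x) = x powi dot n v w)"

definition coroot_comb ::
    "nat \<Rightarrow> ('f::field ^ 'm ^ 'm) set \<Rightarrow> ((nat \<Rightarrow> int) \<Rightarrow> 'f \<Rightarrow> 'f ^ 'm ^ 'm)
      \<Rightarrow> (nat \<Rightarrow> int) \<Rightarrow> 'f \<Rightarrow> 'f ^ 'm ^ 'm" where
  "coroot_comb n T cor k x = finprod (grp T) (\<lambda>i. cor (simple n i) (x powi k i)) {1..n}"

text \<open>Fundamental coweights are the basis dual to the simple roots of the rational span of the
  coroot lattice; the last clause says that \<open>om\<close> lies in that span.\<close>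

definition fundamental_coweight ::
    "nat \<Rightarrow> ('f::field ^ 'm ^ 'm) set \<Rightarrow> ((nat \<Rightarrow> int) \<Rightarrow> 'f ^ 'm ^ 'm \<Rightarrow> 'f)
      \<Rightarrow> ((nat \<Rightarrow> int) \<Rightarrow> 'f \<Rightarrow> 'f ^ 'm ^ 'm) \<Rightarrow> nat \<Rightarrow> ('f \<Rightarrow> 'f ^ 'm ^ 'm) \<Rightarrow> bool" where
  "fundamental_coweight n T rt cor j om \<longleftrightarrow> om \<in> cocharacters T
     \<and> (\<forall>i\<in>{1..n}. \<forall>x. x \<noteq> 0 \<longrightarrow> rt (simple n i) (om x) = (if i = j then x else 1))
     \<and> (\<exists>m>0. \<exists>k. \<forall>x. x \<noteq> 0 \<longrightarrow> om (x ^ m) = coroot_comb n T cor k x)"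

text \<open>The cocharacter lattice is generated by the coroot lattice and \<open>om\<close>.\<close>

definition cocharacters_generated ::
    "nat \<Rightarrow> ('f::field ^ 'm ^ 'm) set \<Rightarrow> ((nat \<Rightarrow> int) \<Rightarrow> 'f \<Rightarrow> 'f ^ 'm ^ 'm)
      \<Rightarrow> ('f \<Rightarrow> 'f ^ 'm ^ 'm) \<Rightarrow> bool" where
  "cocharacters_generated n T cor om \<longleftrightarrow> om \<in> cocharacters T
     \<and> (\<forall>l\<in>cocharacters T. \<exists>k (m::int). \<forall>x. x \<noteq> 0 \<longrightarrow>
          l x = coroot_comb n T cor k x ** om (x powi m))"

definition sigma :: "((nat \<Rightarrow> int) \<Rightarrow> 'f::field \<Rightarrow> 'f ^ 'm ^ 'm) \<Rightarrow> (nat \<Rightarrow> int) \<Rightarrow> 'f ^ 'm ^ 'm" where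
  "sigma u v = u v 1 ** u (- v) (- 1) ** u v 1"

definition realization ::
    "nat \<Rightarrow> ('f::field ^ 'm ^ 'm) set \<Rightarrow> ('f ^ 'm ^ 'm) set
      \<Rightarrow> ((nat \<Rightarrow> int) \<Rightarrow> 'f ^ 'm ^ 'm \<Rightarrow> 'f) \<Rightarrow> ((nat \<Rightarrow> int) \<Rightarrow> 'f \<Rightarrow> 'f ^ 'm ^ 'm)
      \<Rightarrow> ((nat \<Rightarrow> int) \<Rightarrow> 'f \<Rightarrow> 'f ^ 'm ^ 'm) \<Rightarrow> bool" where
  "realization n G T rt cor u \<longleftrightarrow> (\<forall>v\<in>D_roots n.
       is_root_subgroup G T (rt v) (range (u v))
     \<and> root_parametrization G T (rt v) (range (u v)) (u v)
     \<and> sigma u v \<in> reflection G T (rt v) (cor v)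
     \<and> (\<forall>x. x \<noteq> 0 \<longrightarrow> u v x ** u (- v) (- inverse x) ** u v x = cor v x ** sigma u v))"

text \<open>The element of \<open>T\<close> with coordinates \<open>x 1, \<dots>, x n\<close> in the basis consisting of \<open>om\<close> and the
  simple coroots other than the first.\<close>

definition torus_elt ::
    "nat \<Rightarrow> ('f::field ^ 'm ^ 'm) set \<Rightarrow> ((nat \<Rightarrow> int) \<Rightarrow> 'f \<Rightarrow> 'f ^ 'm ^ 'm)
      \<Rightarrow> ('f \<Rightarrow> 'f ^ 'm ^ 'm) \<Rightarrow> (nat \<Rightarrow> 'f) \<Rightarrow> 'f ^ 'm ^ 'm" where
  "torus_elt n T cor om x = om (x 1) ** finprod (grp T) (\<lambda>i. cor (simple n i) (x i)) {2..n}"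


section \<open>Sections of the Weyl group\<close>

text \<open>In this section \<open>s 1, \<dots>, s n\<close> are the simple reflections.\<close>

definition weyl_word ::
    "('f::field ^ 'm ^ 'm) set \<Rightarrow> ('f ^ 'm ^ 'm) set \<Rightarrow> (nat \<Rightarrow> ('f ^ 'm ^ 'm) set)
      \<Rightarrow> nat list \<Rightarrow> ('f ^ 'm ^ 'm) set" where
  "weyl_word G T s is = foldr (\<lambda>i w. s i \<otimes>\<^bsub>weyl_group G T\<^esub> w) is \<one>\<^bsub>weyl_group G T\<^esub>"

definition reduced_word ::
    "('f::field ^ 'm ^ 'm) set \<Rightarrow> ('f ^ 'm ^ 'm) set \<Rightarrow> nat \<Rightarrow> (nat \<Rightarrow> ('f ^ 'm ^ 'm) set)
      \<Rightarrow> nat list \<Rightarrow> bool" where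
  "reduced_word G T n s is \<longleftrightarrow> set is \<subseteq> {1..n} \<and>
     (\<forall>js. set js \<subseteq> {1..n} \<and> weyl_word G T s js = weyl_word G T s is \<longrightarrow> length is \<le> length js)"

text \<open>The braid relations are imposed in the form of multiplicativity along reduced
  expressions, so that a section is determined by its values at the simple reflections.\<close>

definition is_section ::
    "('f::field ^ 'm ^ 'm) set \<Rightarrow> ('f ^ 'm ^ 'm) set \<Rightarrow> nat \<Rightarrow> (nat \<Rightarrow> ('f ^ 'm ^ 'm) set)
      \<Rightarrow> (('f ^ 'm ^ 'm) set \<Rightarrow> 'f ^ 'm ^ 'm) \<Rightarrow> bool" where
  "is_section G T n s S \<longleftrightarrow>
     S \<in> carrier (weyl_group G T) \<rightarrow>\<^sub>E torus_normalizer G T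
   \<and> (\<forall>w\<in>carrier (weyl_group G T). weyl_proj T (S w) = w)
   \<and> (\<forall>is. reduced_word G T n s is \<longrightarrow>
        S (weyl_word G T s is) = foldr (\<lambda>i g. S (s i) ** g) is (mat 1))"

definition tits_section ::
    "('f::field ^ 'm ^ 'm) set \<Rightarrow> ('f ^ 'm ^ 'm) set \<Rightarrow> nat \<Rightarrow> (nat \<Rightarrow> ('f ^ 'm ^ 'm) set)
      \<Rightarrow> (nat \<Rightarrow> 'f ^ 'm ^ 'm) \<Rightarrow> ('f ^ 'm ^ 'm) set \<Rightarrow> 'f ^ 'm ^ 'm" where
  "tits_section G T n s sg = (THE S. is_section G T n s S \<and> (\<forall>i\<in>{1..n}. S (s i) = sg i))"

text \<open>\<open>group.ord\<close> is \<open>0\<close> for elements of infinite order.\<close>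

definition elt_order :: "('f::field ^ 'm ^ 'm) set \<Rightarrow> 'f ^ 'm ^ 'm \<Rightarrow> enat" where
  "elt_order G g = (if group.ord (grp G) g = 0 then \<infinity> else enat (group.ord (grp G) g))"

definition order_profile ::
    "('f::field ^ 'm ^ 'm) set \<Rightarrow> nat \<Rightarrow> (nat \<Rightarrow> ('f ^ 'm ^ 'm) set)
      \<Rightarrow> (('f ^ 'm ^ 'm) set \<Rightarrow> 'f ^ 'm ^ 'm) \<Rightarrow> nat \<Rightarrow> enat" where
  "order_profile G n s S = (\<lambda>i\<in>{1..n}. elt_order G (S (s i)))"

text \<open>The order is reversed: smaller profiles have larger element orders.\<close>

definition profile_less :: "nat \<Rightarrow> (nat \<Rightarrow> enat) \<Rightarrow> (nat \<Rightarrow> enat) \<Rightarrow> bool" where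
  "profile_less n P' P \<longleftrightarrow> (\<forall>i\<in>{1..n}. P' i > P i)"

definition section_profiles ::
    "('f::field ^ 'm ^ 'm) set \<Rightarrow> ('f ^ 'm ^ 'm) set \<Rightarrow> nat \<Rightarrow> (nat \<Rightarrow> ('f ^ 'm ^ 'm) set)
      \<Rightarrow> (nat \<Rightarrow> enat) set" where
  "section_profiles G T n s = order_profile G n s ` {S. is_section G T n s S}"

definition optimal ::
    "('f::field ^ 'm ^ 'm) set \<Rightarrow> ('f ^ 'm ^ 'm) set \<Rightarrow> nat \<Rightarrow> (nat \<Rightarrow> ('f ^ 'm ^ 'm) set)
      \<Rightarrow> (('f ^ 'm ^ 'm) set \<Rightarrow> 'f ^ 'm ^ 'm) \<Rightarrow> bool" where
  "optimal G T n s S \<longleftrightarrow> is_section G T n s S \<and>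
     {P \<in> section_profiles G T n s. \<not> (\<exists>P'\<in>section_profiles G T n s. profile_less n P P')}
       = {order_profile G n s S}"

definition T_conjugate ::
    "('f::field ^ 'm ^ 'm) set \<Rightarrow> ('f ^ 'm ^ 'm) set \<Rightarrow> (('f ^ 'm ^ 'm) set \<Rightarrow> 'f ^ 'm ^ 'm)
      \<Rightarrow> (('f ^ 'm ^ 'm) set \<Rightarrow> 'f ^ 'm ^ 'm) \<Rightarrow> bool" where
  "T_conjugate G T S S' \<longleftrightarrow>
     (\<exists>t\<in>T. \<forall>w\<in>carrier (weyl_group G T). t ** S w ** matrix_inv t = S' w)"

text \<open>The \<open>k\<close>-th coordinate of the torus component \<open>t\<^sub>i\<close> of the section with parameters
  \<open>a, b, c\<close> and \<open>d i = a\<^sub>i\<^sub>i\<close>, for even \<open>n \<ge> 6\<close>.\<close>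

definition section_coord ::
    "nat \<Rightarrow> 'f::field \<Rightarrow> 'f \<Rightarrow> 'f \<Rightarrow> (nat \<Rightarrow> 'f) \<Rightarrow> nat \<Rightarrow> nat \<Rightarrow> 'f" where
  "section_coord n a b c d i k =
     (if i = 1 then
        (if k = 1 then inverse a
         else if k \<le> n - 2 then
           (if even k then a ^ (k div 2) else b * a ^ ((k - 3) div 2))
         else if k = n - 1 then c * (inverse a * b) ^ ((n - 2) div 2)
         else c * (inverse a * b) ^ (n div 2))
      else if k = i then d i
      else if k \<in> {n - 1, n} then c
      else 1)"

definition has_c_value ::
    "nat \<Rightarrow> ('f::field ^ 'm ^ 'm) set \<Rightarrow> ((nat \<Rightarrow> int) \<Rightarrow> 'f \<Rightarrow> 'f ^ 'm ^ 'm)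
      \<Rightarrow> ('f \<Rightarrow> 'f ^ 'm ^ 'm) \<Rightarrow> (nat \<Rightarrow> ('f ^ 'm ^ 'm) set) \<Rightarrow> (nat \<Rightarrow> 'f ^ 'm ^ 'm)
      \<Rightarrow> (('f ^ 'm ^ 'm) set \<Rightarrow> 'f ^ 'm ^ 'm) \<Rightarrow> 'f \<Rightarrow> bool" where
  "has_c_value n T cor om s sg S c \<longleftrightarrow> c ^ 2 = 1 \<and>
     (\<exists>a b d. a \<noteq> 0 \<and> b \<noteq> 0 \<and> a ^ 3 = b ^ 2 \<and> (\<forall>i\<in>{2..n}. d i \<noteq> 0) \<and>
        (\<forall>i\<in>{1..n}. S (s i) = torus_elt n T cor om (section_coord n a b c d i) ** sg i))"

end

theory Submission
  imports Defs "HOL-Algebra.Zassenhaus"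
begin

text \<open>
  Write \<open>\<sigma>\<^sub>i\<close> for the Tits lifts, \<open>s\<^sub>i(t) = t \<alpha>\<^sub>i\<^sup>\<or>(\<alpha>\<^sub>i(t))\<^sup>-\<^sup>1\<close> for the action of the simple reflections
  on \<open>T\<close>, and \<open>t\<^sub>i \<sigma>\<^sub>i\<close> for the values of a section at the simple reflections. The whole
  statement follows from one normal form: every section satisfies

    \<open>t\<^sub>i = z \<alpha>\<^sub>i\<^sup>\<or>(e\<^sub>i)\<close> for all \<open>i\<close>, with a single central \<open>z\<close>, \<open>z\<^sup>2 = 1\<close>, and arbitrary scalars \<open>e\<^sub>i\<close>.

  The centre consists of the elements \<open>z\<^sub>c = \<alpha>\<^sub>n\<^sub>-\<^sub>1\<^sup>\<or>(c) \<alpha>\<^sub>n\<^sup>\<or>(c)\<close> with \<open>c\<^sup>2 = 1\<close>, and the parameter \<open>c\<close> of the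
  section is the one in \<open>z = z\<^sub>c\<close> (lemma \<open>has_c_value_iff\<close>). Given the normal form, the squares
  \<open>(t\<^sub>i \<sigma>\<^sub>i)\<^sup>2 = \<alpha>\<^sub>i\<^sup>\<or>(-1)\<close> do not depend on the section, so neither do the orders; they are nontrivial
  unless the characteristic is 2, because a neighbouring simple root takes the value \<open>-1\<close> there.
  Conjugation by \<open>t \<in> T\<close> multiplies \<open>e\<^sub>i\<close> by \<open>\<alpha>\<^sub>i(t)\<close> and fixes \<open>z\<close>; as the simple roots can be given
  arbitrary nonzero values on \<open>T\<close>, sections are conjugate iff their central elements agree.

  The normal form comes from the braid relations (lemma \<open>section_torus_parts\<close>). For orthogonal
  \<open>\<alpha>\<^sub>i, \<alpha>\<^sub>j\<close> they give \<open>\<alpha>\<^sub>j(t\<^sub>i) = 1\<close>. For adjacent ones they give \<open>r\<^sub>i\<^sub>j = r\<^sub>j\<^sub>i\<close>, where \<open>r\<^sub>i\<^sub>j\<close> is \<open>t\<^sub>i\<close> times a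
  value of \<open>\<alpha>\<^sub>i\<^sup>\<or>\<close>. Only \<open>\<alpha>\<^sub>i\<close> and \<open>\<alpha>\<^sub>j\<close> can be nontrivial on \<open>r\<^sub>i\<^sub>j\<close>, the three edges at the branch
  node force them to be trivial there, and this spreads along the diagram, which shows that all
  \<open>r\<^sub>i\<^sub>j\<close> are central and equal.

  What makes the half-spin group special is that its cocharacter lattice pairs evenly with
  \<open>\<alpha>\<^sub>1 + \<alpha>\<^sub>3 + \<dots> + \<alpha>\<^sub>n\<^sub>-\<^sub>1\<close> (lemma \<open>cocharacter_parity\<close>). This is used twice. First, \<open>z\<^sub>c \<noteq> 1\<close> for \<open>c \<noteq> 1\<close>:
  otherwise \<open>x \<mapsto> \<alpha>\<^sub>n\<^sub>-\<^sub>1\<^sup>\<or>(x) \<alpha>\<^sub>n\<^sup>\<or>(x)\<close> would be the square of a cocharacter that violates parity.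
  Hence \<open>\<alpha>\<^sub>i\<^sup>\<or>(x) \<alpha>\<^sub>j\<^sup>\<or>(y) = 1\<close> forces \<open>x = y = 1\<close> for \<open>i \<noteq> j\<close> (lemma \<open>coroots_independent\<close>).
  Second, no element of the normalizer induces the nontrivial diagram automorphism
  (lemma \<open>act_not_swap\<close>), so the Weyl group of \<open>G\<close> is generated by the simple reflections.

  It remains to see that the Tits section exists. By Matsumoto's theorem, proved here from the
  action of the Weyl group on the roots and the height function (lemma \<open>matsumoto\<close>), this amounts to
  the braid relations for the \<open>\<sigma>\<^sub>i\<close>. Conjugation by an element of the normalizer that takes \<open>\<alpha>\<close> to \<open>\<beta>\<close>
  turns \<open>\<sigma>\<^sub>\<alpha>\<close> into \<open>\<beta>\<^sup>\<or>(c) \<sigma>\<^sub>\<beta>\<close> for some \<open>c\<close> (lemma \<open>conj_by_sigma_transport\<close>). So both sides of a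
  braid relation differ by a value of one simple coroot and, reading the relation backwards, also
  by a value of the other one; independence of the two coroots makes both values trivial.
\<close>

section \<open>The root system of type D\<close>

lemma dot_add_left: "dot n (\<lambda>k. v k + w k) u = dot n v u + dot n w u"
  by (simp add: dot_def algebra_simps sum.distrib)

lemma dot_uminus_left: "dot n (- v) u = - dot n v u"
  by (simp add: dot_def sum_negf)

lemma dot_diff_scale_left: "dot n (\<lambda>k. v k - c * w k) u = dot n v u - c * dot n w u"
  by (simp add: dot_def algebra_simps sum_subtractf sum_distrib_left)

lemma dot_commute: "dot n v w = dot n w v"
  by (simp add: dot_def mult.commute)

lemma dot_unit_vec: "i \<in> {1..n} \<Longrightarrow> dot n (unit_vec i) v = v i"
proof -
  assume i: "i \<in> {1..n}"
  have "dot n (unit_vec i) v = (\<Sum>k=1..n. if k = i then v k else 0)"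
    unfolding dot_def by (rule sum.cong) (auto simp: unit_vec_def)
  then show ?thesis using i by simp
qed

lemma dot_two_coordinates:
  assumes "i \<in> {1..n}" "j \<in> {1..n}"
  shows "dot n (\<lambda>k. a * unit_vec i k + b * unit_vec j k) v = a * v i + b * v j"
proof -
  have "dot n (\<lambda>k. a * unit_vec i k + b * unit_vec j k) v
      = a * dot n (unit_vec i) v + b * dot n (unit_vec j) v"
    by (simp add: dot_def algebra_simps sum.distrib sum_distrib_left)
  then show ?thesis using assms by (simp add: dot_unit_vec)
qed

lemma square_le_two_int: "(x::int) * x \<le> 2 \<Longrightarrow> x \<noteq> 0 \<Longrightarrow> x \<in> {1, -1}"
proof -
  assume a: "x * x \<le> 2" "x \<noteq> 0"
  have "\<bar>x\<bar> < 2"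
  proof (rule ccontr)
    assume "\<not> \<bar>x\<bar> < 2"
    then have "2 * 2 \<le> \<bar>x\<bar> * \<bar>x\<bar>" by (intro mult_mono) auto
    then show False using a by (simp add: abs_mult_self_eq)
  qed
  then show ?thesis using a(2) by auto
qed

text \<open>A vector of squared length 2 in the integer lattice has exactly two nonzero entries, both \<open>\<plusminus>1\<close>.
  In this form closure of the root system under addition and reflection is a computation of
  lengths.\<close>

lemma D_roots_eq:
  "D_roots n = {v. (\<forall>k. k \<notin> {1..n} \<longrightarrow> v k = 0) \<and> dot n v v = 2}" (is "_ = ?R")
proof
  show "D_roots n \<subseteq> ?R"
  proof
    fix v assume "v \<in> D_roots n"
    then obtain i j a b where *: "1 \<le> i" "i < j" "j \<le> n" "a \<in> {1, -1::int}" "b \<in> {1, -1::int}"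
      and v: "v = (\<lambda>k. a * unit_vec i k + b * unit_vec j k)" unfolding D_roots_def by blast
    have "dot n v v = a * v i + b * v j"
      by (subst (1) v, rule dot_two_coordinates) (use * in auto)
    also have "\<dots> = 2" using * by (auto simp: v unit_vec_def)
    finally show "v \<in> ?R" using * by (auto simp: v unit_vec_def)
  qed
  show "?R \<subseteq> D_roots n"
  proof
    fix v assume "v \<in> ?R"
    then have supp: "\<And>k. k \<notin> {1..n} \<Longrightarrow> v k = 0" and norm: "(\<Sum>k=1..n. v k * v k) = 2"
      by (auto simp: dot_def)
    have sq: "0 \<le> v k * v k" for k by simp
    have "\<exists>i\<in>{1..n}. v i \<noteq> 0"
    proof (rule ccontr)
      assume "\<not> ?thesis"
      then have "(\<Sum>k=1..n. v k * v k) = 0" by (intro sum.neutral) auto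
      with norm show False by simp
    qed
    then obtain i where i: "i \<in> {1..n}" "v i \<noteq> 0" by blast
    have s1: "(\<Sum>k=1..n. v k * v k) = v i * v i + (\<Sum>k\<in>{1..n} - {i}. v k * v k)"
      using i by (intro sum.remove) auto
    have "0 \<le> (\<Sum>k\<in>{1..n} - {i}. v k * v k)" by (intro sum_nonneg) auto
    with s1 norm have "v i * v i \<le> 2" by linarith
    then have vi: "v i \<in> {1, -1}" using i square_le_two_int by blast
    then have r1: "(\<Sum>k\<in>{1..n} - {i}. v k * v k) = 1" using s1 norm by auto
    have "\<exists>j\<in>{1..n} - {i}. v j \<noteq> 0"
    proof (rule ccontr)
      assume "\<not> ?thesis"
      then have "(\<Sum>k\<in>{1..n} - {i}. v k * v k) = 0" by (intro sum.neutral) auto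
      with r1 show False by simp
    qed
    then obtain j where j: "j \<in> {1..n} - {i}" "v j \<noteq> 0" by blast
    have s2: "(\<Sum>k\<in>{1..n} - {i}. v k * v k) = v j * v j + (\<Sum>k\<in>{1..n} - {i} - {j}. v k * v k)"
      using j by (intro sum.remove) auto
    have nn: "0 \<le> (\<Sum>k\<in>{1..n} - {i} - {j}. v k * v k)" by (intro sum_nonneg) auto
    with s2 r1 have "v j * v j \<le> 2" by linarith
    then have vj: "v j \<in> {1, -1}" using j square_le_two_int by blast
    then have "(\<Sum>k\<in>{1..n} - {i} - {j}. v k * v k) = 0" using s2 r1 by auto
    then have "\<forall>k\<in>{1..n} - {i} - {j}. v k * v k = 0" by (subst (asm) sum_nonneg_eq_0_iff) auto
    then have rest: "v k = 0" if "k \<noteq> i" "k \<noteq> j" for k using that supp by (cases "k \<in> {1..n}") auto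
    have eq: "v = (\<lambda>k. v i * unit_vec i k + v j * unit_vec j k)"
      using rest j by (auto simp: unit_vec_def fun_eq_iff)
    show "v \<in> D_roots n"
    proof (cases "i < j")
      case True
      then have "1 \<le> i \<and> i < j \<and> j \<le> n \<and> v i \<in> {1, -1} \<and> v j \<in> {1, -1}
          \<and> v = (\<lambda>k. v i * unit_vec i k + v j * unit_vec j k)"
        using eq vi vj i j by simp
      then show ?thesis unfolding D_roots_def by blast
    next
      case False
      then have "j < i" using j by auto
      moreover have "v = (\<lambda>k. v j * unit_vec j k + v i * unit_vec i k)"
        by (subst eq) (simp add: add.commute)
      ultimately have "1 \<le> j \<and> j < i \<and> i \<le> n \<and> v j \<in> {1, -1} \<and> v i \<in> {1, -1}
          \<and> v = (\<lambda>k. v j * unit_vec j k + v i * unit_vec i k)"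
        using vi vj i j by simp
      then show ?thesis unfolding D_roots_def by blast
    qed
  qed
qed

lemma finite_D_roots: "finite (D_roots n)"
proof -
  have "D_roots n \<subseteq> (\<lambda>(i, j, a, b) k. a * unit_vec i k + b * unit_vec j k)
      ` ({1..n} \<times> {1..n} \<times> {1, -1} \<times> {1, -1})"
  proof
    fix v assume "v \<in> D_roots n"
    then obtain i j a b where "1 \<le> i" "i < j" "j \<le> n" "a \<in> {1, -1::int}" "b \<in> {1, -1::int}"
      and v: "v = (\<lambda>k. a * unit_vec i k + b * unit_vec j k)" unfolding D_roots_def by blast
    then have "(i, j, a, b) \<in> {1..n} \<times> {1..n} \<times> {1, -1} \<times> {1, -1}" by auto
    then show "v \<in> (\<lambda>(i, j, a, b) k. a * unit_vec i k + b * unit_vec j k)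
      ` ({1..n} \<times> {1..n} \<times> {1, -1} \<times> {1, -1})"
      by (rule rev_image_eqI) (simp add: v)
  qed
  then show ?thesis by (rule finite_subset) auto
qed

lemma D_roots_uminus: "v \<in> D_roots n \<Longrightarrow> - v \<in> D_roots n"
  by (auto simp: D_roots_eq dot_def)

lemma D_roots_norm: "v \<in> D_roots n \<Longrightarrow> dot n v v = 2"
  by (simp add: D_roots_eq)

lemma D_roots_support: "v \<in> D_roots n \<Longrightarrow> k \<notin> {1..n} \<Longrightarrow> v k = 0"
  by (simp add: D_roots_eq)

text \<open>The squared distance of \<open>v\<close> and \<open>w\<close> is \<open>4 - 2 (v, w)\<close>, which is positive unless \<open>v = w\<close>.\<close>

lemma D_roots_dot_le_1:
  assumes "v \<in> D_roots n" "w \<in> D_roots n" "v \<noteq> w"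
  shows "dot n v w \<le> 1"
proof (rule ccontr)
  assume "\<not> dot n v w \<le> 1"
  moreover have "(\<Sum>k=1..n. (v k - w k) * (v k - w k)) = dot n v v + dot n w w - 2 * dot n v w"
    by (simp add: dot_def algebra_simps sum.distrib sum_subtractf sum_distrib_left)
  ultimately have "(\<Sum>k=1..n. (v k - w k) * (v k - w k)) \<le> 0"
    using assms D_roots_norm by simp
  moreover have "0 \<le> (\<Sum>k=1..n. (v k - w k) * (v k - w k))" by (intro sum_nonneg) auto
  ultimately have "\<forall>k\<in>{1..n}. (v k - w k) * (v k - w k) = 0"
    by (subst sum_nonneg_eq_0_iff[symmetric]) auto
  then have "v k = w k" for k
    using D_roots_support[OF assms(1)] D_roots_support[OF assms(2)] by (cases "k \<in> {1..n}") auto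
  then show False using assms(3) by auto
qed

lemma D_roots_add_iff:
  assumes "v \<in> D_roots n" "w \<in> D_roots n"
  shows "(\<lambda>k. v k + w k) \<in> D_roots n \<longleftrightarrow> dot n v w = -1"
proof -
  have "dot n (\<lambda>k. v k + w k) (\<lambda>k. v k + w k) = dot n v v + dot n w w + 2 * dot n v w"
    by (simp add: dot_def algebra_simps sum.distrib sum_distrib_left)
  then show ?thesis using assms D_roots_norm[OF assms(1)] D_roots_norm[OF assms(2)]
    by (auto simp: D_roots_eq)
qed

definition root_refl :: "nat \<Rightarrow> (nat \<Rightarrow> int) \<Rightarrow> (nat \<Rightarrow> int) \<Rightarrow> nat \<Rightarrow> int" where
  "root_refl n a v = (\<lambda>k. v k - dot n v a * a k)"

lemma refl_root:
  assumes "a \<in> D_roots n" "v \<in> D_roots n"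
  shows "root_refl n a v \<in> D_roots n"
proof -
  have "dot n (root_refl n a v) (root_refl n a v)
      = dot n v v - 2 * dot n v a * dot n v a + dot n v a * dot n v a * dot n a a"
  proof -
    have "dot n (root_refl n a v) (root_refl n a v) = dot n v (root_refl n a v) - dot n v a * dot n a (root_refl n a v)"
      by (subst (1) root_refl_def) (rule dot_diff_scale_left)
    also have "dot n v (root_refl n a v) = dot n v v - dot n v a * dot n v a"
      by (subst dot_commute, subst root_refl_def, subst dot_diff_scale_left) (simp add: dot_commute)
    also have "dot n a (root_refl n a v) = dot n v a - dot n v a * dot n a a"
      by (subst dot_commute, subst root_refl_def, subst dot_diff_scale_left) (simp add: dot_commute)
    finally show ?thesis by (simp add: algebra_simps)
  qed
  then have "dot n (root_refl n a v) (root_refl n a v) = 2"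
    using D_roots_norm[OF assms(1)] D_roots_norm[OF assms(2)] by simp
  then show ?thesis using D_roots_support[OF assms(1)] D_roots_support[OF assms(2)]
    by (auto simp: D_roots_eq root_refl_def)
qed

lemma refl_self: "a \<in> D_roots n \<Longrightarrow> root_refl n a a = - a"
  by (auto simp: root_refl_def D_roots_norm)

lemma refl_refl: "a \<in> D_roots n \<Longrightarrow> root_refl n a (root_refl n a v) = v"
proof -
  assume a: "a \<in> D_roots n"
  have "dot n (root_refl n a v) a = - dot n v a"
    unfolding root_refl_def dot_diff_scale_left D_roots_norm[OF a] by simp
  then show ?thesis by (simp add: root_refl_def fun_eq_iff)
qed

text \<open>Adjacency in the Dynkin diagram: the chain \<open>1, \<dots>, n - 1\<close> with \<open>n\<close> attached to \<open>n - 2\<close>.\<close>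

definition adj :: "nat \<Rightarrow> nat \<Rightarrow> nat \<Rightarrow> bool" where
  "adj n i j \<longleftrightarrow> i < n \<and> j < n \<and> (i = Suc j \<or> j = Suc i) \<or> i = n \<and> j = n - 2 \<or> j = n \<and> i = n - 2"

lemma adj_sym: "adj n i j \<longleftrightarrow> adj n j i"
  by (auto simp: adj_def)

lemma dot_simple:
  assumes "2 \<le> n" "i \<in> {1..n}"
  shows "dot n (simple n i) v = (if i < n then v i - v (Suc i) else v (n - 1) + v n)"
  using assms dot_two_coordinates[of i n "Suc i" 1 "-1" v] dot_two_coordinates[of "n - 1" n n 1 1 v]
  by (auto simp: simple_def)

lemma simple_root: "2 \<le> n \<Longrightarrow> i \<in> {1..n} \<Longrightarrow> simple n i \<in> D_roots n"
  unfolding D_roots_eq by (auto simp: dot_simple) (auto simp: simple_def unit_vec_def)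

lemma cartan_D:
  assumes "3 \<le> n" "i \<in> {1..n}" "j \<in> {1..n}"
  shows "dot n (simple n i) (simple n j) = (if i = j then 2 else if adj n i j then -1 else 0)"
  using assms by (auto simp: dot_simple) (auto simp: simple_def unit_vec_def adj_def)

lemma simple_inj:
  assumes "3 \<le> n" "i \<in> {1..n}" "j \<in> {1..n}" "simple n i = simple n j"
  shows "i = j"
  using cartan_D[OF assms(1-3)] cartan_D[OF assms(1,2,2)] assms(4) by (auto split: if_splits)

text \<open>The pairing with half the sum of the positive coroots, which is the vector \<open>(n - 1, \<dots>, 1, 0)\<close>. A
  root is positive iff its height is, and simple iff its height is 1.\<close>

definition height :: "nat \<Rightarrow> (nat \<Rightarrow> int) \<Rightarrow> int" where
  "height n v = dot n v (\<lambda>k. int n - int k)"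

lemma height_add: "height n (\<lambda>k. v k + w k) = height n v + height n w"
  by (simp add: height_def dot_add_left)

lemma height_uminus: "height n (- v) = - height n v"
  by (simp add: height_def dot_uminus_left)

lemma height_simple: "2 \<le> n \<Longrightarrow> i \<in> {1..n} \<Longrightarrow> height n (simple n i) = 1"
  by (auto simp: height_def dot_simple)

lemma D_roots_cases:
  assumes "v \<in> D_roots n"
  obtains i j a b where "1 \<le> i" "i < j" "j \<le> n" "a \<in> {1, -1}" "b \<in> {1, -1}"
    "v = (\<lambda>k. a * unit_vec i k + b * unit_vec j k)"
    "height n v = a * (int n - int i) + b * (int n - int j)"
proof -
  obtain i j a b where *: "1 \<le> i" "i < j" "j \<le> n" "a \<in> {1, -1::int}" "b \<in> {1, -1::int}"
      and v: "v = (\<lambda>k. a * unit_vec i k + b * unit_vec j k)" 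
    using assms unfolding D_roots_def by blast
  have "height n v = a * (int n - int i) + b * (int n - int j)"
    unfolding v height_def by (subst dot_two_coordinates) (use * in auto)
  then show ?thesis using that * v by blast
qed

lemma height_nonzero: "v \<in> D_roots n \<Longrightarrow> height n v \<noteq> 0"
  by (erule D_roots_cases) auto

lemma height_1_simple:
  assumes "v \<in> D_roots n" "height n v = 1"
  shows "\<exists>i\<in>{1..n}. v = simple n i"
  using assms(1)
proof (rule D_roots_cases)
  fix i j a b assume *: "1 \<le> i" "i < j" "j \<le> n" "a \<in> {1, -1}" "b \<in> {1, -1}"
    "v = (\<lambda>k. a * unit_vec i k + b * unit_vec j k)"
    "height n v = a * (int n - int i) + b * (int n - int j)"
  then have "a = 1" using assms(2) by auto
  moreover have "b = -1 \<Longrightarrow> j = Suc i" "b = 1 \<Longrightarrow> i = n - 1 \<and> j = n"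
    using * assms(2) \<open>a = 1\<close> by auto
  ultimately show ?thesis using * by (auto simp: simple_def fun_eq_iff)
qed

text \<open>Inductions over the height descend by subtracting such a simple root, which leaves a root of
  smaller positive height.\<close>

lemma height_ge_2_simple:
  assumes "2 \<le> n" "v \<in> D_roots n" "height n v \<ge> 2"
  shows "\<exists>i\<in>{1..n}. dot n (simple n i) v = 1"
  using assms(2)
proof (rule D_roots_cases)
  fix i j a b assume *: "1 \<le> i" "i < j" "j \<le> n" "a \<in> {1, -1}" "b \<in> {1, -1}"
    and v: "v = (\<lambda>k. a * unit_vec i k + b * unit_vec j k)"
    and h: "height n v = a * (int n - int i) + b * (int n - int j)"
  have a: "a = 1" using * h assms(3) by auto
  show ?thesis
  proof (cases "Suc i < j")
    case True
    then show ?thesis using * a v by (intro bexI[of _ i]) (auto simp: dot_simple unit_vec_def)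
  next
    case False
    then have j: "j = Suc i" using * by auto
    then have b: "b = 1" "j < n" using * a h assms(3) by auto
    show ?thesis using * a b v j by (intro bexI[of _ j]) (auto simp: dot_simple unit_vec_def)
  qed
qed

text \<open>The simple roots span the rational space, so they separate vectors supported on \<open>{1..n}\<close>.\<close>

lemma dot_simple_ext:
  assumes "2 \<le> n" "\<And>i. i \<in> {1..n} \<Longrightarrow> dot n (simple n i) v = dot n (simple n i) w"
    "\<And>k. k \<notin> {1..n} \<Longrightarrow> v k = w k"
  shows "v = w"
proof -
  define y where "y = (\<lambda>k. v k - w k)"
  have step: "y k = y (Suc k)" if "1 \<le> k" "k < n" for k
    using assms(2)[of k] assms(1) that by (auto simp: dot_simple y_def)
  have const: "k \<le> n \<Longrightarrow> 1 \<le> k \<Longrightarrow> y k = y n" for k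
    by (induction rule: inc_induct) (use step in auto)
  have "y (n - 1) + y n = 0" using assms(2)[of n] assms(1) by (auto simp: dot_simple y_def)
  then have "y n = 0" using const[of "n - 1"] assms(1) by auto
  then have "y k = 0" for k using const[of k] assms(3)[of k] by (cases "k \<in> {1..n}") (auto simp: y_def)
  then show ?thesis by (auto simp: y_def fun_eq_iff)
qed

lemma D_node_cases:
  fixes i n :: nat
  assumes "i \<in> {1..n}"
  obtains (chain) "i \<le> n - 3" | (branch) "i = n - 2" | (left) "i = n - 1" | (right) "i = n"
proof -
  have "i \<le> n" using assms by simp
  then have "i \<le> n - 3 \<or> i = n - 2 \<or> i = n - 1 \<or> i = n" by linarith
  then show ?thesis using that by blast
qed

text \<open>The coroot lattice pairs evenly with \<open>\<alpha>\<^sub>1 + \<alpha>\<^sub>3 + \<dots> + \<alpha>\<^sub>n\<^sub>-\<^sub>1\<close>: for even \<open>n\<close> this sum is the vector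
  \<open>(1, -1, \<dots>, 1, -1)\<close>, which modulo 2 reads off the sum of all coordinates.\<close>

lemma simple_alternating_sum_even:
  assumes n: "6 \<le> n" "even n" and i: "i \<in> {1..n}"
  shows "even (\<Sum>q<n div 2. dot n (simple n (2 * q + 1)) (simple n i))"
proof -
  let ?v = "simple n i"
  have "dot n (simple n (2 * q + 1)) ?v = ?v (2 * q + 1) - ?v (2 * q + 2)" if "q < n div 2" for q
    using that n by (subst dot_simple) auto
  then have "(\<Sum>q<n div 2. dot n (simple n (2 * q + 1)) ?v) = (\<Sum>q<n div 2. ?v (2 * q + 1) - ?v (2 * q + 2))"
    by (intro sum.cong) auto
  moreover have "even ((\<Sum>q<N. ?v (2 * q + 1) - ?v (2 * q + 2)) - (\<Sum>p=1..2 * N. ?v p))" for N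
    by (induction N) (auto simp: algebra_simps)
  from this[of "n div 2"]
  have "even ((\<Sum>q<n div 2. ?v (2 * q + 1) - ?v (2 * q + 2)) - (\<Sum>p=1..n. ?v p))"
    by (simp only: dvd_mult_div_cancel[OF n(2)])
  moreover have "(\<Sum>p=1..n. ?v p) = dot n ?v (\<lambda>_. 1)" by (simp add: dot_def)
  then have "even (\<Sum>p=1..n. ?v p)" using n i by (simp add: dot_simple)
  ultimately show ?thesis by simp
qed

text \<open>The branch node is the only one with three neighbours, and its neighbour in the long arm is the
  only one of the three that is not a leaf. From there on an automorphism has no choice along the
  long arm; only the two leaves can be exchanged. (For \<open>n = 4\<close> all three arms are leaves.)\<close>

lemma D_diagram_automorphism:
  assumes n: "5 \<le> n" and ran: "\<And>i. i \<in> {1..n} \<Longrightarrow> \<pi> i \<in> {1..n}"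
    and inj: "inj_on \<pi> {1..n}"
    and adj: "\<And>i j. i \<in> {1..n} \<Longrightarrow> j \<in> {1..n} \<Longrightarrow> adj n i j \<Longrightarrow> adj n (\<pi> i) (\<pi> j)"
  shows "(\<forall>i\<in>{1..n - 2}. \<pi> i = i)
    \<and> (\<pi> (n - 1) = n - 1 \<and> \<pi> n = n \<or> \<pi> (n - 1) = n \<and> \<pi> n = n - 1)"
proof -
  have neq: "\<pi> i \<noteq> \<pi> j" if "i \<in> {1..n}" "j \<in> {1..n}" "i \<noteq> j" for i j
    using inj that by (auto dest: inj_onD)
  have branch: "k = n - 2" if "adj n k a" "adj n k b" "adj n k c" "a \<noteq> b" "a \<noteq> c" "b \<noteq> c" for k a b c
    using that n unfolding adj_def by linarith
  have p2: "\<pi> (n - 2) = n - 2"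
  proof (rule branch)
    show "adj n (\<pi> (n - 2)) (\<pi> (n - 3))" "adj n (\<pi> (n - 2)) (\<pi> (n - 1))" "adj n (\<pi> (n - 2)) (\<pi> n)"
    proof -
      have "adj n (n - 2) (n - 3)" "adj n (n - 2) (n - 1)" "adj n (n - 2) n"
        using n unfolding adj_def by linarith+
      then show "adj n (\<pi> (n - 2)) (\<pi> (n - 3))" "adj n (\<pi> (n - 2)) (\<pi> (n - 1))" "adj n (\<pi> (n - 2)) (\<pi> n)"
        using n adj by auto
    qed
    show "\<pi> (n - 3) \<noteq> \<pi> (n - 1)" "\<pi> (n - 3) \<noteq> \<pi> n" "\<pi> (n - 1) \<noteq> \<pi> n"
      by (rule neq; use n in auto)+
  qed
  have p3: "\<pi> (n - 3) = n - 3"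
  proof -
    have "adj n (n - 3) (n - 2)" using n unfolding adj_def by linarith
    then have a1: "adj n (\<pi> (n - 3)) (n - 2)" using adj[of "n - 3" "n - 2"] n p2 by auto
    have a2: "adj n (\<pi> (n - 3)) (\<pi> (n - 4))" proof (rule adj)
      show "adj n (n - 3) (n - 4)" using n unfolding adj_def by linarith
    qed (use n in auto)
    have "\<pi> (n - 4) \<noteq> n - 2" using neq[of "n - 4" "n - 2"] p2 n by auto
    then show ?thesis using a1 a2 n unfolding adj_def by linarith
  qed
  have that_low: "\<pi> k = k \<and> \<pi> (Suc k) = Suc k" if "1 \<le> k" "k \<le> n - 3" for k
    using that(2,1)
  proof (induction k rule: inc_induct)
    case base
    have "Suc (n - 3) = n - 2" using n by simp
    then show ?case using p2 p3 by simp
  next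
    case (step k)
    then have IH: "\<pi> (Suc k) = Suc k" "\<pi> (Suc (Suc k)) = Suc (Suc k)" by auto
    have "adj n k (Suc k)" using step n unfolding adj_def by linarith
    then have a: "adj n (\<pi> k) (Suc k)" using adj[of k "Suc k"] IH step n by simp
    have "\<pi> k \<noteq> Suc (Suc k)" using neq[of k "Suc (Suc k)"] IH step n by auto
    moreover have "Suc k \<le> n - 3" using step by simp
    ultimately have "\<pi> k = k" using a n unfolding adj_def by linarith
    then show ?case using IH by simp
  qed
  have low: "\<forall>i\<in>{1..n - 2}. \<pi> i = i"
  proof (intro ballI)
    fix i assume i: "i \<in> {1..n - 2}"
    show "\<pi> i = i" using p2 that_low[of i] i by (cases "i = n - 2") auto
  qed
  have t: "\<pi> k = n - 1 \<or> \<pi> k = n" if k: "k = n - 1 \<or> k = n" for k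
  proof -
    have "adj n k (n - 2)" using k n unfolding adj_def by linarith
    then have adj': "adj n (\<pi> k) (n - 2)" using adj[of k "n - 2"] k p2 n by auto
    have "k \<noteq> n - 3" using k n by linarith
    moreover have "1 \<le> n - 3" "n - 3 \<le> n" "1 \<le> k" "k \<le> n" using k n by linarith+
    ultimately have "\<pi> k \<noteq> n - 3" using neq[of k "n - 3"] p3 by simp
    with adj' show ?thesis using n unfolding adj_def by linarith
  qed
  have "n - 1 \<in> {1..n}" "n \<in> {1..n}" "n - 1 \<noteq> n" using n by simp_all
  then have "\<pi> (n - 1) \<noteq> \<pi> n" by (rule neq)
  then show ?thesis using low t[of "n - 1"] t[of n] by auto
qed

text \<open>A simple reflection permutes the positive roots other than its own: it changes the height by at
  most 1 there, and does not lower the height of another simple root.\<close>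

lemma refl_positive:
  assumes n: "3 \<le> n" and i: "i \<in> {1..n}" and v: "v \<in> D_roots n" "0 < height n v" "v \<noteq> simple n i"
  shows "0 < height n (root_refl n (simple n i) v)"
proof -
  have h: "height n (root_refl n (simple n i) v) = height n v - dot n v (simple n i)"
    using n i by (simp add: height_def root_refl_def dot_diff_scale_left) (simp flip: height_def add: height_simple)
  show ?thesis
  proof (cases "height n v = 1")
    case True
    then obtain j where j: "j \<in> {1..n}" "v = simple n j" using v height_1_simple by blast
    then have "dot n v (simple n i) \<le> 0" using v n i by (auto simp: cartan_D)
    then show ?thesis using h v by simp
  next
    case False
    have "dot n v (simple n i) \<le> 1" using v i n by (intro D_roots_dot_le_1 simple_root) auto
    then show ?thesis using h v False by simp
  qed
qed

section \<open>Reduced words in a group acting on the roots\<close>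

text \<open>A group acting additively on the roots, with elements \<open>s i\<close> acting as the simple reflections and
  with no nontrivial element permuting the simple roots. This is all that the theory of reduced
  words needs; generation by the \<open>s i\<close> is a consequence.\<close>

locale weyl_action = group W for W (structure) +
  fixes n :: nat and s :: "nat \<Rightarrow> 'a" and act :: "'a \<Rightarrow> (nat \<Rightarrow> int) \<Rightarrow> nat \<Rightarrow> int"
  assumes rank: "3 \<le> n"
    and s_closed [simp, intro]: "i \<in> {1..n} \<Longrightarrow> s i \<in> carrier W"
    and act_root: "w \<in> carrier W \<Longrightarrow> v \<in> D_roots n \<Longrightarrow> act w v \<in> D_roots n"
    and act_one: "v \<in> D_roots n \<Longrightarrow> act \<one> v = v"
    and act_mult: "w \<in> carrier W \<Longrightarrow> w' \<in> carrier W \<Longrightarrow> v \<in> D_roots n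
      \<Longrightarrow> act (w \<otimes> w') v = act w (act w' v)"
    and act_add: "w \<in> carrier W \<Longrightarrow> v \<in> D_roots n \<Longrightarrow> v' \<in> D_roots n
      \<Longrightarrow> (\<lambda>k. v k + v' k) \<in> D_roots n \<Longrightarrow> act w (\<lambda>k. v k + v' k) = (\<lambda>k. act w v k + act w v' k)"
    and act_uminus: "w \<in> carrier W \<Longrightarrow> v \<in> D_roots n \<Longrightarrow> act w (- v) = - act w v"
    and act_s: "i \<in> {1..n} \<Longrightarrow> v \<in> D_roots n \<Longrightarrow> act (s i) v = root_refl n (simple n i) v"
    and rigid: "w \<in> carrier W \<Longrightarrow> (\<And>i. i \<in> {1..n} \<Longrightarrow> act w (simple n i) \<in> simple n ` {1..n})
      \<Longrightarrow> w = \<one>"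
begin

lemma simple_D [simp]: "i \<in> {1..n} \<Longrightarrow> simple n i \<in> D_roots n"
  using rank by (intro simple_root) auto

lemma act_inv_cancel: "w \<in> carrier W \<Longrightarrow> v \<in> D_roots n \<Longrightarrow> act w (act (inv w) v) = v"
  "w \<in> carrier W \<Longrightarrow> v \<in> D_roots n \<Longrightarrow> act (inv w) (act w v) = v"
  by (simp_all add: act_one flip: act_mult)

lemma s_square: "i \<in> {1..n} \<Longrightarrow> s i \<otimes> s i = \<one>"
  by (rule rigid) (auto simp: act_mult act_s refl_root refl_refl)

lemma s_inv: "i \<in> {1..n} \<Longrightarrow> inv (s i) = s i"
  by (rule inv_equality) (auto simp: s_square)

lemma s_s_cancel: "i \<in> {1..n} \<Longrightarrow> w \<in> carrier W \<Longrightarrow> s i \<otimes> (s i \<otimes> w) = w"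
  by (simp add: s_square flip: m_assoc)

lemma act_faithful:
  assumes "w \<in> carrier W" "w' \<in> carrier W" "\<And>v. v \<in> D_roots n \<Longrightarrow> act w v = act w' v"
  shows "w = w'"
proof -
  have "inv w' \<otimes> w = \<one>"
    by (rule rigid) (use assms in \<open>auto simp: act_mult act_inv_cancel\<close>)
  then show ?thesis using assms(1,2) by (metis inv_equality inv_inv inv_closed)
qed

lemma s_comm:
  assumes "i \<in> {1..n}" "j \<in> {1..n}" "i \<noteq> j" "\<not> adj n i j"
  shows "s i \<otimes> s j = s j \<otimes> s i"
proof (rule act_faithful)
  have c: "dot n (simple n i) (simple n j) = 0" "dot n (simple n j) (simple n i) = 0"
    using assms rank by (auto simp: cartan_D adj_sym)
  show "act (s i \<otimes> s j) v = act (s j \<otimes> s i) v" if "v \<in> D_roots n" for v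
    using that assms by (simp add: act_mult act_s refl_root)
      (simp add: root_refl_def dot_diff_scale_left c fun_eq_iff)
qed (use assms in auto)

lemma s_braid:
  assumes "i \<in> {1..n}" "j \<in> {1..n}" "adj n i j"
  shows "s i \<otimes> (s j \<otimes> s i) = s j \<otimes> (s i \<otimes> s j)"
proof (rule act_faithful)
  have "i \<noteq> j" using assms rank by (auto simp: adj_def)
  then have c: "dot n (simple n i) (simple n j) = -1" "dot n (simple n j) (simple n i) = -1"
      "dot n (simple n i) (simple n i) = 2" "dot n (simple n j) (simple n j) = 2"
    using assms rank by (auto simp: cartan_D adj_sym)
  show "act (s i \<otimes> (s j \<otimes> s i)) v = act (s j \<otimes> (s i \<otimes> s j)) v" if "v \<in> D_roots n" for v
    using that assms by (simp add: act_mult act_s refl_root)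
      (unfold root_refl_def dot_diff_scale_left c, simp add: algebra_simps fun_eq_iff)
qed (use assms in auto)

lemma act_inv_s_mult:
  assumes "i \<in> {1..n}" "w \<in> carrier W" "v \<in> D_roots n"
  shows "act (inv (s i \<otimes> w)) v = act (inv w) (root_refl n (simple n i) v)"
  using assms by (simp add: inv_mult_group s_inv act_mult act_s)

text \<open>The positive roots made negative by \<open>w\<^sup>-\<^sup>1\<close>. Their number turns out to be the length of \<open>w\<close>.\<close>

definition inversions :: "'a \<Rightarrow> (nat \<Rightarrow> int) set" where
  "inversions w = {v \<in> D_roots n. 0 < height n v \<and> height n (act (inv w) v) < 0}"

definition len :: "'a \<Rightarrow> nat" where
  "len w = card (inversions w)"

definition descent :: "nat \<Rightarrow> 'a \<Rightarrow> bool" where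
  "descent i w \<longleftrightarrow> height n (act (inv w) (simple n i)) < 0"

lemma finite_inversions [simp]: "finite (inversions w)"
  unfolding inversions_def by (rule finite_subset[OF _ finite_D_roots]) auto

lemma descent_s_mult:
  assumes "i \<in> {1..n}" "w \<in> carrier W"
  shows "descent i (s i \<otimes> w) \<longleftrightarrow> \<not> descent i w"
proof -
  have "act (inv w) (simple n i) \<in> D_roots n" using assms by (intro act_root) auto
  from height_nonzero[OF this] show ?thesis
    using assms by (auto simp: descent_def act_inv_s_mult refl_self act_uminus height_uminus)
qed

text \<open>The reflection \<open>s i\<close> matches the inversions of \<open>w\<close> with those of \<open>s i \<otimes> w\<close> other than \<open>\<alpha>\<^sub>i\<close>.\<close>

lemma len_s_mult_ascent:
  assumes i: "i \<in> {1..n}" and w: "w \<in> carrier W" and asc: "\<not> descent i w"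
  shows "len (s i \<otimes> w) = Suc (len w)"
proof -
  let ?r = "root_refl n (simple n i)"
  have rr: "?r (?r v) = v" for v using i by (intro refl_refl) auto
  have in1: "simple n i \<in> inversions (s i \<otimes> w)"
    using i w asc descent_s_mult[OF i w] rank by (auto simp: inversions_def descent_def height_simple)
  have notin: "simple n i \<notin> inversions w" using asc by (simp add: inversions_def descent_def)
  have "inversions (s i \<otimes> w) - {simple n i} = ?r ` inversions w"
  proof
    show "inversions (s i \<otimes> w) - {simple n i} \<subseteq> ?r ` inversions w"
    proof
      fix v assume v: "v \<in> inversions (s i \<otimes> w) - {simple n i}"
      then have "v \<in> D_roots n" "0 < height n v" "height n (act (inv w) (?r v)) < 0"
        using i w by (auto simp: inversions_def act_inv_s_mult)
      then have "?r v \<in> inversions w"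
        using v refl_positive[OF rank i] i by (auto simp: inversions_def refl_root)
      then show "v \<in> ?r ` inversions w" by (rule rev_image_eqI) (simp add: rr)
    qed
    show "?r ` inversions w \<subseteq> inversions (s i \<otimes> w) - {simple n i}"
    proof
      fix v assume "v \<in> ?r ` inversions w"
      then obtain u where u: "u \<in> inversions w" "v = ?r u" by blast
      then have u': "u \<in> D_roots n" "0 < height n u" "height n (act (inv w) u) < 0" "u \<noteq> simple n i"
        using notin by (auto simp: inversions_def)
      have p: "0 < height n v" using refl_positive[OF rank i u'(1,2,4)] u by simp
      have "v \<noteq> simple n i"
      proof
        assume "v = simple n i"
        then have "u = - simple n i" using u rr[of u] refl_self[of "simple n i" n] i by simp
        then show False using u'(2) rank i by (simp add: height_uminus height_simple)
      qed
      moreover have "v \<in> D_roots n" using u u' i by (auto intro: refl_root)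
      ultimately show "v \<in> inversions (s i \<otimes> w) - {simple n i}"
        using u u' p i w rr[of u] by (simp add: inversions_def act_inv_s_mult)
    qed
  qed
  moreover have "inj_on ?r (inversions w)" by (rule inj_on_inverseI[of _ ?r]) (simp add: rr)
  ultimately have "card (inversions (s i \<otimes> w) - {simple n i}) = len w"
    by (simp add: card_image len_def)
  then show ?thesis using card.remove[OF finite_inversions in1] by (simp add: len_def)
qed

lemma len_s_mult_descent:
  assumes "i \<in> {1..n}" "w \<in> carrier W" "descent i w"
  shows "len w = Suc (len (s i \<otimes> w))"
  using len_s_mult_ascent[of i "s i \<otimes> w"] assms by (simp add: descent_s_mult s_s_cancel)

text \<open>Without descents \<open>w\<^sup>-\<^sup>1\<close> never lowers heights of positive roots. Since it permutes the positive
  roots, the heights have the same sum before and after, so all of them are preserved. Then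
  \<open>w\<^sup>-\<^sup>1\<close> permutes the roots of height 1, which are the simple ones, and \<open>rigid\<close> applies.\<close>

lemma exists_descent:
  assumes w: "w \<in> carrier W" "w \<noteq> \<one>"
  shows "\<exists>i\<in>{1..n}. descent i w"
proof (rule ccontr)
  assume no: "\<not> ?thesis"
  define u where "u = inv w"
  have u: "u \<in> carrier W" using w by (simp add: u_def)
  let ?P = "{v \<in> D_roots n. 0 < height n v}"
  have s1: "1 \<le> height n (act u (simple n i))" if "i \<in> {1..n}" for i
  proof -
    have "act u (simple n i) \<in> D_roots n" using u that by (intro act_root) auto
    moreover have "\<not> height n (act u (simple n i)) < 0" using no that unfolding descent_def u_def by blast
    ultimately show ?thesis using height_nonzero[of "act u (simple n i)" n] by linarith
  qed
  have ge: "height n v \<le> height n (act u v)" if "v \<in> ?P" for v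
    using that
  proof (induction "nat (height n v)" arbitrary: v rule: less_induct)
    case less
    show ?case
    proof (cases "height n v = 1")
      case True
      then obtain i where "i \<in> {1..n}" "v = simple n i" using less.prems height_1_simple by blast
      then show ?thesis using s1[of i] True by simp
    next
      case False
      then obtain i where i: "i \<in> {1..n}" "dot n (simple n i) v = 1"
        using height_ge_2_simple[of n v] less.prems rank by auto
      define v' where "v' = (\<lambda>k. v k + (- simple n i) k)"
      have v': "v' \<in> D_roots n" unfolding v'_def
        using i less.prems
        by (subst D_roots_add_iff, simp, simp add: D_roots_uminus, subst dot_commute) (simp add: dot_uminus_left)
      have hv': "height n v' = height n v - 1"
        unfolding v'_def height_add height_uminus using i rank by (simp add: height_simple)
      have veq: "v = (\<lambda>k. v' k + simple n i k)" by (simp add: v'_def)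
      have "act u v = (\<lambda>k. act u v' k + act u (simple n i) k)"
        by (subst veq, rule act_add) (use u v' i less.prems veq in auto)
      moreover have "height n v' \<le> height n (act u v')"
        using less.prems False hv' v' by (intro less.hyps) auto
      ultimately show ?thesis using s1[OF i(1)] hv' by (simp add: height_add)
    qed
  qed
  have inj: "inj_on (act u) ?P"
    by (rule inj_on_inverseI[of _ "act (inv u)"]) (use u in \<open>auto simp: act_inv_cancel\<close>)
  have fin: "finite ?P" by (rule finite_subset[OF _ finite_D_roots]) auto
  have "act u ` ?P \<subseteq> ?P" using ge u act_root by fastforce
  then have im: "act u ` ?P = ?P" using card_subset_eq[OF fin _ card_image[OF inj]] by blast
  \<comment> \<open>No term of this sum is negative, and the sum is zero as \<open>u\<close> permutes the positive roots.\<close>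
  have "(\<Sum>v\<in>?P. height n (act u v) - height n v) = (\<Sum>v\<in>act u ` ?P. height n v) - (\<Sum>v\<in>?P. height n v)"
    using inj by (simp add: sum_subtractf sum.reindex)
  then have "(\<Sum>v\<in>?P. height n (act u v) - height n v) = 0" by (simp add: im)
  then have eq: "\<forall>v\<in>?P. height n (act u v) - height n v = 0"
    using ge fin by (subst (asm) sum_nonneg_eq_0_iff) auto
  have "u = \<one>"
  proof (rule rigid[OF u])
    fix i assume i: "i \<in> {1..n}"
    then have "height n (act u (simple n i)) = 1"
      using eq rank by (auto simp: height_simple dest!: bspec[of _ _ "simple n i"])
    then show "act u (simple n i) \<in> simple n ` {1..n}"
      using height_1_simple[of "act u (simple n i)" n] act_root[of u] u i by auto
  qed
  then show False using w by (simp add: u_def)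
qed

definition word :: "nat list \<Rightarrow> 'a" where
  "word is = foldr (\<lambda>i w. s i \<otimes> w) is \<one>"

lemma word_simps [simp]: "word [] = \<one>" "word (i # is) = s i \<otimes> word is"
  by (simp_all add: word_def)

lemma word_closed [simp, intro]: "set is \<subseteq> {1..n} \<Longrightarrow> word is \<in> carrier W"
  by (induction "is") auto

lemma len_one: "len \<one> = 0"
proof -
  have "inversions \<one> = {}" by (auto simp: inversions_def act_one)
  then show ?thesis by (simp add: len_def)
qed

lemma len_word_le: "set is \<subseteq> {1..n} \<Longrightarrow> len (word is) \<le> length is"
proof (induction "is")
  case (Cons i "is")
  then show ?case
    using len_s_mult_ascent[of i "word is"] len_s_mult_descent[of i "word is"]
    by (cases "descent i (word is)") auto
qed (simp add: len_one)

lemma exists_word: "w \<in> carrier W \<Longrightarrow> \<exists>is. set is \<subseteq> {1..n} \<and> word is = w \<and> length is = len w"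
proof (induction "len w" arbitrary: w rule: less_induct)
  case less
  show ?case
  proof (cases "w = \<one>")
    case True
    then show ?thesis by (intro exI[of _ "[]"]) (simp add: len_one)
  next
    case False
    then obtain i where i: "i \<in> {1..n}" "descent i w" using exists_descent less.prems by blast
    have l: "len w = Suc (len (s i \<otimes> w))" using len_s_mult_descent i less.prems by blast
    then obtain js where "set js \<subseteq> {1..n}" "word js = s i \<otimes> w" "length js = len (s i \<otimes> w)"
      using less.hyps[of "s i \<otimes> w"] i less.prems by auto
    then show ?thesis using i less.prems l by (intro exI[of _ "i # js"]) (simp add: s_s_cancel)
  qed
qed

definition reduced :: "nat list \<Rightarrow> bool" where
  "reduced is \<longleftrightarrow> set is \<subseteq> {1..n} \<and> length is = len (word is)"

lemma reduced_iff_minimal: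
  "reduced is \<longleftrightarrow> set is \<subseteq> {1..n} \<and> (\<forall>js. set js \<subseteq> {1..n} \<and> word js = word is \<longrightarrow> length is \<le> length js)"
proof
  assume "reduced is"
  then show "set is \<subseteq> {1..n} \<and> (\<forall>js. set js \<subseteq> {1..n} \<and> word js = word is \<longrightarrow> length is \<le> length js)"
    unfolding reduced_def by (metis len_word_le)
next
  assume *: "set is \<subseteq> {1..n} \<and> (\<forall>js. set js \<subseteq> {1..n} \<and> word js = word is \<longrightarrow> length is \<le> length js)"
  then obtain js where "set js \<subseteq> {1..n}" "word js = word is" "length js = len (word is)"
    using exists_word[of "word is"] by auto
  then show "reduced is" unfolding reduced_def using * len_word_le[of "is"] by (metis le_antisym)
qed

lemma exists_reduced: "w \<in> carrier W \<Longrightarrow> \<exists>is. reduced is \<and> word is = w"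
  using exists_word unfolding reduced_def by blast

lemma reduced_Cons:
  assumes "reduced (i # is)"
  shows "reduced is" "i \<in> {1..n}" "descent i (word (i # is))"
proof -
  have *: "i \<in> {1..n}" "set is \<subseteq> {1..n}" "Suc (length is) = len (s i \<otimes> word is)"
    using assms by (auto simp: reduced_def)
  show "i \<in> {1..n}" by fact
  have "\<not> descent i (word is)"
    using len_s_mult_descent[of i "word is"] len_word_le[of "is"] * by auto
  then show "reduced is" "descent i (word (i # is))"
    using * len_s_mult_ascent[of i "word is"] by (auto simp: reduced_def descent_s_mult)
qed

text \<open>Two descents \<open>i, j\<close> of \<open>w\<close> are descents along the whole longest word in \<open>s i\<close> and \<open>s j\<close>, since the
  roots that decide this are \<open>\<alpha>\<^sub>i, \<alpha>\<^sub>j\<close> and \<open>\<alpha>\<^sub>i + \<alpha>\<^sub>j\<close>.\<close>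

lemma descent_two:
  assumes w: "w \<in> carrier W" and i: "i \<in> {1..n}" and j: "j \<in> {1..n}" and ij: "i \<noteq> j"
    and di: "descent i w" and dj: "descent j w"
  shows "descent j (s i \<otimes> w)" and "adj n i j \<Longrightarrow> descent i (s j \<otimes> (s i \<otimes> w))"
proof -
  let ?a = "simple n i" and ?b = "simple n j"
  have c: "dot n ?b ?a = (if adj n i j then -1 else 0)" "dot n ?a ?b = (if adj n i j then -1 else 0)"
    using rank i j ij by (auto simp: cartan_D adj_sym)
  have sum: "(\<lambda>k. ?b k + ?a k) \<in> D_roots n" if "adj n i j"
    using that i j c by (subst D_roots_add_iff) auto
  have a: "root_refl n ?a ?b = (if adj n i j then (\<lambda>k. ?b k + ?a k) else ?b)"
    by (auto simp: root_refl_def c)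
  have d: "height n (act (inv w) (\<lambda>k. ?b k + ?a k)) < 0" if "adj n i j"
    using that di dj w i j sum[OF that] by (subst act_add) (auto simp: height_add descent_def)
  then show "descent j (s i \<otimes> w)"
    using i j w dj a by (auto simp: descent_def act_inv_s_mult)
  assume adj: "adj n i j"
  have "root_refl n ?b ?a = (\<lambda>k. ?b k + ?a k)" using adj by (auto simp: root_refl_def c)
  moreover have "root_refl n ?a (\<lambda>k. ?b k + ?a k) = ?b"
    using a adj refl_refl[of ?a n ?b] i by simp
  ultimately show "descent i (s j \<otimes> (s i \<otimes> w))"
    using i j w dj by (auto simp: descent_def act_inv_s_mult refl_root sum[OF adj])
qed

lemma descent_one: "i \<in> {1..n} \<Longrightarrow> \<not> descent i \<one>"
  using rank by (simp add: descent_def act_one height_simple)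

lemma descent_simple_reflection:
  assumes i: "i \<in> {1..n}" and j: "j \<in> {1..n}" and ij: "i \<noteq> j"
  shows "\<not> descent i (s j)"
proof -
  have "simple n i \<noteq> simple n j" using simple_inj[of n i j] rank i j ij by auto
  then show ?thesis using refl_positive[OF rank j, of "simple n i"] i j rank
    by (simp add: descent_def s_inv act_s height_simple)
qed

lemma len_simple_reflection: "i \<in> {1..n} \<Longrightarrow> len (s i) = 1"
  using len_s_mult_ascent[OF _ one_closed descent_one, of i] by (simp add: len_one)

lemma reduced_single: "i \<in> {1..n} \<Longrightarrow> reduced [i]"
  by (simp add: reduced_def len_simple_reflection)

lemma reduced_pair: "i \<in> {1..n} \<Longrightarrow> j \<in> {1..n} \<Longrightarrow> i \<noteq> j \<Longrightarrow> reduced [i, j]"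
  using len_s_mult_ascent[of i "s j"] descent_simple_reflection[of i j]
  by (simp add: reduced_def len_simple_reflection)

lemma reduced_triple:
  assumes i: "i \<in> {1..n}" and j: "j \<in> {1..n}" and ij: "adj n i j"
  shows "reduced [i, j, i]"
proof -
  have ne: "i \<noteq> j" using ij i j rank by (auto simp: adj_def)
  have d: "dot n (simple n i) (simple n j) = -1" "dot n (simple n j) (simple n i) = -1"
      "dot n (simple n i) (simple n i) = 2"
    using rank i j ij ne by (auto simp: cartan_D adj_sym)
  have "act (inv (s j \<otimes> s i)) (simple n i) = root_refl n (simple n i) (root_refl n (simple n j) (simple n i))"
    using i j by (simp add: act_inv_s_mult s_inv act_s refl_root)
  also have "\<dots> = simple n j"
    by (simp add: root_refl_def d) (unfold dot_add_left dot_diff_scale_left d, simp add: d)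
  finally have "\<not> descent i (s j \<otimes> s i)" using rank j by (simp add: descent_def height_simple)
  then show ?thesis
    using len_s_mult_ascent[of i "s j \<otimes> s i"] len_s_mult_ascent[of j "s i"]
      descent_simple_reflection[of j i] i j ne
    by (simp add: reduced_def len_simple_reflection)
qed

text \<open>If two reduced words of \<open>w\<close> begin with different letters \<open>i, j\<close>, then \<open>w\<close> also has reduced words
  that begin with the two longest words in \<open>i, j\<close> and end in the same way. These two are related by
  one braid move, and by induction on the length each of them gives the same product as the given
  word with the same first letter.\<close>

lemma matsumoto:
  assumes comm: "\<And>i j x. i \<in> {1..n} \<Longrightarrow> j \<in> {1..n} \<Longrightarrow> i \<noteq> j \<Longrightarrow> \<not> adj n i j \<Longrightarrow> f i (f j x) = f j (f i x)"
    and braid: "\<And>i j x. i \<in> {1..n} \<Longrightarrow> j \<in> {1..n} \<Longrightarrow> adj n i j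
      \<Longrightarrow> f i (f j (f i x)) = f j (f i (f j x))"
    and "reduced is" "reduced js" "word is = word js"
  shows "foldr f is e = foldr f js e"
  using assms(3-)
proof (induction "length is" arbitrary: "is" js rule: less_induct)
  case less
  have len: "length is = length js" using less.prems by (simp add: reduced_def)
  show ?case
  proof (cases "is")
    case Nil
    then show ?thesis using len by simp
  next
    case (Cons i is')
    then obtain j js' where js: "js = j # js'" using len by (cases js) auto
    define w where "w = word is"
    note ri = reduced_Cons[of i is'] and rj = reduced_Cons[of j js']
    have i: "i \<in> {1..n}" "reduced is'" "descent i w" using less.prems ri Cons by (auto simp: w_def)
    have j: "j \<in> {1..n}" "reduced js'" "descent j w" using less.prems rj js by (auto simp: w_def)
    have w: "w \<in> carrier W" using less.prems by (auto simp: reduced_def w_def)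
    have "w = s i \<otimes> word is'" "w = s j \<otimes> word js'"
      using less.prems Cons js by (simp_all add: w_def)
    then have wi: "word is' = s i \<otimes> w" and wj: "word js' = s j \<otimes> w"
      using s_s_cancel[of i "word is'"] s_s_cancel[of j "word js'"] i j
      unfolding reduced_def by (metis word_closed)+
    have IH: "foldr f xs e = foldr f ys e"
      if "reduced xs" "reduced ys" "word xs = word ys" "length xs < length is" for xs ys
      using less.hyps that by blast
    have IHi: "foldr f is' e = foldr f xs e" if "reduced xs" "word xs = s i \<otimes> w" for xs
      using that i wi Cons by (intro IH) auto
    have IHj: "foldr f js' e = foldr f xs e" if "reduced xs" "word xs = s j \<otimes> w" for xs
      using that j wj js len by (intro IH) auto
    consider "i = j" | "i \<noteq> j" "\<not> adj n i j" | "i \<noteq> j" "adj n i j" by blast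
    then show ?thesis
    proof cases
      case 1
      then show ?thesis using IHi[of js'] j wj Cons js by simp
    next
      case 2
      have d: "descent j (s i \<otimes> w)" using descent_two(1)[of w i j] w i j 2 by auto
      have l: "len w = Suc (Suc (len (s j \<otimes> (s i \<otimes> w))))"
        using len_s_mult_descent[of i w] len_s_mult_descent[of j "s i \<otimes> w"] d w i j by simp
      obtain xs where xs: "reduced xs" "word xs = s j \<otimes> (s i \<otimes> w)"
        using exists_reduced[of "s j \<otimes> (s i \<otimes> w)"] w i j by auto
      have wj: "word (j # xs) = s i \<otimes> w" using xs w i j by (simp add: s_s_cancel)
      have "word (i # xs) = s i \<otimes> (s j \<otimes> s i) \<otimes> w" using xs w i j by (simp add: m_assoc)
      also have "\<dots> = s i \<otimes> (s i \<otimes> s j) \<otimes> w" using s_comm[of j i] i j 2 by (simp add: adj_sym)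
      also have "\<dots> = s j \<otimes> w" using w i j by (simp add: m_assoc s_s_cancel)
      finally have wi: "word (i # xs) = s j \<otimes> w" .
      have "reduced (j # xs)" "reduced (i # xs)"
        using xs i j l wi wj len_s_mult_descent[of i w] len_s_mult_descent[of j w] w
        by (simp_all add: reduced_def)
      then have "foldr f is' e = f j (foldr f xs e)" "foldr f js' e = f i (foldr f xs e)"
        using IHi wj IHj wi by fastforce+
      then show ?thesis using Cons js comm[of i j] i j 2 by simp
    next
      case 3
      have d: "descent j (s i \<otimes> w)" "descent i (s j \<otimes> (s i \<otimes> w))"
        using descent_two[of w i j] w i j 3 by auto
      let ?x = "s i \<otimes> (s j \<otimes> (s i \<otimes> w))"
      have l: "len w = Suc (Suc (Suc (len ?x)))"
        using len_s_mult_descent[of i w] len_s_mult_descent[of j "s i \<otimes> w"]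
          len_s_mult_descent[of i "s j \<otimes> (s i \<otimes> w)"] d w i j by simp
      obtain xs where xs: "reduced xs" "word xs = ?x"
        using exists_reduced[of ?x] w i j by auto
      have wj: "word (j # i # xs) = s i \<otimes> w" using xs w i j by (simp add: s_s_cancel)
      have "word (i # j # xs) = s i \<otimes> (s j \<otimes> (s i \<otimes> (s j \<otimes> s i))) \<otimes> w"
        using xs w i j by (simp add: m_assoc)
      also have "\<dots> = s i \<otimes> (s i \<otimes> (s j \<otimes> (s i \<otimes> s i))) \<otimes> w"
        using s_braid[of j i] 3 i j by (simp add: adj_sym m_assoc[symmetric])
      also have "\<dots> = s j \<otimes> w" using w i j by (simp add: m_assoc s_s_cancel s_square)
      finally have wi: "word (i # j # xs) = s j \<otimes> w" .
      have "reduced (j # i # xs)" "reduced (i # j # xs)"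
        using xs i j l wi wj len_s_mult_descent[of i w] len_s_mult_descent[of j w] w
        by (simp_all add: reduced_def)
      then have "foldr f is' e = f j (f i (foldr f xs e))" "foldr f js' e = f i (f j (foldr f xs e))"
        using IHi wj IHj wi by fastforce+
      then show ?thesis using Cons js braid[of i j] i j 3 by simp
    qed
  qed
qed

end

section \<open>Conjugation in the general linear group\<close>

lemma matrix_inv_right [simp]: "invertible (A :: 'f::field ^ 'm ^ 'm) \<Longrightarrow> A ** matrix_inv A = mat 1"
  and matrix_inv_left [simp]: "invertible A \<Longrightarrow> matrix_inv A ** A = mat 1"
  unfolding invertible_def matrix_inv_def by (metis (mono_tags, lifting) someI_ex)+

lemma matrix_inv_unique:
  assumes "A ** B = mat 1" "B ** A = mat 1"
  shows "matrix_inv (A :: 'f::field ^ 'm ^ 'm) = B"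
proof -
  have "invertible A" using assms unfolding invertible_def by blast
  then have "matrix_inv A ** (A ** B) = B" by (simp add: matrix_mul_assoc)
  then show ?thesis using assms by simp
qed

lemma invertible_matrix_inv [simp]: "invertible A \<Longrightarrow> invertible (matrix_inv (A :: 'f::field ^ 'm ^ 'm))"
  unfolding invertible_def[of "matrix_inv A"] by (intro exI[of _ A]) simp

lemma matrix_inv_inv [simp]: "invertible A \<Longrightarrow> matrix_inv (matrix_inv (A :: 'f::field ^ 'm ^ 'm)) = A"
  by (rule matrix_inv_unique) auto

lemma matrix_inv_cancel [simp]:
  assumes "invertible (A :: 'f::field ^ 'm ^ 'm)"
  shows "A ** (matrix_inv A ** B) = B" "matrix_inv A ** (A ** B) = B"
    "B ** A ** matrix_inv A = B" "B ** matrix_inv A ** A = B"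
proof -
  show "A ** (matrix_inv A ** B) = B" "matrix_inv A ** (A ** B) = B"
    using assms by (simp_all only: matrix_mul_assoc matrix_inv_right matrix_inv_left matrix_mul_lid)
  have "B ** A ** matrix_inv A = B ** (A ** matrix_inv A)" "B ** matrix_inv A ** A = B ** (matrix_inv A ** A)"
    by (simp_all only: matrix_mul_assoc)
  then show "B ** A ** matrix_inv A = B" "B ** matrix_inv A ** A = B" using assms by simp_all
qed

lemma matrix_inv_mult:
  assumes "invertible (A :: 'f::field ^ 'm ^ 'm)" "invertible (B :: 'f ^ 'm ^ 'm)"
  shows "matrix_inv (A ** B) = matrix_inv B ** matrix_inv A"
proof (rule matrix_inv_unique)
  have "A ** B ** (matrix_inv B ** matrix_inv A) = A ** (B ** matrix_inv B) ** matrix_inv A"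
    by (simp only: matrix_mul_assoc)
  then show "A ** B ** (matrix_inv B ** matrix_inv A) = mat 1" using assms by simp
  have "matrix_inv B ** matrix_inv A ** (A ** B) = matrix_inv B ** (matrix_inv A ** A) ** B"
    by (simp only: matrix_mul_assoc)
  then show "matrix_inv B ** matrix_inv A ** (A ** B) = mat 1" using assms by simp
qed

lemma matrix_inv_one [simp]: "matrix_inv (mat 1 :: 'f::field ^ 'm ^ 'm) = mat 1"
  by (rule matrix_inv_unique) auto

lemma invertible_one [simp]: "invertible (mat 1 :: 'f::field ^ 'm ^ 'm)"
  unfolding invertible_def by (intro exI[of _ "mat 1"]) simp

lemma GL_simps [simp]: "carrier GL = {A. invertible A}" "A \<otimes>\<^bsub>GL\<^esub> B = A ** B" "\<one>\<^bsub>GL\<^esub> = mat 1"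
  by (simp_all add: GL_def)

lemma GL_group: "Group.group (GL :: ('f::field ^ 'm ^ 'm) monoid)"
proof (rule groupI)
  fix A :: "'f ^ 'm ^ 'm" assume "A \<in> carrier GL"
  then show "\<exists>B\<in>carrier GL. B \<otimes>\<^bsub>GL\<^esub> A = \<one>\<^bsub>GL\<^esub>" by (intro bexI[of _ "matrix_inv A"]) auto
qed (auto simp: invertible_mult matrix_mul_assoc)

lemma GL_inv: "invertible A \<Longrightarrow> inv\<^bsub>GL\<^esub> A = matrix_inv (A :: 'f::field ^ 'm ^ 'm)"
  by (rule group.inv_equality[OF GL_group]) auto

lemma Gm_simps [simp]: "carrier Gm = {x. x \<noteq> 0}" "a \<otimes>\<^bsub>Gm\<^esub> b = a * b" "\<one>\<^bsub>Gm\<^esub> = 1"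
  by (simp_all add: Gm_def)

lemma matrix_left_cancel:
  assumes "invertible (A :: 'f::field ^ 'm ^ 'm)"
  shows "A ** B = A ** C \<longleftrightarrow> B = (C :: 'f ^ 'm ^ 'm)"
proof
  assume "A ** B = A ** C"
  then have "matrix_inv A ** (A ** B) = matrix_inv A ** (A ** C)" by (rule arg_cong)
  then show "B = C" by (simp only: matrix_inv_cancel(2)[OF assms])
qed (simp only:)

lemma matrix_right_cancel:
  assumes "invertible (A :: 'f::field ^ 'm ^ 'm)"
  shows "B ** A = C ** A \<longleftrightarrow> B = (C :: 'f ^ 'm ^ 'm)"
proof
  assume eq: "B ** A = C ** A"
  have "B ** A ** matrix_inv A = C ** A ** matrix_inv A" by (simp only: eq)
  then show "B = C" by (simp only: matrix_inv_cancel(3)[OF assms])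
qed (simp only:)

definition conj_by :: "'f::field ^ 'm ^ 'm \<Rightarrow> 'f ^ 'm ^ 'm \<Rightarrow> 'f ^ 'm ^ 'm" where
  "conj_by g A = g ** A ** matrix_inv g"

lemma conj_by_mult: "invertible g \<Longrightarrow> conj_by g (A ** B) = conj_by g A ** conj_by g B"
  by (simp add: conj_by_def matrix_mul_assoc)

lemma conj_by_conj_by: "invertible g \<Longrightarrow> invertible h \<Longrightarrow> conj_by g (conj_by h A) = conj_by (g ** h) A"
  by (simp add: conj_by_def matrix_inv_mult matrix_mul_assoc)

lemma conj_by_one [simp]: "invertible g \<Longrightarrow> conj_by g (mat 1) = mat 1"
  by (simp add: conj_by_def)

lemma conj_by_by_one [simp]: "conj_by (mat 1) A = A"
  by (simp add: conj_by_def)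

lemma conj_by_cancel [simp]:
  "invertible g \<Longrightarrow> conj_by g (conj_by (matrix_inv g) A) = A"
  "invertible g \<Longrightarrow> conj_by (matrix_inv g) (conj_by g A) = A"
  by (simp_all add: conj_by_conj_by)

lemma conj_by_invertible [simp]: "invertible g \<Longrightarrow> invertible A \<Longrightarrow> invertible (conj_by g A)"
  by (simp add: conj_by_def invertible_mult)

lemma conj_by_matrix_inv: "invertible g \<Longrightarrow> invertible A \<Longrightarrow> conj_by g (matrix_inv A) = matrix_inv (conj_by g A)"
  by (rule matrix_inv_unique[symmetric]) (simp_all flip: conj_by_mult)

lemma conj_by_eq_iff [simp]: "invertible g \<Longrightarrow> conj_by g A = conj_by g B \<longleftrightarrow> A = B"
  by (metis conj_by_cancel(2))

lemma conj_by_entry: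
  "conj_by g A $ i $ j = (\<Sum>k\<in>UNIV. (\<Sum>l\<in>UNIV. g $ i $ l * A $ l $ k) * matrix_inv g $ k $ j)"
  by (simp add: conj_by_def matrix_matrix_mult_def)

lemma det_conj_by [simp]: "invertible (g :: 'f::field ^ 'm ^ 'm) \<Longrightarrow> det (conj_by g A) = det A"
proof -
  assume g: "invertible g"
  have "det g * det (matrix_inv g) = 1" using g by (metis det_I det_mul matrix_inv_right)
  then show ?thesis by (simp add: conj_by_def det_mul mult.assoc mult.commute mult.left_commute)
qed

section \<open>Laurent polynomials and cocharacters\<close>

text \<open>The regular functions of one nonzero variable, which are the entries of cocharacters.\<close>

definition laurent :: "('f::field \<Rightarrow> 'f) \<Rightarrow> bool" where
  "laurent f \<longleftrightarrow> (\<exists>p (k::nat). \<forall>x. x \<noteq> 0 \<longrightarrow> f x = poly p x / x ^ k)"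

lemma laurent_const: "laurent (\<lambda>_. c)"
  unfolding laurent_def by (intro exI[of _ "[:c:]"] exI[of _ 0]) simp

lemma laurent_add: assumes "laurent f" "laurent g" shows "laurent (\<lambda>x. f x + g x)"
proof -
  obtain p k q l where "\<forall>x. x \<noteq> 0 \<longrightarrow> f x = poly p x / x ^ k" "\<forall>x. x \<noteq> 0 \<longrightarrow> g x = poly q x / x ^ l"
    using assms unfolding laurent_def by blast
  then show ?thesis unfolding laurent_def
    by (intro exI[of _ "p * monom 1 l + q * monom 1 k"] exI[of _ "k + l"])
      (auto simp: poly_monom field_simps power_add)
qed

lemma laurent_mult: assumes "laurent f" "laurent g" shows "laurent (\<lambda>x. f x * g x)"
proof -
  obtain p k q l where "\<forall>x. x \<noteq> 0 \<longrightarrow> f x = poly p x / x ^ k" "\<forall>x. x \<noteq> 0 \<longrightarrow> g x = poly q x / x ^ l"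
    using assms unfolding laurent_def by blast
  then show ?thesis unfolding laurent_def
    by (intro exI[of _ "p * q"] exI[of _ "k + l"]) (auto simp: field_simps power_add)
qed

lemma laurent_sum: "(\<And>i. i \<in> A \<Longrightarrow> laurent (f i)) \<Longrightarrow> laurent (\<lambda>x. \<Sum>i\<in>A. f i x)"
  by (induction A rule: infinite_finite_induct) (auto intro: laurent_const laurent_add)

lemma infinite_UNIV_alg_closed_field: "infinite (UNIV :: 'f::alg_closed_field set)"
proof
  assume fin: "finite (UNIV :: 'f set)"
  define p where "p = (\<Prod>a\<in>(UNIV::'f set). [:- a, 1:])"
  have "degree p = card (UNIV :: 'f set)"
    unfolding p_def by (subst degree_prod_eq_sum_degree) auto
  then have "0 < degree p" using fin by (simp add: finite_UNIV_card_ge_0)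
  then have "0 < degree (p + 1)" by (simp add: degree_add_eq_left)
  then obtain x where "poly (p + 1) x = 0" using alg_closed_imp_poly_has_root by blast
  moreover have "poly p x = 0" unfolding p_def poly_prod using fin by (auto intro: prod_zero)
  ultimately show False by simp
qed

lemma infinite_field_poly_eq:
  assumes "\<And>x::'f::alg_closed_field. x \<noteq> 0 \<Longrightarrow> poly p x = poly q x"
  shows "p = q"
proof (rule ccontr)
  assume "p \<noteq> q"
  then have "monom 1 1 * (p - q) \<noteq> 0" by simp
  then have "finite {x. poly (monom 1 1 * (p - q)) x = 0}" by (rule poly_roots_finite)
  moreover have "{x. poly (monom 1 1 * (p - q)) x = 0} = UNIV"
    using assms by (auto simp: poly_monom)
  ultimately show False by (simp only: infinite_UNIV_alg_closed_field)
qed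

text \<open>An even Laurent polynomial is a Laurent polynomial in the square of the variable, so a
  cocharacter that is trivial at \<open>-1\<close> is the square of another one.\<close>

lemma laurent_even:
  fixes f :: "'f::alg_closed_field \<Rightarrow> 'f"
  assumes f: "laurent f" and even: "\<And>x. x \<noteq> 0 \<Longrightarrow> f (- x) = f x" and char: "(2::'f) \<noteq> 0"
  shows "\<exists>h. laurent h \<and> (\<forall>x. x \<noteq> 0 \<longrightarrow> h (x ^ 2) = f x)"
proof -
  obtain p k where p: "\<And>x. x \<noteq> 0 \<Longrightarrow> f x = poly p x / x ^ k" using f unfolding laurent_def by blast
  \<comment> \<open>Multiplication by an even power of the variable makes the function a polynomial, whose odd
    coefficients then vanish.\<close>
  define q where "q = p * monom 1 k"
  have q: "f x * (x ^ 2) ^ k = poly q x" if "x \<noteq> 0" for x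
    using that p[OF that] by (simp add: q_def poly_monom power_mult[symmetric] mult_2 power_add)
  have "q = pcompose q [:0, -1:]"
  proof (rule infinite_field_poly_eq)
    fix x :: 'f assume "x \<noteq> 0"
    then show "poly q x = poly (pcompose q [:0, -1:]) x"
      using q[of x] q[of "- x"] even[of x] by (simp add: poly_pcompose)
  qed
  then have "Polynomial.coeff q i = (-1) ^ i * Polynomial.coeff q i" for i
    by (metis coeff_pcompose_linear)
  then have odd: "Polynomial.coeff q i = 0" if "odd i" for i
  proof -
    have "Polynomial.coeff q i = - Polynomial.coeff q i"
      using that \<open>\<And>i. Polynomial.coeff q i = _\<close>[of i] by simp
    then have "Polynomial.coeff q i + Polynomial.coeff q i = 0" by (simp only: eq_neg_iff_add_eq_0)
    then have "2 * Polynomial.coeff q i = 0" by (simp only: mult_2)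
    then show ?thesis using char by simp
  qed
  define r where "r = (\<Sum>i\<le>degree q. monom (Polynomial.coeff q (2 * i)) i)"
  have r: "poly r (x ^ 2) = poly q x" for x
  proof -
    have "poly r (x ^ 2) = (\<Sum>i\<le>degree q. Polynomial.coeff q (2 * i) * x ^ (2 * i))"
      by (simp add: r_def poly_sum poly_monom power_mult)
    also have "\<dots> = (\<Sum>j\<in>(\<lambda>i. 2 * i) ` {..degree q}. Polynomial.coeff q j * x ^ j)"
      by (subst sum.reindex) (auto simp: inj_on_def)
    also have "\<dots> = (\<Sum>j\<le>2 * degree q. Polynomial.coeff q j * x ^ j)"
    proof (rule sum.mono_neutral_left)
      show "\<forall>j\<in>{..2 * degree q} - (\<lambda>i. 2 * i) ` {..degree q}. Polynomial.coeff q j * x ^ j = 0"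
      proof
        fix j assume j: "j \<in> {..2 * degree q} - (\<lambda>i. 2 * i) ` {..degree q}"
        have "odd j"
        proof
          assume "even j"
          then obtain i where "j = 2 * i" by blast
          then show False using j by auto
        qed
        then show "Polynomial.coeff q j * x ^ j = 0" by (simp add: odd)
      qed
    qed auto
    also have "\<dots> = (\<Sum>j\<le>degree q. Polynomial.coeff q j * x ^ j)"
      by (rule sum.mono_neutral_right) (auto simp: coeff_eq_0)
    finally show ?thesis by (simp add: poly_altdef)
  qed
  define h where "h y = poly r y / y ^ k" for y
  have "laurent h" unfolding laurent_def h_def by blast
  moreover have "h (x ^ 2) = f x" if "x \<noteq> 0" for x
    using q[OF that] that by (simp add: h_def r field_simps)
  ultimately show ?thesis by blast
qed

lemma cocharacters_iff:
  "l \<in> cocharacters T \<longleftrightarrow> l \<in> hom Gm (grp T) \<and> (\<forall>i j. laurent (\<lambda>x. l x $ i $ j))"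
  by (simp add: cocharacters_def laurent_def)

lemma cocharacter_mem: "l \<in> cocharacters T \<Longrightarrow> x \<noteq> 0 \<Longrightarrow> l x \<in> T"
  by (auto simp: cocharacters_def hom_def Pi_iff)

lemma cocharacter_mult: "l \<in> cocharacters T \<Longrightarrow> x \<noteq> 0 \<Longrightarrow> y \<noteq> 0 \<Longrightarrow> l (x * y) = l x ** l y"
  by (auto simp: cocharacters_def hom_def)

lemma cocharacter_conj_by:
  assumes l: "l \<in> cocharacters T" and g: "invertible g" and T: "\<And>t. t \<in> T \<Longrightarrow> conj_by g t \<in> T"
  shows "(\<lambda>x. conj_by g (l x)) \<in> cocharacters T"
  unfolding cocharacters_iff
proof
  show "(\<lambda>x. conj_by g (l x)) \<in> hom Gm (grp T)"
    using cocharacter_mem[OF l] cocharacter_mult[OF l] T g by (auto intro!: homI simp: conj_by_mult)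
  show "\<forall>i j. laurent (\<lambda>x. conj_by g (l x) $ i $ j)"
    using l unfolding conj_by_entry cocharacters_iff
    by (intro allI laurent_sum laurent_mult laurent_const) auto
qed

lemma cocharacter_prod:
  assumes l: "l \<in> cocharacters T" "l' \<in> cocharacters T"
    and T: "\<And>s t. s \<in> T \<Longrightarrow> t \<in> T \<Longrightarrow> s ** t \<in> T \<and> s ** t = t ** s"
  shows "(\<lambda>x. l x ** l' x) \<in> cocharacters T"
  unfolding cocharacters_iff
proof
  have "l (x * y) ** l' (x * y) = l x ** l' x ** (l y ** l' y)" if "x \<noteq> 0" "y \<noteq> 0" for x y
  proof -
    have "l (x * y) ** l' (x * y) = l x ** (l y ** l' x) ** l' y"
      using that l by (simp add: cocharacter_mult matrix_mul_assoc)
    also have "l y ** l' x = l' x ** l y" using T[of "l y" "l' x"] l that by (simp add: cocharacter_mem)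
    finally show ?thesis by (simp add: matrix_mul_assoc)
  qed
  then show "(\<lambda>x. l x ** l' x) \<in> hom Gm (grp T)"
    using cocharacter_mem[OF l(1)] cocharacter_mem[OF l(2)] T by (auto intro!: homI)
  show "\<forall>i j. laurent (\<lambda>x. (l x ** l' x) $ i $ j)"
    using l unfolding matrix_matrix_mult_def cocharacters_iff
    by (auto intro!: laurent_sum laurent_mult)
qed

section \<open>Conjugating polynomial functions, roots and root subgroups\<close>

lemma polynomial_functions_sum:
  "(\<And>i. i \<in> A \<Longrightarrow> p i \<in> polynomial_functions) \<Longrightarrow> (\<lambda>X. \<Sum>i\<in>A. p i X) \<in> polynomial_functions"
  by (induction A rule: infinite_finite_induct)
    (auto intro: polynomial_functions.const polynomial_functions.add)

lemma polynomial_functions_conj_by: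
  assumes "p \<in> polynomial_functions"
  shows "(\<lambda>A. p (conj_by g A)) \<in> polynomial_functions"
  using assms
proof induction
  case (entry i j)
  show ?case unfolding conj_by_entry
    by (intro polynomial_functions_sum polynomial_functions.intros)
qed (auto intro: polynomial_functions.intros)

lemma zariski_closed_conj_by:
  assumes g: "invertible (g :: 'f::field ^ 'm ^ 'm)" and Z: "zariski_closed Z"
  shows "zariski_closed (conj_by g ` Z)"
proof -
  obtain P where P: "P \<subseteq> polynomial_functions" "Z = {A. invertible A \<and> (\<forall>p\<in>P. p A = 0)}"
    using Z unfolding zariski_closed_def by blast
  let ?P = "(\<lambda>p A. p (conj_by (matrix_inv g) A)) ` P"
  have "?P \<subseteq> polynomial_functions" using P polynomial_functions_conj_by by blast
  moreover have "conj_by g ` Z = {A. invertible A \<and> (\<forall>p\<in>?P. p A = 0)}"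
  proof
    show "conj_by g ` Z \<subseteq> {A. invertible A \<and> (\<forall>p\<in>?P. p A = 0)}" using P g by auto
    show "{A. invertible A \<and> (\<forall>p\<in>?P. p A = 0)} \<subseteq> conj_by g ` Z"
    proof
      fix A assume "A \<in> {A. invertible A \<and> (\<forall>p\<in>?P. p A = 0)}"
      then have "conj_by (matrix_inv g) A \<in> Z" using P g by auto
      then show "A \<in> conj_by g ` Z" by (rule rev_image_eqI) (use g in simp)
    qed
  qed
  ultimately show ?thesis unfolding zariski_closed_def by blast
qed

lemma subgroup_GL_iff:
  "subgroup H (GL :: ('f::field ^ 'm ^ 'm) monoid) \<longleftrightarrow>
     (\<forall>A\<in>H. invertible A) \<and> mat 1 \<in> H \<and> (\<forall>A\<in>H. \<forall>B\<in>H. A ** B \<in> H) \<and> (\<forall>A\<in>H. matrix_inv A \<in> H)"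
  by (auto simp: subgroup_def GL_inv subset_iff)

lemma linear_algebraic_group_conj_by:
  assumes g: "invertible (g :: 'f::field ^ 'm ^ 'm)" and H: "linear_algebraic_group H"
  shows "linear_algebraic_group (conj_by g ` H)"
proof -
  have "subgroup H GL" using H by (simp add: linear_algebraic_group_def)
  then have "subgroup (conj_by g ` H) GL"
    unfolding subgroup_GL_iff using g
    by (auto simp flip: conj_by_mult conj_by_matrix_inv intro!: rev_image_eqI[of "mat 1"])
  then show ?thesis using zariski_closed_conj_by[OF g] H by (simp add: linear_algebraic_group_def)
qed

lemma regular_on_conj_by:
  assumes g: "invertible (g :: 'f::field ^ 'm ^ 'm)" and f: "regular_on Z f"
    and Z: "\<And>A. A \<in> Z' \<Longrightarrow> conj_by g A \<in> Z"
  shows "regular_on Z' (\<lambda>A. f (conj_by g A))"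
proof -
  obtain p k where p: "p \<in> polynomial_functions" "\<forall>A\<in>Z. f A = p A / det A ^ k"
    using f unfolding regular_on_def by blast
  then have "\<forall>A\<in>Z'. f (conj_by g A) = p (conj_by g A) / det A ^ k" using Z g by simp
  then show ?thesis unfolding regular_on_def
    by (intro bexI[OF _ polynomial_functions_conj_by[OF p(1), of g]] exI[of _ k])
qed

lemma regular_on_cong: "regular_on Z f \<Longrightarrow> (\<And>A. A \<in> Z \<Longrightarrow> f A = f' A) \<Longrightarrow> regular_on Z f'"
  unfolding regular_on_def by metis

lemma map_matrix_conj_by:
  "conj_by g (map_matrix ((*) c) X) = map_matrix ((*) (c::'f::field)) (conj_by g X)"
  by (simp add: vec_eq_iff conj_by_entry map_matrix_def sum_distrib_left sum_distrib_right mult.assoc mult.commute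
    mult.left_commute)

lemma conj_by_add: "conj_by g (A + B) = conj_by g A + conj_by g B"
  by (simp add: vec_eq_iff conj_by_entry algebra_simps sum.distrib)

lemma lie_algebra_conj_by:
  assumes G: "subgroup G GL" and g: "g \<in> G" and X: "X \<in> lie_algebra G"
  shows "conj_by g X \<in> lie_algebra (G :: ('f::field ^ 'm ^ 'm) set)"
  unfolding lie_algebra_def
proof (intro CollectI ballI impI allI)
  fix p q assume p: "p \<in> polynomial_functions" "\<forall>h\<in>G. p h = 0"
    and q: "\<forall>s. poly q s = p (mat 1 + map_matrix ((*) s) (conj_by g X))"
  have inv: "invertible g" using G g by (simp add: subgroup_GL_iff)
  have "conj_by g h \<in> G" if "h \<in> G" for h
    using G g that by (auto simp: subgroup_GL_iff conj_by_def)
  then have "\<forall>h\<in>G. p (conj_by g h) = 0" using p by blast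
  moreover have "\<forall>s. poly q s = p (conj_by g (mat 1 + map_matrix ((*) s) X))"
    using q inv by (simp add: conj_by_add map_matrix_conj_by)
  ultimately show "Polynomial.coeff q 1 = 0"
    using X[unfolded lie_algebra_def mem_Collect_eq, rule_format, OF polynomial_functions_conj_by[OF p(1), of g], of q]
    by blast
qed

lemma character_conj_by:
  assumes ch: "ch \<in> characters T" and g: "invertible (g :: 'f::field ^ 'm ^ 'm)"
    and T: "\<And>t. t \<in> T \<Longrightarrow> conj_by g t \<in> T" "subgroup T GL"
  shows "(\<lambda>t\<in>T. ch (conj_by g t)) \<in> characters T"
proof -
  have "(\<lambda>t\<in>T. ch (conj_by g t)) \<in> hom (grp T) Gm"
    using ch T g by (auto simp: characters_def hom_def Pi_iff conj_by_mult subgroup_GL_iff)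
  moreover have "regular_on T (\<lambda>t. ch (conj_by g t))"
    using ch T by (intro regular_on_conj_by[OF g]) (auto simp: characters_def)
  then have "regular_on T (\<lambda>t\<in>T. ch (conj_by g t))" by (rule regular_on_cong) simp
  ultimately show ?thesis by (simp add: characters_def)
qed

text \<open>Conjugation by an element of \<open>G\<close> maps the Lie algebra to itself and root vectors to root vectors.\<close>

lemma root_conj_by:
  assumes G: "subgroup G GL" and T: "subgroup T GL" and g: "g \<in> G"
    and norm: "\<And>t. t \<in> T \<Longrightarrow> conj_by g t \<in> T" "\<And>t. t \<in> T \<Longrightarrow> conj_by (matrix_inv g) t \<in> T"
    and \<alpha>: "\<alpha> \<in> roots G T"
  shows "(\<lambda>t\<in>T. \<alpha> (conj_by (matrix_inv g) t)) \<in> roots G (T :: ('f::field ^ 'm ^ 'm) set)"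
proof -
  have inv: "invertible g" using G g by (simp add: subgroup_GL_iff)
  obtain t0 X where t0: "t0 \<in> T" "\<alpha> t0 \<noteq> 1" and X: "X \<in> lie_algebra G" "X \<noteq> 0"
    "\<And>t. t \<in> T \<Longrightarrow> conj_by t X = map_matrix ((*) (\<alpha> t)) X" and ch: "\<alpha> \<in> characters T"
    using \<alpha> unfolding roots_def conj_by_def by blast
  have "\<exists>t\<in>T. (\<lambda>t\<in>T. \<alpha> (conj_by (matrix_inv g) t)) t \<noteq> 1"
    by (rule bexI[of _ "conj_by g t0"]) (use t0 norm inv in auto)
  moreover have "conj_by g X \<noteq> 0"
  proof
    assume "conj_by g X = 0"
    then have "conj_by (matrix_inv g) (conj_by g X) = conj_by (matrix_inv g) 0" by simp
    then have "X = conj_by (matrix_inv g) 0" using inv by simp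
    then show False using X(2) by (simp add: conj_by_def)
  qed
  moreover have "conj_by t (conj_by g X) = map_matrix ((*) (\<alpha> (conj_by (matrix_inv g) t))) (conj_by g X)"
    if t: "t \<in> T" for t
  proof -
    have it: "invertible t" using T t by (simp add: subgroup_GL_iff)
    have "conj_by t (conj_by g X) = conj_by (g ** conj_by (matrix_inv g) t) X"
      using inv it by (simp add: conj_by_conj_by) (simp add: conj_by_def matrix_mul_assoc)
    also have "\<dots> = conj_by g (conj_by (conj_by (matrix_inv g) t) X)"
      using inv it by (simp add: conj_by_conj_by)
    also have "conj_by (conj_by (matrix_inv g) t) X = map_matrix ((*) (\<alpha> (conj_by (matrix_inv g) t))) X"
      using norm t by (intro X(3)) auto
    finally show ?thesis by (simp add: map_matrix_conj_by)
  qed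
  ultimately show ?thesis
    using character_conj_by[OF ch invertible_matrix_inv[OF inv] norm(2) T] lie_algebra_conj_by[OF G g X(1)]
    unfolding roots_def conj_by_def by (auto intro!: exI bexI[of _ "g ** X ** matrix_inv g"])
qed

lemma Ga_iso_conj_by:
  assumes g: "invertible (g :: 'f::field ^ 'm ^ 'm)" and u: "Ga_iso U u"
  shows "Ga_iso (conj_by g ` U) (\<lambda>x. conj_by g (u x))"
  unfolding Ga_iso_def
proof (intro conjI allI)
  have U: "linear_algebraic_group U" "range u = U" "\<And>x y. u (x + y) = u x ** u y"
    using u by (auto simp: Ga_iso_def)
  show "linear_algebraic_group (conj_by g ` U)" using linear_algebraic_group_conj_by g U by blast
  show "range (\<lambda>x. conj_by g (u x)) = conj_by g ` U" using U by auto
  show "conj_by g (u (x + y)) = conj_by g (u x) ** conj_by g (u y)" for x y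
    using U g by (simp add: conj_by_mult)
  show "\<exists>p. \<forall>x. conj_by g (u x) $ i $ j = poly p x" for i j
  proof -
    obtain p where p: "\<And>k l x. u x $ l $ k = poly (p l k) x"
      using u unfolding Ga_iso_def by metis
    show ?thesis
      by (rule exI[of _ "\<Sum>k\<in>UNIV. (\<Sum>l\<in>UNIV. [:g $ i $ l:] * p l k) * [:matrix_inv g $ k $ j:]"])
        (simp add: conj_by_entry p poly_sum algebra_simps)
  qed
  obtain f where f: "regular_on U f" "\<forall>x. f (u x) = x" using u unfolding Ga_iso_def by blast
  show "\<exists>f. regular_on (conj_by g ` U) f \<and> (\<forall>x. f (conj_by g (u x)) = x)"
    using f g by (intro exI[of _ "\<lambda>A. f (conj_by (matrix_inv g) A)"])
      (auto intro!: regular_on_conj_by)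
qed

lemma root_parametrization_conj_by:
  assumes G: "subgroup G GL" and T: "subgroup T GL" and g: "g \<in> G"
    and norm: "\<And>t. t \<in> T \<Longrightarrow> conj_by (matrix_inv g) t \<in> T"
    and u: "root_parametrization G T \<alpha> U u"
    and \<beta>: "\<And>t. t \<in> T \<Longrightarrow> \<beta> t = \<alpha> (conj_by (matrix_inv g) t)"
  shows "root_parametrization G (T :: ('f::field ^ 'm ^ 'm) set) \<beta> (conj_by g ` U) (\<lambda>x. conj_by g (u x))"
  unfolding root_parametrization_def
proof (intro conjI ballI allI)
  have inv: "invertible g" using G g by (simp add: subgroup_GL_iff)
  show "conj_by g ` U \<subseteq> G"
    using u G g by (auto simp: root_parametrization_def subgroup_GL_iff conj_by_def subset_iff)
  show "Ga_iso (conj_by g ` U) (\<lambda>x. conj_by g (u x))"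
    using Ga_iso_conj_by[OF inv] u by (simp add: root_parametrization_def)
  fix t x assume t: "t \<in> T"
  have it: "invertible t" using T t by (simp add: subgroup_GL_iff)
  have "conj_by t (conj_by g (u x)) = conj_by (g ** conj_by (matrix_inv g) t) (u x)"
    using inv it by (simp add: conj_by_conj_by) (simp add: conj_by_def matrix_mul_assoc)
  also have "\<dots> = conj_by g (conj_by (conj_by (matrix_inv g) t) (u x))"
    using inv it by (simp add: conj_by_conj_by)
  also have "conj_by (conj_by (matrix_inv g) t) (u x) = u (\<alpha> (conj_by (matrix_inv g) t) * x)"
    using u norm[OF t] unfolding root_parametrization_def conj_by_def by blast
  finally show "t ** conj_by g (u x) ** matrix_inv t = conj_by g (u (\<beta> t * x))"
    using \<beta>[OF t] by (simp add: conj_by_def)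
qed

section \<open>The torus of the half-spin group\<close>

text \<open>Exponents can be read off because the field is infinite.\<close>

lemma powi_eq_imp_eq:
  assumes "\<And>x::'f::alg_closed_field. x \<noteq> 0 \<Longrightarrow> x powi a = x powi b"
  shows "a = b"
proof -
  have aux: "d = 0" if "\<And>x::'f. x \<noteq> 0 \<Longrightarrow> x ^ d = 1" for d :: nat
  proof -
    have "monom (1::'f) d = 1"
      by (rule infinite_field_poly_eq) (use that in \<open>simp add: poly_monom\<close>)
    then have "degree (monom (1::'f) d) = 0" by simp
    then show ?thesis by (simp add: degree_monom_eq)
  qed
  have le: "b \<le> a" if eq: "\<And>x::'f. x \<noteq> 0 \<Longrightarrow> x powi a = x powi b" for a b
  proof (rule ccontr)
    assume ab: "\<not> b \<le> a"
    have "x ^ nat (b - a) = 1" if x: "x \<noteq> 0" for x :: 'f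
    proof -
      have "x powi (b - a) = x powi b / x powi a" using x by (simp add: power_int_diff)
      also have "\<dots> = 1" using eq[OF x] x by simp
      finally show ?thesis using ab by (simp add: power_int_def)
    qed
    then have "nat (b - a) = 0" by (rule aux)
    then show False using ab by simp
  qed
  from le[of a b] le[of b a] assms show ?thesis by force
qed

lemma powi_prod_exponents:
  "(x::'f::field) \<noteq> 0 \<Longrightarrow> (\<Prod>i\<in>A. x powi f i) = x powi (\<Sum>i\<in>A. f i)"
  by (induction A rule: infinite_finite_induct) (auto simp: power_int_add)

lemma prod_powi: "(\<Prod>i\<in>A. f i) powi c = (\<Prod>i\<in>A. (f i :: 'f::field) powi c)"
  by (induction A rule: infinite_finite_induct) (auto simp: power_int_mult_distrib)

lemma grp_simps [simp]:
  "carrier (grp H) = H" "A \<otimes>\<^bsub>grp H\<^esub> B = A ** B" "\<one>\<^bsub>grp H\<^esub> = mat 1"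
  by simp_all

lemma sqrt_one_inverse: "(c::'f::field) ^ 2 = 1 \<Longrightarrow> c * c' = 1 \<Longrightarrow> c' = c"
proof -
  assume "c ^ 2 = 1" "c * c' = 1"
  then have "c * (c * c') = c" "c * c * c' = c'" by (simp_all add: power2_eq_square)
  then show "c' = c" by (simp only: mult.assoc)
qed

text \<open>The recursion that solves \<open>y\<^sub>k\<^sup>2 = y\<^sub>k\<^sub>-\<^sub>1 y\<^sub>k\<^sub>+\<^sub>1 f\<^sub>k\<close> along the chain of the diagram. The starting values at
  0 and 1 are a normalization; with the value 1 at 0 the equation also holds at the end node.\<close>

fun chain :: "(nat \<Rightarrow> 'f::field) \<Rightarrow> nat \<Rightarrow> 'f" where
  "chain f 0 = 1"
| "chain f (Suc 0) = 1"
| "chain f (Suc (Suc k)) = chain f (Suc k) ^ 2 / (chain f k * f (Suc k))"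

lemma chain_nonzero: "(\<And>i. 1 \<le> i \<Longrightarrow> i < k \<Longrightarrow> f i \<noteq> 0) \<Longrightarrow> chain f k \<noteq> 0"
  by (induction f k rule: chain.induct) auto

text \<open>A group of type \<open>D\<^sub>n\<close> with even \<open>n \<ge> 6\<close> whose cocharacter lattice is generated by the coroots and
  the fundamental coweight \<open>\<omega>\<^sub>n\<close>.\<close>

locale half_spin_group =
  fixes n :: nat
    and G T :: "('f::alg_closed_field ^ 'm::finite ^ 'm) set"
    and rt :: "(nat \<Rightarrow> int) \<Rightarrow> 'f ^ 'm ^ 'm \<Rightarrow> 'f"
    and cor u :: "(nat \<Rightarrow> int) \<Rightarrow> 'f \<Rightarrow> 'f ^ 'm ^ 'm"
    and om :: "'f \<Rightarrow> 'f ^ 'm ^ 'm"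
  assumes rank: "6 \<le> n" "even n"
    and G_alg: "linear_algebraic_group G"
    and T_max: "maximal_torus G T"
    and centralizer: "{g \<in> G. \<forall>t\<in>T. g ** t = t ** g} = T"
    and type: "type_D n G T rt cor"
    and om: "fundamental_coweight n T rt cor n om"
    and lattice: "cocharacters_generated n T cor om"
    and realization: "realization n G T rt cor u"
begin

abbreviation alpha :: "nat \<Rightarrow> 'f ^ 'm ^ 'm \<Rightarrow> 'f" where
  "alpha i \<equiv> rt (simple n i)"

abbreviation coroot :: "nat \<Rightarrow> 'f \<Rightarrow> 'f ^ 'm ^ 'm" where
  "coroot i \<equiv> cor (simple n i)"

lemma simple_D [simp]: "1 \<le> i \<Longrightarrow> i \<le> n \<Longrightarrow> simple n i \<in> D_roots n"
  using rank by (intro simple_root) auto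

lemma G_subgroup: "subgroup G GL"
  using G_alg by (simp add: linear_algebraic_group_def)

lemma T_torus: "torus T" and T_sub_G: "T \<subseteq> G"
  using T_max by (auto simp: maximal_torus_def)

lemma T_subgroup: "subgroup T GL"
  using T_torus by (simp add: torus_def linear_algebraic_group_def)

lemma T_comm_group: "comm_group (grp T)"
  using T_torus by (simp add: torus_def)

lemma G_closed:
  "g \<in> G \<Longrightarrow> invertible g" "mat 1 \<in> G" "g \<in> G \<Longrightarrow> h \<in> G \<Longrightarrow> g ** h \<in> G" "g \<in> G \<Longrightarrow> matrix_inv g \<in> G"
  using G_subgroup by (simp_all add: subgroup_GL_iff)

lemma T_closed [simp]:
  "t \<in> T \<Longrightarrow> invertible t" "mat 1 \<in> T" "s \<in> T \<Longrightarrow> t \<in> T \<Longrightarrow> s ** t \<in> T" "t \<in> T \<Longrightarrow> matrix_inv t \<in> T"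
  using T_subgroup by (simp_all add: subgroup_GL_iff)

lemma T_G: "t \<in> T \<Longrightarrow> t \<in> G"
  using T_sub_G by blast

lemma T_commute: "s \<in> T \<Longrightarrow> t \<in> T \<Longrightarrow> s ** t = t ** s"
  using comm_monoid.m_comm[OF comm_group.axioms(1)[OF T_comm_group], of s t] by simp

lemma T_left_commute: "s \<in> T \<Longrightarrow> t \<in> T \<Longrightarrow> s ** (t ** A) = t ** (s ** A)"
  using T_commute[of s t] by (simp add: matrix_mul_assoc)

lemmas T_ac = matrix_mul_assoc[symmetric] T_commute T_left_commute

lemma T_conj_by [simp]: "s \<in> T \<Longrightarrow> t \<in> T \<Longrightarrow> conj_by s t = t"
  by (simp add: conj_by_def T_commute[of s t])

lemma rt_character: "v \<in> D_roots n \<Longrightarrow> rt v \<in> characters T"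
  using type by (auto simp: type_D_def bij_betw_def roots_def)

lemma rt_nonzero: "v \<in> D_roots n \<Longrightarrow> t \<in> T \<Longrightarrow> rt v t \<noteq> 0"
  and rt_mult: "v \<in> D_roots n \<Longrightarrow> s \<in> T \<Longrightarrow> t \<in> T \<Longrightarrow> rt v (s ** t) = rt v s * rt v t"
  using rt_character[of v] by (auto simp: characters_def hom_def Pi_iff)

lemma rt_one: "v \<in> D_roots n \<Longrightarrow> rt v (mat 1) = 1"
  using rt_mult[of v "mat 1" "mat 1"] rt_nonzero[of v "mat 1"] by simp

lemma rt_inv: "v \<in> D_roots n \<Longrightarrow> t \<in> T \<Longrightarrow> rt v (matrix_inv t) = inverse (rt v t)"
  using rt_mult[of v t "matrix_inv t"] rt_nonzero[of v t] by (simp add: rt_one field_simps)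

lemma cor_cocharacter: "v \<in> D_roots n \<Longrightarrow> cor v \<in> cocharacters T"
  using type by (auto simp: type_D_def is_coroot_def)

lemma cor_T [simp]: "v \<in> D_roots n \<Longrightarrow> x \<noteq> 0 \<Longrightarrow> cor v x \<in> T"
  by (meson cocharacter_mem cor_cocharacter)

lemma cor_mult: "v \<in> D_roots n \<Longrightarrow> x \<noteq> 0 \<Longrightarrow> y \<noteq> 0 \<Longrightarrow> cor v (x * y) = cor v x ** cor v y"
  by (meson cocharacter_mult cor_cocharacter)

lemma cocharacter_one: "l \<in> cocharacters T \<Longrightarrow> l 1 = mat 1"
proof -
  assume l: "l \<in> cocharacters T"
  have "l 1 ** l 1 = l 1 ** mat 1" using cocharacter_mult[OF l, of 1 1] by simp
  moreover have "invertible (l 1)" using cocharacter_mem[OF l, of 1] by simp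
  ultimately show ?thesis by (metis matrix_inv_cancel(2))
qed

lemma cor_one: "v \<in> D_roots n \<Longrightarrow> cor v 1 = mat 1"
  by (intro cocharacter_one cor_cocharacter)

lemma cor_inverse: "v \<in> D_roots n \<Longrightarrow> x \<noteq> 0 \<Longrightarrow> matrix_inv (cor v x) = cor v (inverse x)"
  by (rule matrix_inv_unique) (simp_all flip: cor_mult add: cor_one)

lemma rt_cor: "v \<in> D_roots n \<Longrightarrow> w \<in> D_roots n \<Longrightarrow> x \<noteq> 0 \<Longrightarrow> rt v (cor w x) = x powi dot n v w"
  using type by (simp add: type_D_def)

text \<open>The torus is parametrized, not injectively, by all simple coroots at once. This treats the nodes
  symmetrically, unlike the basis of the cocharacter lattice in which the first coroot is replaced
  by the coweight.\<close>

definition kappa :: "(nat \<Rightarrow> 'f) \<Rightarrow> 'f ^ 'm ^ 'm" where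
  "kappa y = finprod (grp T) (\<lambda>i. coroot i (y i)) {1..n}"

definition nonvanishing :: "(nat \<Rightarrow> 'f) \<Rightarrow> bool" where
  "nonvanishing y \<longleftrightarrow> (\<forall>i\<in>{1..n}. y i \<noteq> 0)"

interpretation Tg: comm_group "grp T"
  by (rule T_comm_group)

lemma rt_finprod:
  assumes v: "v \<in> D_roots n" and f: "\<And>i. i \<in> A \<Longrightarrow> f i \<in> T"
  shows "rt v (finprod (grp T) f A) = (\<Prod>i\<in>A. rt v (f i))"
  using f
proof (induction A rule: infinite_finite_induct)
  case (insert a A)
  have m: "finprod (grp T) f A \<in> T" using Tg.finprod_closed[of f A] insert by auto
  have "finprod (grp T) f (insert a A) = f a ** finprod (grp T) f A"
    using Tg.finprod_insert[of A a f] insert by auto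
  then show ?case using insert m by (simp add: rt_mult[OF v])
qed (use rt_one[OF v] Tg.finprod_infinite in auto)

lemma kappa_T [simp]: "nonvanishing y \<Longrightarrow> kappa y \<in> T"
  using Tg.finprod_closed[of "\<lambda>i. coroot i (y i)" "{1..n}"] by (auto simp: kappa_def nonvanishing_def)

lemma kappa_mult:
  assumes "nonvanishing y" "nonvanishing z"
  shows "kappa (\<lambda>i. y i * z i) = kappa y ** kappa z"
proof -
  have "kappa (\<lambda>i. y i * z i) = finprod (grp T) (\<lambda>i. coroot i (y i) ** coroot i (z i)) {1..n}"
    unfolding kappa_def using assms
    by (intro Tg.finprod_cong) (auto simp: cor_mult nonvanishing_def simp_implies_def)
  also have "\<dots> = kappa y ** kappa z"
    unfolding kappa_def using assms
      Tg.finprod_multf[of "\<lambda>i. coroot i (y i)" "{1..n}" "\<lambda>i. coroot i (z i)"]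
    by (auto simp: nonvanishing_def)
  finally show ?thesis .
qed

lemma kappa_cong: "(\<And>i. i \<in> {1..n} \<Longrightarrow> y i = z i) \<Longrightarrow> nonvanishing z \<Longrightarrow> kappa y = kappa z"
  unfolding kappa_def by (intro Tg.finprod_cong) (auto simp: nonvanishing_def simp_implies_def)

lemma kappa_one [simp]: "kappa (\<lambda>_. 1) = mat 1"
  unfolding kappa_def using Tg.finprod_one_eqI[of "{1..n}" "\<lambda>i. coroot i 1"] by (auto simp: cor_one)

lemma rt_kappa:
  "v \<in> D_roots n \<Longrightarrow> nonvanishing y \<Longrightarrow> rt v (kappa y) = (\<Prod>i=1..n. y i powi dot n v (simple n i))"
  unfolding kappa_def by (subst rt_finprod) (auto simp: rt_cor nonvanishing_def)

lemma kappa_single: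
  assumes "j \<in> {1..n}" "x \<noteq> 0"
  shows "kappa (\<lambda>i. if i = j then x else 1) = coroot j x"
proof -
  have "kappa (\<lambda>i. if i = j then x else 1) = finprod (grp T) (\<lambda>i. if j = i then coroot i x else \<one>\<^bsub>grp T\<^esub>) {1..n}"
    unfolding kappa_def using assms by (intro Tg.finprod_cong) (auto simp: cor_one simp_implies_def)
  also have "\<dots> = coroot j x"
    using assms by (subst Tg.finprod_singleton) auto
  finally show ?thesis .
qed

text \<open>The columns of the Cartan matrix, written out for the five kinds of nodes.\<close>

lemma alpha_kappa:
  assumes "nonvanishing y"
  shows "alpha 1 (kappa y) = y 1 ^ 2 / y 2"
    and "2 \<le> j \<Longrightarrow> j \<le> n - 3 \<Longrightarrow> alpha j (kappa y) = y j ^ 2 / (y (j - 1) * y (j + 1))"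
    and "alpha (n - 2) (kappa y) = y (n - 2) ^ 2 / (y (n - 3) * y (n - 1) * y n)"
    and "alpha (n - 1) (kappa y) = y (n - 1) ^ 2 / y (n - 2)"
    and "alpha n (kappa y) = y n ^ 2 / y (n - 2)"
proof -
  have neg1: "x powi (-1) = inverse x" and pos2: "x powi 2 = x ^ 2" for x :: 'f
    by (simp_all add: power_int_def)
  have *: "alpha j (kappa y) = (\<Prod>i\<in>J. y i powi (if j = i then 2 else -1))"
    if j: "j \<in> {1..n}" and J: "J \<subseteq> {1..n}" "\<And>i. i \<in> {1..n} \<Longrightarrow> i \<in> J \<longleftrightarrow> i = j \<or> adj n j i" for j J
  proof -
    have "alpha j (kappa y) = (\<Prod>i=1..n. y i powi dot n (simple n j) (simple n i))"
      using assms j by (intro rt_kappa) auto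
    also have "\<dots> = (\<Prod>i\<in>J. y i powi dot n (simple n j) (simple n i))"
      using J j rank by (intro prod.mono_neutral_right) (auto simp: cartan_D)
    also have "\<dots> = (\<Prod>i\<in>J. y i powi (if j = i then 2 else -1))"
      using J j rank by (intro prod.cong) (auto simp: cartan_D)
    finally show ?thesis .
  qed
  show "alpha 1 (kappa y) = y 1 ^ 2 / y 2"
    by (subst *[where J = "{1, 2}"]) (use rank in \<open>auto simp: adj_def neg1 pos2 divide_inverse\<close>)
  show "alpha j (kappa y) = y j ^ 2 / (y (j - 1) * y (j + 1))" if j: "2 \<le> j" "j \<le> n - 3"
  proof (subst *[where J = "{j, j - 1, j + 1}"])
    have "j < n" "j \<noteq> n" "j \<noteq> n - 2" "j + 1 < n" "j - 1 < n" "j = Suc (j - 1)" using j rank by linarith+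
    then show "i \<in> {j, j - 1, j + 1} \<longleftrightarrow> i = j \<or> adj n j i" for i
      by (auto simp: adj_def)
  qed (use j rank in \<open>auto simp: neg1 pos2 divide_inverse\<close>)
  show "alpha (n - 2) (kappa y) = y (n - 2) ^ 2 / (y (n - 3) * y (n - 1) * y n)"
  proof (subst *[where J = "{n - 2, n - 3, n - 1, n}"])
    show "i \<in> {n - 2, n - 3, n - 1, n} \<longleftrightarrow> i = n - 2 \<or> adj n (n - 2) i" for i
      using rank by (auto simp: adj_def)
    have "n - 2 \<noteq> n - 3" "n - 2 \<noteq> n - 1" "n - 2 \<noteq> n" "n - 3 \<noteq> n - 1" "n - 3 \<noteq> n" "n - 1 \<noteq> n"
      using rank by linarith+
    then show "(\<Prod>i\<in>{n - 2, n - 3, n - 1, n}. y i powi (if n - 2 = i then 2 else - 1))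
       = y (n - 2) ^ 2 / (y (n - 3) * y (n - 1) * y n)"
      by (simp add: neg1 pos2 divide_inverse mult_ac)
  qed (use rank in auto)
  show "alpha (n - 1) (kappa y) = y (n - 1) ^ 2 / y (n - 2)"
  proof (subst *[where J = "{n - 1, n - 2}"])
    show "i \<in> {n - 1, n - 2} \<longleftrightarrow> i = n - 1 \<or> adj n (n - 1) i" if "i \<in> {1..n}" for i
      using rank that by (auto simp: adj_def)
    have "n - 2 \<noteq> n - 1" using rank by linarith
    then show "(\<Prod>i\<in>{n - 1, n - 2}. y i powi (if n - 1 = i then 2 else - 1)) = y (n - 1) ^ 2 / y (n - 2)"
      by (simp add: neg1 pos2 divide_inverse mult_ac)
  qed (use rank in auto)
  show "alpha n (kappa y) = y n ^ 2 / y (n - 2)"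
  proof (subst *[where J = "{n, n - 2}"])
    show "i \<in> {n, n - 2} \<longleftrightarrow> i = n \<or> adj n n i" for i
      using rank by (auto simp: adj_def)
    have "n - 2 \<noteq> n" using rank by linarith
    then show "(\<Prod>i\<in>{n, n - 2}. y i powi (if n = i then 2 else - 1)) = y n ^ 2 / y (n - 2)"
      by (simp add: neg1 pos2 divide_inverse mult_ac)
  qed (use rank in auto)
qed

text \<open>The coefficients of \<open>2 \<omega>\<^sub>n\<close> in the simple coroots, which are integral for even \<open>n\<close>.\<close>

definition omega_coeff :: "nat \<Rightarrow> nat" where
  "omega_coeff i = (if i \<le> n - 2 then i else if i = n - 1 then (n - 2) div 2 else n div 2)"

lemma omega_coeff_simps [simp]:
  "i \<le> n - 2 \<Longrightarrow> omega_coeff i = i" "omega_coeff (n - 1) = (n - 2) div 2" "omega_coeff n = n div 2"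
proof -
  have "\<not> n - 1 \<le> n - 2" "\<not> n \<le> n - 2" "n \<noteq> n - 1" using rank by linarith+
  then show "i \<le> n - 2 \<Longrightarrow> omega_coeff i = i" "omega_coeff (n - 1) = (n - 2) div 2" "omega_coeff n = n div 2"
    by (simp_all only: omega_coeff_def if_True if_False simp_thms)
qed

lemma om_cocharacter: "om \<in> cocharacters T"
  using om by (simp add: fundamental_coweight_def)

lemma alpha_om: "j \<in> {1..n} \<Longrightarrow> x \<noteq> 0 \<Longrightarrow> alpha j (om x) = (if j = n then x else 1)"
  using om by (simp add: fundamental_coweight_def)

lemma coroot_comb_kappa: "coroot_comb n T cor k x = kappa (\<lambda>i. x powi k i)"
  by (simp add: coroot_comb_def kappa_def)

text \<open>The coweight is only given through a multiple \<open>m \<omega>\<^sub>n = \<Sum>\<^sub>i k\<^sub>i \<alpha>\<^sub>i\<^sup>\<or>\<close>. Pairing with the simple roots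
  determines the coefficients: \<open>k\<^sub>i\<close> is \<open>k\<^sub>1\<close> times that of \<open>2 \<omega>\<^sub>n\<close>, and \<open>m = 2 k\<^sub>1\<close>. As \<open>k\<^sub>1\<close>-th roots
  exist, the factor \<open>k\<^sub>1\<close> can be divided out.\<close>

lemma om_square:
  assumes y: "y \<noteq> 0"
  shows "om (y ^ 2) = kappa (\<lambda>i. y ^ omega_coeff i)"
proof -
  obtain m k where m: "0 < m" and k: "\<And>x. x \<noteq> 0 \<Longrightarrow> om (x ^ m) = kappa (\<lambda>i. x powi k i)"
    using om unfolding fundamental_coweight_def coroot_comb_kappa by blast
  have nv: "nonvanishing (\<lambda>i. x powi k i)" if "x \<noteq> 0" for x using that by (simp add: nonvanishing_def)
  have al: "alpha j (kappa (\<lambda>i. x powi k i)) = (if j = n then x ^ m else 1)" if "x \<noteq> 0" "j \<in> {1..n}" for x j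
    using alpha_om[of j "x ^ m"] k[of x] that by simp
  have p2: "(x powi a) ^ 2 = x powi (2 * a)" if "x \<noteq> 0" for x :: 'f and a
    using that power_int_add[of x a a] by (simp only: power2_eq_square mult_2 disj_not1 simp_thms)
  have e1: "2 * k 1 = k 2"
  proof (rule powi_eq_imp_eq)
    fix x :: 'f assume x: "x \<noteq> 0"
    show "x powi (2 * k 1) = x powi k 2"
      using alpha_kappa(1)[OF nv[OF x]] al[OF x, of 1] x rank by (simp add: p2[OF x] field_simps split: if_splits)
  qed
  have e2: "2 * k j = k (j - 1) + k (j + 1)" if j: "2 \<le> j" "j \<le> n - 3" for j
  proof (rule powi_eq_imp_eq)
    fix x :: 'f assume x: "x \<noteq> 0"
    show "x powi (2 * k j) = x powi (k (j - 1) + k (j + 1))"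
      using alpha_kappa(2)[OF nv[OF x] j] al[OF x, of j] x rank j
      by (simp add: p2[OF x] power_int_add field_simps split: if_splits)
  qed
  have e3: "2 * k (n - 2) = k (n - 3) + k (n - 1) + k n"
  proof (rule powi_eq_imp_eq)
    fix x :: 'f assume x: "x \<noteq> 0"
    show "x powi (2 * k (n - 2)) = x powi (k (n - 3) + k (n - 1) + k n)"
      using alpha_kappa(3)[OF nv[OF x]] al[OF x, of "n - 2"] x rank
      by (simp add: p2[OF x] power_int_add field_simps split: if_splits)
  qed
  have e4: "2 * k (n - 1) = k (n - 2)"
  proof (rule powi_eq_imp_eq)
    fix x :: 'f assume x: "x \<noteq> 0"
    show "x powi (2 * k (n - 1)) = x powi (k (n - 2))"
      using alpha_kappa(4)[OF nv[OF x]] al[OF x, of "n - 1"] x rank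
      by (simp add: p2[OF x] power_int_add field_simps split: if_splits)
  qed
  have e5: "2 * k n = k (n - 2) + int m"
  proof (rule powi_eq_imp_eq)
    fix x :: 'f assume x: "x \<noteq> 0"
    show "x powi (2 * k n) = x powi (k (n - 2) + int m)"
      using alpha_kappa(5)[OF nv[OF x]] al[OF x, of n] x rank
      by (simp add: p2[OF x] power_int_add field_simps split: if_splits)
  qed
  have lin: "k (Suc j) = int (Suc j) * k 1 \<and> k j = int j * k 1" if "1 \<le> j" "j \<le> n - 3" for j
    using that
  proof (induction j rule: dec_induct)
    case base
    then show ?case using e1 by (simp add: numeral_2_eq_2)
  next
    case (step j)
    then have "2 * k (Suc j) = k j + k (Suc (Suc j))" using e2[of "Suc j"] by simp
    then show ?case using step by (simp add: algebra_simps)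
  qed
  have "Suc (n - 3) = n - 2" using rank by simp
  then have l2: "k (n - 2) = int (n - 2) * k 1" "k (n - 3) = int (n - 3) * k 1"
    using lin[of "n - 3"] rank by auto
  define p where "p = (n - 2) div 2"
  have "n - 2 = 2 * p" using rank by (auto simp: p_def)
  then have p: "int (n - 2) = 2 * int p" "int (n - 3) = 2 * int p - 1" "n div 2 = Suc p"
    using rank by auto
  have kn1: "k (n - 1) = int p * k 1" using e4 l2(1) p by simp
  have kn: "k n = int (Suc p) * k 1" using e3 l2 kn1 p by (simp add: algebra_simps)
  have mk: "int m = 2 * k 1" using e5 l2(1) kn p by (simp add: algebra_simps)
  then have k1: "0 < k 1" using m by simp
  have kk: "k i = k 1 * int (omega_coeff i)" if "i \<in> {1..n}" for i
  proof -
    consider "i \<le> n - 3" | "i = n - 2" | "i = n - 1" | "i = n" using D_node_cases[OF \<open>i \<in> {1..n}\<close>] by blast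
    then show ?thesis
    proof cases
      case 1 then show ?thesis using lin[of i] that by (simp add: omega_coeff_def)
    next
      case 2 then show ?thesis using l2 by (simp add: omega_coeff_def)
    next
      case 3 then show ?thesis using kn1 3 by (simp only: omega_coeff_simps p_def mult.commute)
    next
      case 4 then show ?thesis using kn p(3) 4 by (simp only: omega_coeff_simps mult.commute)
    qed
  qed
  obtain x where x: "x ^ nat (k 1) = y" using nth_root_exists[of "nat (k 1)" y] k1 by auto
  have x0: "x \<noteq> 0" using x y k1 by (auto simp: power_0_left)
  have "m = nat (k 1) * 2" using mk k1 by linarith
  then have "om (y ^ 2) = om (x ^ m)" using x by (simp add: power_mult)
  also have "\<dots> = kappa (\<lambda>i. x powi k i)" by (rule k[OF x0])
  also have "\<dots> = kappa (\<lambda>i. y ^ omega_coeff i)"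
  proof (rule kappa_cong)
    fix i assume i: "i \<in> {1..n}"
    have "x powi k i = x ^ (nat (k 1) * omega_coeff i)"
      using kk[OF i] k1 by (simp add: power_int_def nat_mult_distrib)
    then show "x powi k i = y ^ omega_coeff i" using x by (simp add: power_mult)
  qed (use y in \<open>simp add: nonvanishing_def\<close>)
  finally show ?thesis .
qed

lemma om_kappa: "x \<noteq> 0 \<Longrightarrow> \<exists>y. nonvanishing y \<and> om x = kappa y"
proof -
  assume x: "x \<noteq> 0"
  obtain y where y: "y ^ 2 = x" using nth_root_exists[of 2 x] by auto
  then have "y \<noteq> 0" using x by auto
  then show ?thesis using om_square[of y] y
    by (intro exI[of _ "\<lambda>i. y ^ omega_coeff i"]) (auto simp: nonvanishing_def)
qed

lemma cocharacter_kappa: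
  assumes "l \<in> cocharacters T" "x \<noteq> 0"
  shows "\<exists>y. nonvanishing y \<and> l x = kappa y"
proof -
  obtain k m where "l x = kappa (\<lambda>i. x powi k i) ** om (x powi m)"
    using lattice assms unfolding cocharacters_generated_def coroot_comb_kappa by blast
  moreover obtain y where y: "nonvanishing y" "om (x powi m) = kappa y" using om_kappa[of "x powi m"] assms by auto
  moreover have "nonvanishing (\<lambda>i. x powi k i)" using assms by (simp add: nonvanishing_def)
  ultimately show ?thesis
    using assms by (intro exI[of _ "\<lambda>i. x powi k i * y i"]) (auto simp: kappa_mult nonvanishing_def)
qed

text \<open>A torus is the product of the images of its cocharacters, and these lie in the span of the
  coroots after extracting roots of the argument.\<close>

lemma T_kappa:
  assumes "t \<in> T"
  obtains y where "nonvanishing y" "t = kappa y"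
proof -
  obtain r :: nat and ch l where ch: "\<And>i. i < r \<Longrightarrow> ch i \<in> characters T" "\<And>i. i < r \<Longrightarrow> l i \<in> cocharacters T"
    and t: "t = finprod (grp T) (\<lambda>i. l i (ch i t)) {..<r}"
    using T_torus assms unfolding torus_def by blast
  have nz: "ch i t \<noteq> 0" if "i < r" for i
    using ch(1)[OF that] assms by (auto simp: characters_def hom_def Pi_iff)
  have "\<exists>y. nonvanishing y \<and> finprod (grp T) (\<lambda>i. l i (ch i t)) A = kappa y" if "A \<subseteq> {..<r}" "finite A" for A
    using that(2,1)
  proof (induction A rule: finite_induct)
    case empty
    show ?case by (intro exI[of _ "\<lambda>_. 1"]) (simp add: nonvanishing_def)
  next
    case (insert a A)
    then obtain y where y: "nonvanishing y" "finprod (grp T) (\<lambda>i. l i (ch i t)) A = kappa y" by auto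
    obtain z where z: "nonvanishing z" "l a (ch a t) = kappa z"
      using cocharacter_kappa[of "l a" "ch a t"] ch nz insert by auto
    have "l i (ch i t) \<in> T" if "i \<in> insert a A" for i
      using that insert.prems ch(2) nz by (intro cocharacter_mem) auto
    then have "finprod (grp T) (\<lambda>i. l i (ch i t)) (insert a A)
        = l a (ch a t) ** finprod (grp T) (\<lambda>i. l i (ch i t)) A"
      using Tg.finprod_insert[of A a "\<lambda>i. l i (ch i t)"] insert by (auto simp: Pi_iff)
    then show ?case using y z by (intro exI[of _ "\<lambda>i. z i * y i"]) (auto simp: kappa_mult nonvanishing_def)
  qed
  from this[of "{..<r}"] t that show ?thesis by auto
qed

text \<open>Since the coroots generate the torus, a root is determined by its pairings with them; linear
  relations between roots as vectors become multiplicative relations between characters.\<close>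

lemma rt_eq_on_T:
  assumes "v \<in> D_roots n" "w \<in> D_roots n" "v' \<in> D_roots n" "t \<in> T"
    and "\<And>i. i \<in> {1..n} \<Longrightarrow> dot n v (simple n i) = dot n w (simple n i) + c * dot n v' (simple n i)"
  shows "rt v t = rt w t * rt v' t powi c"
proof -
  obtain y where y: "nonvanishing y" "t = kappa y" using assms(4) by (rule T_kappa)
  have "(\<Prod>i=1..n. y i powi dot n v (simple n i))
      = (\<Prod>i=1..n. y i powi dot n w (simple n i) * (y i powi dot n v' (simple n i)) powi c)"
  proof (intro prod.cong refl)
    fix i assume i: "i \<in> {1..n}"
    have "y i powi (c * dot n v' (simple n i)) = (y i powi dot n v' (simple n i)) powi c"
      by (metis power_int_mult mult.commute)
    then show "y i powi dot n v (simple n i)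
        = y i powi dot n w (simple n i) * (y i powi dot n v' (simple n i)) powi c"
      using i y assms(5)[OF i] by (simp add: nonvanishing_def power_int_add)
  qed
  also have "\<dots> = (\<Prod>i=1..n. y i powi dot n w (simple n i)) * (\<Prod>i=1..n. y i powi dot n v' (simple n i)) powi c"
    by (simp add: prod.distrib prod_powi)
  finally show ?thesis using y assms(1-3) by (simp add: rt_kappa)
qed

lemma rt_add:
  assumes "v \<in> D_roots n" "w \<in> D_roots n" "(\<lambda>k. v k + w k) \<in> D_roots n" "t \<in> T"
  shows "rt (\<lambda>k. v k + w k) t = rt v t * rt w t"
  using rt_eq_on_T[OF assms(3,1,2,4), of 1] by (simp add: dot_add_left)

lemma rt_uminus:
  assumes "v \<in> D_roots n" "t \<in> T"
  shows "rt (- v) t = inverse (rt v t)"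
proof -
  have "rt (- v) t = rt v t * rt v t powi (-2)"
    using assms by (intro rt_eq_on_T) (auto simp: D_roots_uminus dot_uminus_left)
  then show ?thesis using rt_nonzero[OF assms] by (simp add: power_int_minus power2_eq_square field_simps)
qed

lemma rt_refl:
  assumes "v \<in> D_roots n" "a \<in> D_roots n" "t \<in> T"
  shows "rt (root_refl n a v) t = rt v t * rt a t powi (- dot n v a)"
  using assms by (intro rt_eq_on_T) (auto simp: refl_root, simp add: root_refl_def dot_diff_scale_left)

section \<open>The centre and the cocharacter lattice\<close>

definition central :: "'f ^ 'm ^ 'm \<Rightarrow> bool" where
  "central r \<longleftrightarrow> r \<in> T \<and> (\<forall>j\<in>{1..n}. alpha j r = 1)"

definition zc :: "'f \<Rightarrow> 'f ^ 'm ^ 'm" where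
  "zc c = kappa (\<lambda>i. if i \<in> {n - 1, n} then c else 1)"

lemma zc_nonvanishing: "c \<noteq> 0 \<Longrightarrow> nonvanishing (\<lambda>i. if i \<in> {n - 1, n} then c else 1)"
  by (simp add: nonvanishing_def)

lemma central_zc: "c ^ 2 = 1 \<Longrightarrow> central (zc c)"
proof -
  assume c: "c ^ 2 = 1"
  then have c0: "c \<noteq> 0" by auto
  have cc: "c * c = 1" using c by (simp add: power2_eq_square)
  note nv = zc_nonvanishing[OF c0]
  have "alpha j (zc c) = 1" if "j \<in> {1..n}" for j
  proof -
    consider "j = 1" | "2 \<le> j" "j \<le> n - 3" | "j = n - 2" | "j = n - 1" | "j = n"
      using \<open>j \<in> {1..n}\<close> D_node_cases[OF \<open>j \<in> {1..n}\<close>]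
      by (metis Suc_1 atLeastAtMost_iff le_antisym not_less_eq_eq)
    then show ?thesis 
    proof cases
      case 1 then show ?thesis using alpha_kappa(1)[OF nv] rank by (auto simp: zc_def)
    next
      case 2 then show ?thesis using alpha_kappa(2)[OF nv 2] rank by (auto simp: zc_def)
    next
      case 3
      have "n - 3 \<noteq> n - 1" "n - 2 \<noteq> n - 1" "n - 3 \<noteq> n" "n - 2 \<noteq> n" using rank by linarith+
      then show ?thesis using alpha_kappa(3)[OF nv] 3 cc by (simp add: zc_def)
    next
      case 4
      have "n - 2 \<noteq> n - 1" "n - 2 \<noteq> n" using rank by linarith+
      then show ?thesis using alpha_kappa(4)[OF nv] 4 c by (simp add: zc_def)
    next
      case 5
      have "n - 2 \<noteq> n - 1" "n - 2 \<noteq> n" using rank by linarith+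
      then show ?thesis using alpha_kappa(5)[OF nv] 5 c by (simp add: zc_def)
    qed
  qed
  then show ?thesis using nv by (simp add: central_def zc_def)
qed

text \<open>Let \<open>r = \<kappa>(y)\<close> with all simple roots trivial at \<open>r\<close>. Along the chain this means \<open>y\<^sub>i = w\<^sup>i\<close> with
  \<open>w = y\<^sub>1\<close>, and at the two leaves it determines \<open>y\<close> up to signs. So \<open>r\<close> is the value of \<open>2 \<omega>\<^sub>n\<close> at \<open>w\<close>,
  corrected at the leaves. The equation at the branch node shows that both corrections are equal,
  and comparison of the leaves gives \<open>w\<^sup>2 = 1\<close>. Hence the value \<open>\<omega>\<^sub>n(w\<^sup>2)\<close> is trivial.\<close>

lemma central_is_zc:
  assumes "central r"
  shows "\<exists>c. c ^ 2 = 1 \<and> r = zc c"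
proof -
  obtain y where y: "nonvanishing y" "r = kappa y" using assms T_kappa unfolding central_def by blast
  have al: "alpha j (kappa y) = 1" if "j \<in> {1..n}" for j using assms y that by (simp add: central_def)
  have nz: "y i \<noteq> 0" if "1 \<le> i" "i \<le> n" for i using y that by (simp add: nonvanishing_def)
  have one: "1 \<in> {1..n}" and n2: "n - 2 \<in> {1..n}" and n1: "n - 1 \<in> {1..n}" and nn: "n \<in> {1..n}"
    using rank by auto
  define w where "w = y 1"
  have w0: "w \<noteq> 0" using nz[of 1] rank by (simp add: w_def)
  have e1: "y 2 = w ^ 2" using alpha_kappa(1)[OF y(1)] al[OF one] nz[of 2] rank by (simp add: w_def field_simps)
  have lin: "y (Suc j) = w ^ Suc j \<and> y j = w ^ j" if "1 \<le> j" "j \<le> n - 3" for j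
    using that
  proof (induction j rule: dec_induct)
    case base
    then show ?case using e1 by (simp add: numeral_2_eq_2 w_def)
  next
    case (step j)
    then have j: "2 \<le> Suc j" "Suc j \<le> n - 3" by auto
    have nz2: "y (Suc (Suc j)) \<noteq> 0" using nz[of "Suc (Suc j)"] j rank by simp
    have "y (Suc j) ^ 2 = y j * y (Suc (Suc j))"
      using alpha_kappa(2)[OF y(1) j] al[of "Suc j"] nz[of j] nz2 step rank by (auto simp: field_simps)
    then have "w ^ j * y (Suc (Suc j)) = w ^ j * w ^ Suc (Suc j)"
      using step by (auto simp: power2_eq_square algebra_simps)
    then have "y (Suc (Suc j)) = w ^ Suc (Suc j)" using w0 by (metis mult_left_cancel power_not_zero)
    then show ?case using step by simp
  qed
  have "Suc (n - 3) = n - 2" using rank by simp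
  then have l2: "y (n - 2) = w ^ (n - 2)" "y (n - 3) = w ^ (n - 3)" using lin[of "n - 3"] rank by auto
  obtain h where h: "n = 2 * h" using rank by blast
  have h3: "3 \<le> h" using h rank by simp
  define p where "p = (n - 2) div 2"
  have p: "n - 2 = 2 * p" "n div 2 = Suc p" "n - 3 + 1 = 2 * p" using h h3 by (auto simp: p_def)
  have sq1: "y (n - 1) ^ 2 = w ^ (2 * p)"
    using alpha_kappa(4)[OF y(1)] al[OF n1] l2(1) p(1) w0 by simp
  have sq2: "y n ^ 2 = w ^ (2 * p)"
    using alpha_kappa(5)[OF y(1)] al[OF nn] l2(1) p(1) w0 by simp
  have b: "w ^ (2 * p) * w ^ (2 * p) = w ^ (n - 3) * y (n - 1) * y n"
    using alpha_kappa(3)[OF y(1)] al[OF n2] l2 p(1) w0 nz[of "n - 1"] nz[of n] rank by (simp add: power2_eq_square)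
  have "w ^ (n - 3) * (w * w ^ (2 * p)) = w ^ (n - 3) * (y (n - 1) * y n)"
    using b p(3) by (metis (no_types, lifting) mult.assoc power_add power_one_right)
  then have b': "y (n - 1) * y n = w * w ^ (2 * p)" using w0 by simp
  \<comment> \<open>The deviations from \<open>2 \<omega>\<^sub>n\<close> at the two leaves, both of which turn out to be \<open>c\<close>.\<close>
  define c where "c = y (n - 1) / w ^ p"
  define c' where "c' = y n / w ^ Suc p"
  have c2: "c ^ 2 = 1" using sq1 w0 by (simp add: c_def power_divide power_mult[symmetric] mult.commute)
  have "c * c' = 1" using b' w0 by (simp add: c_def c'_def field_simps flip: power_add mult_2)
  then have cc': "c' = c" using c2 by (metis mult.assoc mult.left_neutral mult.right_neutral power2_eq_square)
  have w2: "w ^ 2 = 1"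
  proof -
    have "c' ^ 2 = 1" using cc' c2 by simp
    then have "y n ^ 2 = (w ^ Suc p) ^ 2" using w0 by (simp add: c'_def power_divide)
    also have "\<dots> = w ^ (2 * p) * w ^ 2" by (simp add: power2_eq_square mult_2 mult_2_right power_add mult_ac)
    finally show ?thesis using sq2 w0 by simp
  qed
  have c0: "c \<noteq> 0" using c2 by auto
  have nvw: "nonvanishing (\<lambda>i. w ^ omega_coeff i)" using w0 by (simp add: nonvanishing_def)
  have "r = kappa (\<lambda>i. w ^ omega_coeff i * (if i \<in> {n - 1, n} then c else 1))"
    unfolding y(2)
  proof (rule kappa_cong)
    fix i assume i: "i \<in> {1..n}"
    consider "i \<le> n - 3" | "i = n - 2" | "i = n - 1" | "i = n" using D_node_cases[OF i] by blast
    then show "y i = w ^ omega_coeff i * (if i \<in> {n - 1, n} then c else 1)"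
    proof cases
      case 1
      then have "i \<noteq> n - 1" "i \<noteq> n" using rank by linarith+
      then show ?thesis using lin[of i] 1 i rank by (simp add: omega_coeff_def)
    next
      case 2
      then have "i \<noteq> n - 1" "i \<noteq> n" using rank by linarith+
      then show ?thesis using l2 2 by (simp add: omega_coeff_def)
    next
      case 3
      then have "y i = w ^ omega_coeff i * c"
        using w0 omega_coeff_simps(2) by (simp only: c_def p_def[symmetric]) simp
      then show ?thesis using 3 by simp
    next
      case 4
      have "c = y n / w ^ Suc p" using cc' c'_def by simp
      then have "y i = w ^ omega_coeff i * c"
        using 4 w0 p(2) omega_coeff_simps(3) by simp
      then show ?thesis using 4 by simp
    qed
  qed (use w0 c0 in \<open>auto simp: nonvanishing_def\<close>)
  also have "\<dots> = om (w ^ 2) ** zc c"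
    using kappa_mult[OF nvw zc_nonvanishing[OF c0]] om_square[OF w0] by (simp add: zc_def)
  also have "\<dots> = zc c" using w2 cocharacter_one[OF om_cocharacter] by simp
  finally show ?thesis using c2 by blast
qed

lemma alpha_coroot: 
  assumes "i \<in> {1..n}" "j \<in> {1..n}" "x \<noteq> 0"
  shows "alpha j (coroot i x) = (if j = i then x ^ 2 else if adj n j i then inverse x else 1)"
proof -
  have "alpha j (coroot i x) = x powi dot n (simple n j) (simple n i)"
    using assms by (intro rt_cor) auto
  then show ?thesis using assms rank by (auto simp: cartan_D power_int_def)
qed

text \<open>The sum of the odd-numbered simple roots pairs evenly with the coroots, and trivially with
  \<open>\<omega>\<^sub>n\<close> because \<open>n\<close> is even. So it pairs evenly with the whole cocharacter lattice.\<close>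

lemma cocharacter_parity:
  assumes \<mu>: "\<mu> \<in> cocharacters T"
    and d: "\<And>j x. j \<in> {1..n} \<Longrightarrow> x \<noteq> 0 \<Longrightarrow> alpha j (\<mu> x) = x powi d j"
  shows "even (\<Sum>q<n div 2. d (2 * q + 1))"
proof -
  obtain k m where k: "\<And>x. x \<noteq> 0 \<Longrightarrow> \<mu> x = kappa (\<lambda>i. x powi k i) ** om (x powi m)"
    using lattice \<mu> unfolding cocharacters_generated_def coroot_comb_kappa by blast
  have dj: "d j = (\<Sum>i=1..n. k i * dot n (simple n j) (simple n i))" if j: "j \<in> {1..n}" "j \<noteq> n" for j
  proof (rule powi_eq_imp_eq)
    fix x :: 'f assume x: "x \<noteq> 0"
    have nv: "nonvanishing (\<lambda>i. x powi k i)" using x by (simp add: nonvanishing_def)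
    have "x powi d j = alpha j (kappa (\<lambda>i. x powi k i)) * alpha j (om (x powi m))"
      using d[OF j(1) x] k[OF x] rt_mult[of "simple n j" "kappa (\<lambda>i. x powi k i)" "om (x powi m)"]
        nv j x om_cocharacter by (simp add: cocharacter_mem)
    also have "alpha j (om (x powi m)) = 1" using alpha_om[of j "x powi m"] j x by simp
    also have "alpha j (kappa (\<lambda>i. x powi k i)) = (\<Prod>i=1..n. x powi (k i * dot n (simple n j) (simple n i)))"
      using rt_kappa[OF _ nv, of "simple n j"] j by (simp add: power_int_mult)
    also have "\<dots> = x powi (\<Sum>i=1..n. k i * dot n (simple n j) (simple n i))"
      by (rule powi_prod_exponents[OF x])
    finally show "x powi d j = x powi (\<Sum>i=1..n. k i * dot n (simple n j) (simple n i))" by simp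
  qed
  have "(\<Sum>q<n div 2. d (2 * q + 1))
      = (\<Sum>q<n div 2. \<Sum>i=1..n. k i * dot n (simple n (2 * q + 1)) (simple n i))"
  proof (rule sum.cong)
    fix q assume "q \<in> {..<n div 2}"
    then have "2 * q + 1 \<in> {1..n}" "2 * q + 1 \<noteq> n" using rank by auto
    then show "d (2 * q + 1) = (\<Sum>i=1..n. k i * dot n (simple n (2 * q + 1)) (simple n i))" by (rule dj)
  qed simp
  also have "\<dots> = (\<Sum>i=1..n. k i * (\<Sum>q<n div 2. dot n (simple n (2 * q + 1)) (simple n i)))"
    by (subst sum.swap) (simp add: sum_distrib_left)
  finally show ?thesis
    using simple_alternating_sum_even[OF rank] by (auto intro!: dvd_sum)
qed

lemma odd_indicator_sum: "(\<Sum>q<n div 2. if 2 * q + 1 = n - 1 then 1 else 0 :: int) = 1"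
proof -
  have "(2 * q + 1 = n - 1) = (q = n div 2 - 1)" for q using rank by auto
  then show ?thesis using rank by (simp add: sum.delta')
qed

text \<open>Otherwise \<open>c = -1\<close>, and the cocharacter \<open>x \<mapsto> \<alpha>\<^sub>n\<^sub>-\<^sub>1\<^sup>\<or>(x) \<alpha>\<^sub>n\<^sup>\<or>(x)\<close> is trivial at \<open>-1\<close>. It is then the
  square of a cocharacter, whose pairing with \<open>\<alpha>\<^sub>1 + \<alpha>\<^sub>3 + \<dots> + \<alpha>\<^sub>n\<^sub>-\<^sub>1\<close> is 1, against parity.\<close>

lemma zc_eq_one:
  assumes c: "c ^ 2 = 1" and z: "zc c = mat 1"
  shows "c = 1"
proof (rule ccontr)
  assume c1: "c \<noteq> 1"
  have "(c - 1) * (c + 1) = 0" using c by (simp add: algebra_simps power2_eq_square)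
  then have cm: "c = - 1" using c1 by (simp add: eq_neg_iff_add_eq_0)
  have two: "(2::'f) \<noteq> 0"
  proof
    assume "(2::'f) = 0"
    then have "(1::'f) + 1 = 0" by simp
    then show False using c1 cm by (simp add: eq_neg_iff_add_eq_0)
  qed
  have n1: "n - 1 \<in> {1..n}" and nn: "n \<in> {1..n}" and ne: "n - 1 \<noteq> n" using rank by auto
  define \<nu> where "\<nu> x = coroot (n - 1) x ** coroot n x" for x
  have nu: "\<nu> \<in> cocharacters T" unfolding \<nu>_def
    by (rule cocharacter_prod) (use n1 nn in \<open>auto simp: cor_cocharacter T_commute\<close>)
  have "\<nu> (- 1) = zc c"
  proof -
    have "zc c = kappa (\<lambda>i. (if i = n - 1 then c else 1) * (if i = n then c else 1))"
      unfolding zc_def by (rule kappa_cong) (use ne c in \<open>auto simp: nonvanishing_def\<close>)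
    also have "\<dots> = kappa (\<lambda>i. if i = n - 1 then c else 1) ** kappa (\<lambda>i. if i = n then c else 1)"
      using c by (intro kappa_mult) (auto simp: nonvanishing_def)
    also have "\<dots> = coroot (n - 1) c ** coroot n c"
      using c by (subst (1 2) kappa_single) (use n1 nn in auto)
    finally show ?thesis by (simp add: \<nu>_def cm)
  qed
  then have num: "\<nu> (- 1) = mat 1" using z by simp
  have even: "\<nu> (- x) = \<nu> x" if "x \<noteq> 0" for x
    using cocharacter_mult[OF nu, of "- 1" x] that num by simp
  have "\<exists>h. laurent h \<and> (\<forall>x. x \<noteq> 0 \<longrightarrow> h (x ^ 2) = \<nu> x $ i $ j)" for i j
    using nu even two by (intro laurent_even) (auto simp: cocharacters_iff)
  then obtain h where h: "\<And>i j. laurent (h i j)" "\<And>i j x. x \<noteq> 0 \<Longrightarrow> h i j (x ^ 2) = \<nu> x $ i $ j"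
    by metis
  \<comment> \<open>The square root of \<open>\<nu>\<close>, entry by entry.\<close>
  define \<mu> where "\<mu> y = (\<chi> i j. h i j y)" for y
  have mu2: "\<mu> (x ^ 2) = \<nu> x" if "x \<noteq> 0" for x
    using that by (simp add: \<mu>_def h(2) vec_eq_iff)
  have root: "\<exists>x. x \<noteq> 0 \<and> y = x ^ 2" if "y \<noteq> 0" for y :: 'f
    using nth_root_exists[of 2 y] that by fastforce
  have mu: "\<mu> \<in> cocharacters T" unfolding cocharacters_iff
  proof
    show "\<mu> \<in> hom Gm (grp T)"
    proof (rule homI)
      fix y assume "y \<in> carrier (Gm :: 'f monoid)"
      then obtain x where "x \<noteq> 0" "y = x ^ 2" using root[of y] by auto
      then show "\<mu> y \<in> carrier (grp T)" using mu2 cocharacter_mem[OF nu] by simp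
    next
      fix y y' assume "y \<in> carrier (Gm :: 'f monoid)" "y' \<in> carrier (Gm :: 'f monoid)"
      then obtain x x' where "x \<noteq> 0" "y = x ^ 2" "x' \<noteq> 0" "y' = x' ^ 2" using root[of y] root[of y'] by auto
      then show "\<mu> (y \<otimes>\<^bsub>Gm\<^esub> y') = \<mu> y \<otimes>\<^bsub>grp T\<^esub> \<mu> y'"
        using mu2[of "x * x'"] mu2[of x] mu2[of x'] cocharacter_mult[OF nu] by (simp add: power_mult_distrib)
    qed
    show "\<forall>i j. laurent (\<lambda>x. \<mu> x $ i $ j)" using h(1) by (simp add: \<mu>_def)
  qed
  \<comment> \<open>The pairings of \<open>\<mu>\<close>, half of those of \<open>\<nu>\<close>.\<close>
  define d :: "nat \<Rightarrow> int" where "d j = (if j \<in> {n - 1, n} then 1 else if j = n - 2 then -1 else 0)" for j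
  have "even (\<Sum>q<n div 2. d (2 * q + 1))"
  proof (rule cocharacter_parity[OF mu])
    fix j and y :: 'f assume j: "j \<in> {1..n}" and "y \<noteq> 0"
    then obtain x where x: "x \<noteq> 0" "y = x ^ 2" using root[of y] by auto
    have "alpha j (\<mu> y) = alpha j (coroot (n - 1) x) * alpha j (coroot n x)"
      using x j n1 nn by (simp add: mu2 \<nu>_def rt_mult)
    also have "\<dots> = y powi d j"
    proof -
      have a1: "alpha j (coroot (n - 1) x) = (if j = n - 1 then y else if j = n - 2 then inverse x else 1)"
      proof -
        have "adj n j (n - 1) \<longleftrightarrow> j = n - 2" using rank j by (auto simp: adj_def)
        then show ?thesis using alpha_coroot[OF n1 j x(1)] x by simp
      qed
      have a2: "alpha j (coroot n x) = (if j = n then y else if j = n - 2 then inverse x else 1)"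
      proof -
        have "adj n j n \<longleftrightarrow> j = n - 2" using rank j by (auto simp: adj_def)
        then show ?thesis using alpha_coroot[OF nn j x(1)] x by simp
      qed
      have "n - 2 \<noteq> n - 1" "n - 2 \<noteq> n" using rank by linarith+
      then show ?thesis unfolding a1 a2 d_def using ne x
        by (auto simp: power_int_minus power2_eq_square)
    qed
    finally show "alpha j (\<mu> y) = y powi d j" .
  qed
  moreover have "(\<Sum>q<n div 2. d (2 * q + 1)) = (\<Sum>q<n div 2. if 2 * q + 1 = n - 1 then 1 else 0)"
  proof (rule sum.cong)
    fix q :: nat
    have e: "even n" "even (n - 2)" using rank by simp_all
    have "2 * q + 1 \<noteq> n" using e(1) by auto
    moreover have "2 * q + 1 \<noteq> n - 2" using e(2) by (metis even_plus_one_iff dvd_triv_left)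
    ultimately show "d (2 * q + 1) = (if 2 * q + 1 = n - 1 then 1 else 0)" by (simp add: d_def)
  qed simp
  ultimately show False using odd_indicator_sum by simp
qed

lemma zc_mult: "c \<noteq> 0 \<Longrightarrow> c' \<noteq> 0 \<Longrightarrow> zc (c * c') = zc c ** zc c'"
proof -
  assume c: "c \<noteq> 0" "c' \<noteq> 0"
  have "zc (c * c') = kappa (\<lambda>i. (if i \<in> {n - 1, n} then c else 1) * (if i \<in> {n - 1, n} then c' else 1))"
    unfolding zc_def by (rule kappa_cong) (use c in \<open>auto simp: nonvanishing_def\<close>)
  then show ?thesis using kappa_mult[OF zc_nonvanishing[OF c(1)] zc_nonvanishing[OF c(2)]] unfolding zc_def by (rule trans)
qed

lemma zc_one: "zc 1 = mat 1"
  unfolding zc_def by (subst kappa_one[symmetric], rule kappa_cong) (auto simp: nonvanishing_def)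

lemma zc_square: "c ^ 2 = 1 \<Longrightarrow> zc c ** zc c = mat 1"
proof -
  assume c: "c ^ 2 = 1"
  then have "c \<noteq> 0" by auto
  then have "zc c ** zc c = zc (c ^ 2)" by (simp add: zc_mult power2_eq_square)
  then show ?thesis using c zc_one by simp
qed

lemma zc_inject:
  assumes "c ^ 2 = 1" "c' ^ 2 = 1" "zc c = zc c'"
  shows "c = c'"
proof -
  have nz: "c \<noteq> 0" "c' \<noteq> 0" using assms by auto
  have "zc (c * c') = mat 1" using zc_mult[OF nz] assms(3) zc_square[OF assms(2)] by simp
  moreover have "(c * c') ^ 2 = 1" using assms by (simp add: power_mult_distrib)
  ultimately have "c * c' = 1" by (metis zc_eq_one)
  then show ?thesis using sqrt_one_inverse[OF assms(1), of c'] by simp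
qed

lemma central_square: "central r \<Longrightarrow> r ** r = mat 1"
  using central_is_zc zc_square by metis

lemma exists_adjacent: "i \<in> {1..n} \<Longrightarrow> \<exists>k\<in>{1..n}. k \<noteq> i \<and> adj n k i"
proof -
  assume i: "i \<in> {1..n}"
  show ?thesis
  proof (cases "i = n")
    case True
    then show ?thesis using rank by (intro bexI[of _ "n - 2"]) (auto simp: adj_def)
  next
    case False
    show ?thesis
    proof (cases "i = 1")
      case True
      then show ?thesis using rank by (intro bexI[of _ 2]) (auto simp: adj_def)
    next
      case 2: False
      then show ?thesis using False i rank by (intro bexI[of _ "i - 1"]) (auto simp: adj_def)
    qed
  qed
qed

lemma coroot_eq_one: "i \<in> {1..n} \<Longrightarrow> x \<noteq> 0 \<Longrightarrow> coroot i x = mat 1 \<Longrightarrow> x = 1"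
proof -
  assume i: "i \<in> {1..n}" and x: "x \<noteq> 0" "coroot i x = mat 1"
  obtain k where k: "k \<in> {1..n}" "k \<noteq> i" "adj n k i" using exists_adjacent[OF i] by blast
  have "inverse x = alpha k (coroot i x)" using alpha_coroot[OF i k(1) x(1)] k by simp
  then show "x = 1" using x k by (simp add: rt_one)
qed

text \<open>Apart from each other, two distinct nodes have the same neighbours only if they are the two leaves
  at the branch node.\<close>

lemma exists_separating_node:
  assumes "i \<in> {1..n}" "j \<in> {1..n}" "i < j" "\<not> (i = n - 1 \<and> j = n)"
  shows "\<exists>k\<in>{1..n}. k \<noteq> i \<and> k \<noteq> j \<and> adj n k i \<noteq> adj n k j"
proof -
  consider "2 \<le> i" | "i = 1" "j = 2" | "i = 1" "j = 3" | "i = 1" "4 \<le> j"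
    using assms by force
  then show ?thesis
  proof cases
    case 1
    then show ?thesis using assms rank by (intro bexI[of _ "i - 1"]) (auto simp: adj_def)
  next
    case 2
    then show ?thesis using rank by (intro bexI[of _ 3]) (auto simp: adj_def)
  next
    case 3
    then show ?thesis using rank by (intro bexI[of _ 4]) (auto simp: adj_def)
  next
    case 4
    then show ?thesis using assms rank by (intro bexI[of _ 2]) (auto simp: adj_def)
  qed
qed

text \<open>A simple root attached to exactly one of the two nodes shows that one argument is 1, and then so
  is the other. For the two leaves at the branch node there is no such root, and the roots only give
  \<open>c = c'\<close> and \<open>c\<^sup>2 = 1\<close>; but then the product is \<open>z\<^sub>c\<close>.\<close>

lemma coroots_independent:
  assumes i: "i \<in> {1..n}" and j: "j \<in> {1..n}" and ij: "i \<noteq> j"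
    and c: "c \<noteq> 0" "c' \<noteq> 0" and eq: "coroot i c ** coroot j c' = mat 1"
  shows "c = 1 \<and> c' = 1"
proof -
  have main: "c = 1 \<and> c' = 1" if i: "i \<in> {1..n}" and j: "j \<in> {1..n}" and ij: "i < j"
    and c: "c \<noteq> 0" "c' \<noteq> 0" and eq: "coroot i c ** coroot j c' = mat 1" for i j c c'
  proof -
    have al: "alpha k (coroot i c) * alpha k (coroot j c') = 1" if k: "k \<in> {1..n}" for k
      using arg_cong[OF eq, of "alpha k"] i j k c by (simp add: rt_mult rt_one)
    show ?thesis
    proof (cases "i = n - 1 \<and> j = n")
      case True
      have ne: "n - 1 \<noteq> n" "n - 2 \<noteq> n - 1" "n - 2 \<noteq> n" "n - 2 \<in> {1..n}" using rank by auto
      have adj: "adj n (n - 2) (n - 1)" "adj n (n - 2) n" "\<not> adj n (n - 1) n"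
        using rank unfolding adj_def by linarith+
      have "inverse c * inverse c' = 1"
        using al[OF ne(4)] alpha_coroot[OF i ne(4) c(1)] alpha_coroot[OF j ne(4) c(2)] True ne adj by simp
      moreover have c2: "c ^ 2 = 1"
        using al[OF i] alpha_coroot[OF i i c(1)] alpha_coroot[OF j i c(2)] True ne adj by simp
      ultimately have "c * c' = 1" using c by (simp add: field_simps)
      then have cc: "c' = c" by (rule sqrt_one_inverse[OF c2])
      have "zc c = kappa (\<lambda>k. (if k = i then c else 1) * (if k = j then c else 1))"
        unfolding zc_def by (rule kappa_cong) (use True ne c in \<open>auto simp: nonvanishing_def\<close>)
      also have "\<dots> = coroot i c ** coroot j c"
        using i j c by (subst kappa_mult) (auto simp: nonvanishing_def kappa_single)
      finally have "c = 1" using zc_eq_one[OF c2] eq cc by simp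
      then show ?thesis using cc by simp
    next
      case False
      obtain k where k: "k \<in> {1..n}" "k \<noteq> i" "k \<noteq> j" "adj n k i \<noteq> adj n k j"
        using exists_separating_node[OF i j ij False] by blast
      then have "c = 1 \<or> c' = 1"
        using al[OF k(1)] alpha_coroot[OF i k(1) c(1)] alpha_coroot[OF j k(1) c(2)] by (auto split: if_splits)
      then show ?thesis
        using eq coroot_eq_one[OF i c(1)] coroot_eq_one[OF j c(2)] i j by (auto simp: cor_one)
    qed
  qed
  show ?thesis
  proof (cases "i < j")
    case True
    then show ?thesis using main[OF i j _ c eq] by simp
  next
    case False
    have "coroot j c' ** coroot i c = mat 1" using eq T_commute[of "coroot j c'" "coroot i c"] i j c by simp
    then show ?thesis using main[OF j i _ c(2,1)] False ij by simp
  qed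
qed

section \<open>The normalizer of the torus acts on the roots\<close>

definition N :: "('f ^ 'm ^ 'm) set" where
  "N = torus_normalizer G T"

lemma N_iff:
  "g \<in> N \<longleftrightarrow> g \<in> G \<and> (\<forall>t\<in>T. conj_by g t \<in> T) \<and> (\<forall>t\<in>T. conj_by (matrix_inv g) t \<in> T)"
proof -
  have "g \<in> N \<longleftrightarrow> g \<in> G \<and> conj_by g ` T = T"
  proof -
    have "inv\<^bsub>grp G\<^esub> g = matrix_inv g" if "g \<in> G"
      using group.m_inv_consistent[OF GL_group G_subgroup that] GL_inv[of g] that G_closed(1) by simp
    then have "g <#\<^bsub>grp G\<^esub> T #>\<^bsub>grp G\<^esub> (inv\<^bsub>grp G\<^esub> g) = conj_by g ` T" if "g \<in> G"
      using that by (auto simp: l_coset_def r_coset_def conj_by_def)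
    then show ?thesis using T_sub_G by (auto simp: N_def torus_normalizer_def normalizer_def stabilizer_def)
  qed
  also have "\<dots> \<longleftrightarrow> g \<in> G \<and> (\<forall>t\<in>T. conj_by g t \<in> T) \<and> (\<forall>t\<in>T. conj_by (matrix_inv g) t \<in> T)"
  proof (intro conj_cong refl iffI)
    assume g: "g \<in> G" and *: "conj_by g ` T = T"
    have "conj_by (matrix_inv g) t \<in> T" if t: "t \<in> T" for t
    proof -
      obtain s where "s \<in> T" "t = conj_by g s" using * t by blast
      then show ?thesis using g G_closed(1) by simp
    qed
    then show "(\<forall>t\<in>T. conj_by g t \<in> T) \<and> (\<forall>t\<in>T. conj_by (matrix_inv g) t \<in> T)" using * by blast
  next
    assume g: "g \<in> G" and *: "(\<forall>t\<in>T. conj_by g t \<in> T) \<and> (\<forall>t\<in>T. conj_by (matrix_inv g) t \<in> T)"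
    show "conj_by g ` T = T"
    proof
      show "T \<subseteq> conj_by g ` T"
      proof
        fix t assume "t \<in> T"
        then show "t \<in> conj_by g ` T" using * g G_closed(1)
          by (intro rev_image_eqI[of "conj_by (matrix_inv g) t"]) auto
      qed
    qed (use * in blast)
  qed
  finally show ?thesis .
qed

lemma N_G: "g \<in> N \<Longrightarrow> g \<in> G" and N_invertible [simp]: "g \<in> N \<Longrightarrow> invertible g"
  and N_conj [simp]: "g \<in> N \<Longrightarrow> t \<in> T \<Longrightarrow> conj_by g t \<in> T"
  and N_conj_inv [simp]: "g \<in> N \<Longrightarrow> t \<in> T \<Longrightarrow> conj_by (matrix_inv g) t \<in> T"
  using G_closed(1) by (auto simp: N_iff)

lemma N_mult [simp]: "g \<in> N \<Longrightarrow> h \<in> N \<Longrightarrow> g ** h \<in> N"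
  unfolding N_iff[of "g ** h"]
  by (auto simp: N_G G_closed matrix_inv_mult simp flip: conj_by_conj_by)

lemma N_inv [simp]: "g \<in> N \<Longrightarrow> matrix_inv g \<in> N"
  unfolding N_iff[of "matrix_inv g"] by (auto simp: N_G G_closed)

lemma T_N: "t \<in> T \<Longrightarrow> t \<in> N"
  unfolding N_iff by (auto simp: T_G)

lemma N_one [simp]: "mat 1 \<in> N"
  by (simp add: T_N)

text \<open>Roots are extensional characters, so agreement on \<open>T\<close> is equality.\<close>

lemma rt_inject:
  assumes "v \<in> D_roots n" "w \<in> D_roots n" "\<And>t. t \<in> T \<Longrightarrow> rt v t = rt w t"
  shows "v = w"
proof -
  have "rt v = rt w" using assms rt_character[OF assms(1)] rt_character[OF assms(2)]
    by (intro extensionalityI[of _ T]) (auto simp: characters_def)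
  then show ?thesis using type assms(1,2) by (auto simp: type_D_def bij_betw_def dest: inj_onD)
qed

text \<open>The action of the normalizer on the roots, transported to vectors.\<close>

definition act :: "'f ^ 'm ^ 'm \<Rightarrow> (nat \<Rightarrow> int) \<Rightarrow> nat \<Rightarrow> int" where
  "act g v = (THE w. w \<in> D_roots n \<and> (\<forall>t\<in>T. rt w (conj_by g t) = rt v t))"

lemma act_eqI:
  assumes g: "g \<in> N" and w: "w \<in> D_roots n" "\<And>t. t \<in> T \<Longrightarrow> rt w (conj_by g t) = rt v t"
  shows "act g v = w"
  unfolding act_def
proof (rule the_equality)
  fix w' assume w': "w' \<in> D_roots n \<and> (\<forall>t\<in>T. rt w' (conj_by g t) = rt v t)"
  show "w' = w"
  proof (rule rt_inject)
    fix t assume t: "t \<in> T"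
    have s: "conj_by (matrix_inv g) t \<in> T" using g t by simp
    have "rt w' (conj_by g (conj_by (matrix_inv g) t)) = rt w (conj_by g (conj_by (matrix_inv g) t))"
      using w(2)[OF s] w' s by (simp only:)
    then show "rt w' t = rt w t" using g by simp
  qed (use w w' in auto)
qed (use w in auto)

lemma act_root: "g \<in> N \<Longrightarrow> v \<in> D_roots n \<Longrightarrow> act g v \<in> D_roots n"
  and rt_act: "g \<in> N \<Longrightarrow> v \<in> D_roots n \<Longrightarrow> t \<in> T \<Longrightarrow> rt (act g v) (conj_by g t) = rt v t"
proof -
  have "act g v \<in> D_roots n \<and> (\<forall>t\<in>T. rt (act g v) (conj_by g t) = rt v t)" if g: "g \<in> N" and v: "v \<in> D_roots n"
  proof -
    have "rt v \<in> roots G T" using type v by (auto simp: type_D_def bij_betw_def)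
    then have "(\<lambda>t\<in>T. rt v (conj_by (matrix_inv g) t)) \<in> roots G T"
      using g by (intro root_conj_by G_subgroup T_subgroup) (auto simp: N_G)
    then obtain w where w: "w \<in> D_roots n" "rt w = (\<lambda>t\<in>T. rt v (conj_by (matrix_inv g) t))"
      using type by (auto simp: type_D_def bij_betw_def image_iff) (metis (mono_tags, lifting) imageE)
    have "rt w (conj_by g t) = rt v t" if "t \<in> T" for t using w(2) g that by simp
    then show ?thesis using act_eqI[OF g w(1)] w(1) by simp
  qed
  then show "g \<in> N \<Longrightarrow> v \<in> D_roots n \<Longrightarrow> act g v \<in> D_roots n"
    "g \<in> N \<Longrightarrow> v \<in> D_roots n \<Longrightarrow> t \<in> T \<Longrightarrow> rt (act g v) (conj_by g t) = rt v t" by auto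
qed

lemma act_T: "t \<in> T \<Longrightarrow> v \<in> D_roots n \<Longrightarrow> act t v = v"
  by (rule act_eqI) (auto simp: T_N)

lemma act_mult: "g \<in> N \<Longrightarrow> h \<in> N \<Longrightarrow> v \<in> D_roots n \<Longrightarrow> act (g ** h) v = act g (act h v)"
  by (rule act_eqI) (auto simp: act_root rt_act simp flip: conj_by_conj_by)

lemma act_uminus: "g \<in> N \<Longrightarrow> v \<in> D_roots n \<Longrightarrow> act g (- v) = - act g v"
  by (rule act_eqI) (auto simp: act_root rt_act D_roots_uminus rt_uminus)

text \<open>Additivity holds for characters; it carries over to vectors by pairing with the coroots.\<close>

lemma act_add:
  assumes g: "g \<in> N" and v: "v \<in> D_roots n" "v' \<in> D_roots n" "(\<lambda>k. v k + v' k) \<in> D_roots n"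
  shows "act g (\<lambda>k. v k + v' k) = (\<lambda>k. act g v k + act g v' k)"
proof (rule dot_simple_ext)
  let ?s = "act g (\<lambda>k. v k + v' k)"
  fix i assume i: "i \<in> {1..n}"
  note r = act_root[OF g v(1)] act_root[OF g v(2)] act_root[OF g v(3)]
  have "dot n ?s (simple n i) = dot n (act g v) (simple n i) + dot n (act g v') (simple n i)"
  proof (rule powi_eq_imp_eq)
    fix x :: 'f assume x: "x \<noteq> 0"
    let ?t = "conj_by (matrix_inv g) (coroot i x)"
    have t: "?t \<in> T" using g i x by simp
    have "rt ?s (conj_by g ?t) = rt (act g v) (conj_by g ?t) * rt (act g v') (conj_by g ?t)"
      using rt_act[OF g _ t] v rt_add[OF v t] by simp
    then show "x powi dot n ?s (simple n i) = x powi (dot n (act g v) (simple n i) + dot n (act g v') (simple n i))"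
      using g r x i by (simp add: rt_cor power_int_add)
  qed
  then show "dot n (simple n i) ?s = dot n (simple n i) (\<lambda>k. act g v k + act g v' k)"
    by (simp add: dot_commute[of n "simple n i"] dot_add_left)
next
  fix k assume k: "k \<notin> {1..n}"
  show "act g (\<lambda>k. v k + v' k) k = act g v k + act g v' k"
    using D_roots_support[OF act_root[OF g v(1)] k] D_roots_support[OF act_root[OF g v(2)] k]
      D_roots_support[OF act_root[OF g v(3)] k] by simp
qed (use rank in simp)

lemma reflection_iff:
  "g \<in> reflection G T (rt a) (cor a) \<longleftrightarrow> g \<in> N \<and> (\<forall>t\<in>T. conj_by g t = t ** matrix_inv (cor a (rt a t)))"
  by (simp add: reflection_def N_def conj_by_def)

lemma act_reflection:
  assumes a: "a \<in> D_roots n" and g: "g \<in> reflection G T (rt a) (cor a)" and v: "v \<in> D_roots n"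
  shows "act g v = root_refl n a v"
proof (rule act_eqI)
  show "g \<in> N" "root_refl n a v \<in> D_roots n" using g a v by (auto simp: reflection_iff refl_root)
  fix t assume t: "t \<in> T"
  let ?q = "rt a t"
  have q: "?q \<noteq> 0" using rt_nonzero a t by simp
  have "rt (root_refl n a v) (conj_by g t) = rt (root_refl n a v) t * inverse (?q powi dot n (root_refl n a v) a)"
    using g a v t q by (simp add: reflection_iff rt_mult rt_inv rt_cor refl_root)
  also have "dot n (root_refl n a v) a = - dot n v a"
    unfolding root_refl_def dot_diff_scale_left D_roots_norm[OF a] by simp
  finally show "rt (root_refl n a v) (conj_by g t) = rt v t"
    using q by (simp add: rt_refl[OF v a t] power_int_minus)
qed

lemma T_square_root: "t \<in> T \<Longrightarrow> \<exists>s\<in>T. t = s ** s"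
proof -
  assume "t \<in> T"
  then obtain y where y: "nonvanishing y" "t = kappa y" by (rule T_kappa)
  have "\<forall>i. \<exists>z. z ^ 2 = y i" by (intro allI nth_root_exists) simp
  then obtain z where z: "\<And>i. z i ^ 2 = y i" by metis
  have nz: "nonvanishing z" using y z unfolding nonvanishing_def by (metis power_zero_numeral)
  have "kappa y = kappa (\<lambda>i. z i * z i)" by (simp add: z flip: power2_eq_square)
  then show ?thesis using kappa_mult[OF nz nz] y nz by auto
qed

lemma centralizes_imp_T:
  assumes g: "g \<in> G" and c: "\<And>t. t \<in> T \<Longrightarrow> conj_by g t = t"
  shows "g \<in> T"
proof -
  have "g ** t = t ** g" if "t \<in> T" for t
    using c[OF that] matrix_inv_cancel(4)[OF G_closed(1)[OF g], of "g ** t"] unfolding conj_by_def by simp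
  then show ?thesis using centralizer g by blast
qed

text \<open>If \<open>g\<close> fixes the simple roots, then \<open>g s g\<^sup>-\<^sup>1 s\<^sup>-\<^sup>1\<close> is central and hence of square 1 for all \<open>s \<in> T\<close>. As
  every element of \<open>T\<close> is a square \<open>s\<^sup>2\<close>, the element \<open>g\<close> centralizes \<open>T\<close>, which is its own
  centralizer.\<close>

lemma act_trivial_imp_T:
  assumes g: "g \<in> N" and "\<And>i. i \<in> {1..n} \<Longrightarrow> act g (simple n i) = simple n i"
  shows "g \<in> T"
proof -
  have "conj_by g t = t" if "t \<in> T" for t
  proof -
    obtain s where s: "s \<in> T" "t = s ** s" using T_square_root[OF \<open>t \<in> T\<close>] by blast
    let ?r = "conj_by g s ** matrix_inv s"
    have "central ?r" unfolding central_def
    proof (intro conjI ballI)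
      fix j assume j: "j \<in> {1..n}"
      then have "alpha j (conj_by g s) = alpha j s" using rt_act[OF g _ s(1), of "simple n j"] assms(2)[OF j] by simp
      then show "alpha j ?r = 1" using g s j rt_nonzero[of "simple n j" s] by (simp add: rt_mult rt_inv)
    qed (use g s in simp)
    then have "?r ** ?r = mat 1" by (rule central_square)
    have "conj_by g t ** matrix_inv t = ?r ** ?r"
      using g s by (simp add: conj_by_mult matrix_inv_mult T_ac)
    then have "conj_by g t ** matrix_inv t = mat 1" using \<open>?r ** ?r = mat 1\<close> by simp
    then have "conj_by g t ** matrix_inv t ** t = t" by simp
    then show ?thesis using that by simp
  qed
  then show ?thesis by (rule centralizes_imp_T[OF N_G[OF g]])
qed

text \<open>The conjugate of \<open>\<omega>\<^sub>n\<close> would be a cocharacter pairing to 1 with \<open>\<alpha>\<^sub>n\<^sub>-\<^sub>1\<close> and to 0 with the other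
  simple roots, against parity.\<close>

lemma act_not_swap:
  assumes g: "g \<in> N" and fixed: "\<And>i. i \<in> {1..n - 2} \<Longrightarrow> act g (simple n i) = simple n i"
    and sw: "act g (simple n (n - 1)) = simple n n" "act g (simple n n) = simple n (n - 1)"
  shows False
proof -
  let ?mu = "\<lambda>x. conj_by g (om x)"
  have mu: "?mu \<in> cocharacters T" using g by (intro cocharacter_conj_by om_cocharacter) auto
  have al: "rt (act g (simple n j)) (?mu x) = (if j = n then x else 1)" if "j \<in> {1..n}" "x \<noteq> 0" for j x
    using rt_act[OF g, of "simple n j" "om x"] alpha_om[of j x] that om_cocharacter
    by (simp add: cocharacter_mem)
  have "even (\<Sum>q<n div 2. if 2 * q + 1 = n - 1 then 1 else 0 :: int)"
  proof (rule cocharacter_parity[OF mu])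
    fix j and x :: 'f assume j: "j \<in> {1..n}" and x: "x \<noteq> 0"
    have ne: "n - 1 \<noteq> n" "n - 1 \<in> {1..n}" "n \<in> {1..n}" using rank by auto
    have "j \<in> {1..n - 2} \<or> j = n - 1 \<or> j = n" using j rank by auto
    then consider "j \<in> {1..n - 2}" | "j = n - 1" | "j = n" by blast
    then show "alpha j (?mu x) = x powi (if j = n - 1 then 1 else 0)"
    proof cases
      case 1
      have "j \<noteq> n - 1" "j \<noteq> n" using 1 rank by auto
      then show ?thesis using al[OF j x] fixed[OF 1] by simp
    next
      case 2
      then show ?thesis using al[OF ne(3) x] sw by simp
    next
      case 3
      then show ?thesis using al[OF ne(2) x] sw ne by simp
    qed
  qed
  then show False using odd_indicator_sum by simp
qed

section \<open>The Weyl group\<close>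

lemma T_normal: "T \<lhd> grp N"
proof -
  have gG: "Group.group (grp G)" by (rule group.subgroup_imp_group[OF GL_group G_subgroup])
  have "subgroup T (grp G)" by (rule group.subgroup_incl[OF GL_group T_subgroup G_subgroup T_sub_G])
  from group.subgroup_in_normalizer[OF gG this] show ?thesis
    by (simp add: N_def torus_normalizer_def)
qed

lemma weyl_group_group: "Group.group (weyl_group G T)"
  unfolding weyl_group_def N_def[symmetric] by (rule normal.factorgroup_is_group[OF T_normal])

lemma weyl_proj_grp: "weyl_proj T g = T #>\<^bsub>grp N\<^esub> g"
  by (simp add: weyl_proj_def r_coset_def)

lemma weyl_proj_set: "weyl_proj T g = (\<lambda>t. t ** g) ` T"
  by (auto simp: weyl_proj_def r_coset_def)

lemma weyl_carrier: "carrier (weyl_group G T) = weyl_proj T ` N"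
  unfolding weyl_group_def N_def[symmetric] carrier_FactGroup by (auto simp: weyl_proj_grp)

lemma weyl_mult:
  assumes "g \<in> N" "h \<in> N"
  shows "weyl_proj T g \<otimes>\<^bsub>weyl_group G T\<^esub> weyl_proj T h = weyl_proj T (g ** h)"
  using normal.rcos_sum[OF T_normal, of g h] assms
  by (simp add: weyl_group_def N_def[symmetric] weyl_proj_grp)

lemma weyl_proj_T: "t \<in> T \<Longrightarrow> weyl_proj T t = T"
  unfolding weyl_proj_set
proof
  assume t: "t \<in> T"
  show "(\<lambda>s. s ** t) ` T \<subseteq> T" using t by auto
  show "T \<subseteq> (\<lambda>s. s ** t) ` T"
  proof
    fix s assume "s \<in> T"
    then show "s \<in> (\<lambda>s. s ** t) ` T" using t by (intro rev_image_eqI[of "s ** matrix_inv t"]) auto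
  qed
qed

lemma weyl_one: "\<one>\<^bsub>weyl_group G T\<^esub> = T"
  by (simp add: weyl_group_def)

lemma weyl_proj_eqD: "g \<in> N \<Longrightarrow> h \<in> N \<Longrightarrow> weyl_proj T g = weyl_proj T h \<Longrightarrow> \<exists>t\<in>T. g = t ** h"
proof -
  assume "weyl_proj T g = weyl_proj T h"
  moreover have "g \<in> weyl_proj T g" unfolding weyl_proj_set by (rule rev_image_eqI[of "mat 1"]) auto
  ultimately show ?thesis by (auto simp: weyl_proj_set)
qed

text \<open>An element of the Weyl group is a coset of \<open>T\<close>, which acts trivially on the roots, so the choice of
  the representative does not matter.\<close>

definition weyl_act :: "('f ^ 'm ^ 'm) set \<Rightarrow> (nat \<Rightarrow> int) \<Rightarrow> nat \<Rightarrow> int" where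
  "weyl_act w = act (SOME g. g \<in> N \<and> w = weyl_proj T g)"

lemma weyl_act_proj: "g \<in> N \<Longrightarrow> v \<in> D_roots n \<Longrightarrow> weyl_act (weyl_proj T g) v = act g v"
proof -
  assume g: "g \<in> N" and v: "v \<in> D_roots n"
  define h where "h = (SOME h. h \<in> N \<and> weyl_proj T g = weyl_proj T h)"
  have h: "h \<in> N \<and> weyl_proj T g = weyl_proj T h" unfolding h_def by (rule someI[of _ g]) (use g in simp)
  then obtain t where "t \<in> T" "h = t ** g" using weyl_proj_eqD[of h g] g by auto
  then have "act h v = act g v" using g v by (simp add: act_mult act_T act_root T_N)
  then show ?thesis by (simp add: weyl_act_def h_def)
qed

abbreviation sig :: "nat \<Rightarrow> 'f ^ 'm ^ 'm" where
  "sig i \<equiv> sigma u (simple n i)"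

abbreviation srefl :: "nat \<Rightarrow> ('f ^ 'm ^ 'm) set" where
  "srefl i \<equiv> reflection G T (rt (simple n i)) (cor (simple n i))"

lemma sigma_reflection: "v \<in> D_roots n \<Longrightarrow> sigma u v \<in> reflection G T (rt v) (cor v)"
  using realization by (simp add: realization_def)

lemma sigma_N [simp]: "v \<in> D_roots n \<Longrightarrow> sigma u v \<in> N"
  using sigma_reflection by (auto simp: reflection_iff)

lemma act_sigma: "v \<in> D_roots n \<Longrightarrow> w \<in> D_roots n \<Longrightarrow> act (sigma u v) w = root_refl n v w"
  using act_reflection sigma_reflection by blast

lemma conj_by_sigma: "v \<in> D_roots n \<Longrightarrow> t \<in> T \<Longrightarrow> conj_by (sigma u v) t = t ** cor v (inverse (rt v t))"
  using sigma_reflection[of v] by (simp add: reflection_iff cor_inverse rt_nonzero)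

lemma reflection_coset:
  assumes a: "a \<in> D_roots n" and g: "g \<in> reflection G T (rt a) (cor a)"
  shows "reflection G T (rt a) (cor a) = weyl_proj T g"
proof
  have gN: "g \<in> N" using g by (simp add: reflection_iff)
  show "weyl_proj T g \<subseteq> reflection G T (rt a) (cor a)"
    using g by (auto simp: weyl_proj_set reflection_iff T_N rt_nonzero a simp flip: conj_by_conj_by)
  show "reflection G T (rt a) (cor a) \<subseteq> weyl_proj T g"
  proof
    fix h assume h: "h \<in> reflection G T (rt a) (cor a)"
    then have hN: "h \<in> N" by (simp add: reflection_iff)
    have "h ** matrix_inv g \<in> T"
    proof (rule centralizes_imp_T)
      show "h ** matrix_inv g \<in> G" using gN hN by (simp add: G_closed N_G)
      fix t assume t: "t \<in> T"
      let ?s = "conj_by (matrix_inv g) t"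
      have s: "?s \<in> T" using gN t by simp
      have "conj_by (h ** matrix_inv g) t = conj_by h ?s" using gN hN by (simp add: conj_by_conj_by)
      also have "conj_by h ?s = ?s ** matrix_inv (cor a (rt a ?s))" using h s by (simp only: reflection_iff)
      also have "\<dots> = conj_by g ?s" using g s by (simp only: reflection_iff)
      finally show "conj_by (h ** matrix_inv g) t = t" using gN by simp
    qed
    then show "h \<in> weyl_proj T g" unfolding weyl_proj_set
      by (rule rev_image_eqI) (use gN in simp)
  qed
qed

lemma srefl_proj: "i \<in> {1..n} \<Longrightarrow> srefl i = weyl_proj T (sig i)"
  by (intro reflection_coset sigma_reflection) auto

lemma act_inj: "g \<in> N \<Longrightarrow> v \<in> D_roots n \<Longrightarrow> act (matrix_inv g) (act g v) = v"
  by (simp add: act_T flip: act_mult)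

text \<open>An element permuting the simple roots acts by a diagram automorphism, because whether two simple
  roots are adjacent is decided by their sum being a root.\<close>

lemma weyl_rigid:
  assumes g: "g \<in> N" and perm: "\<And>i. i \<in> {1..n} \<Longrightarrow> act g (simple n i) \<in> simple n ` {1..n}"
  shows "g \<in> T"
proof -
  have "\<forall>i\<in>{1..n}. \<exists>j\<in>{1..n}. act g (simple n i) = simple n j" using perm by blast
  then obtain \<pi> where \<pi>: "\<And>i. i \<in> {1..n} \<Longrightarrow> \<pi> i \<in> {1..n}"
    "\<And>i. i \<in> {1..n} \<Longrightarrow> act g (simple n i) = simple n (\<pi> i)"
    by metis
  have inj: "inj_on \<pi> {1..n}"
  proof (rule inj_onI)
    fix i j assume ij: "i \<in> {1..n}" "j \<in> {1..n}" "\<pi> i = \<pi> j"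
    then have eq: "act g (simple n i) = act g (simple n j)" using \<pi> by simp
    have "simple n i = act (matrix_inv g) (act g (simple n i))" using act_inj[OF g, of "simple n i"] ij by simp
    also have "\<dots> = act (matrix_inv g) (act g (simple n j))" by (simp only: eq)
    also have "\<dots> = simple n j" using act_inj[OF g, of "simple n j"] ij by simp
    finally have "simple n i = simple n j" .
    then show "i = j" using ij rank simple_inj[of n i j] by simp
  qed
  have adj: "adj n (\<pi> i) (\<pi> j)" if ij: "i \<in> {1..n}" "j \<in> {1..n}" "adj n i j" for i j
  proof -
    have "i \<noteq> j" using ij rank by (auto simp: adj_def)
    then have "dot n (simple n i) (simple n j) = -1" using ij rank by (simp add: cartan_D)
    then have s: "(\<lambda>k. simple n i k + simple n j k) \<in> D_roots n" using ij by (simp add: D_roots_add_iff)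
    have "(\<lambda>k. simple n (\<pi> i) k + simple n (\<pi> j) k) \<in> D_roots n"
      using act_root[OF g s] act_add[OF g _ _ s] ij \<pi> by simp
    moreover have "simple n (\<pi> i) \<in> D_roots n" "simple n (\<pi> j) \<in> D_roots n" using \<pi>(1)[OF ij(1)] \<pi>(1)[OF ij(2)] by auto
    ultimately have "dot n (simple n (\<pi> i)) (simple n (\<pi> j)) = -1" by (simp add: D_roots_add_iff)
    then show ?thesis using \<pi>(1)[OF ij(1)] \<pi>(1)[OF ij(2)] rank
        cartan_D[of n "\<pi> i" "\<pi> j"] by (simp split: if_splits)
  qed
  have n1: "n - 1 \<in> {1..n}" "n \<in> {1..n}" using rank by auto
  have D: "(\<forall>i\<in>{1..n - 2}. \<pi> i = i)
      \<and> (\<pi> (n - 1) = n - 1 \<and> \<pi> n = n \<or> \<pi> (n - 1) = n \<and> \<pi> n = n - 1)"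
    using rank by (intro D_diagram_automorphism \<pi>(1) inj adj) auto
  have low: "act g (simple n i) = simple n i" if "i \<in> {1..n - 2}" for i
    using D \<pi>(2)[of i] that rank by auto
  have "\<not> (\<pi> (n - 1) = n \<and> \<pi> n = n - 1)"
    using act_not_swap[OF g low] \<pi>(2)[OF n1(1)] \<pi>(2)[OF n1(2)] by auto
  then have "act g (simple n i) = simple n i" if i: "i \<in> {1..n}" for i
  proof -
    have "i \<in> {1..n - 2} \<or> i = n - 1 \<or> i = n" using i by auto
    then show ?thesis using D low \<pi>(2)[OF i] \<open>\<not> (\<pi> (n - 1) = n \<and> \<pi> n = n - 1)\<close> by metis
  qed
  then show ?thesis by (rule act_trivial_imp_T[OF g])
qed

sublocale W: weyl_action "weyl_group G T" n srefl weyl_act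
proof (intro weyl_action.intro weyl_group_group weyl_action_axioms.intro)
  show "3 \<le> n" using rank by simp
  show "srefl i \<in> carrier (weyl_group G T)" if "i \<in> {1..n}" for i
    using that srefl_proj[OF that] by (auto simp: weyl_carrier)
  show "weyl_act w v \<in> D_roots n" if "w \<in> carrier (weyl_group G T)" "v \<in> D_roots n" for w v
    using that by (auto simp: weyl_carrier weyl_act_proj act_root)
  show "weyl_act \<one>\<^bsub>weyl_group G T\<^esub> v = v" if "v \<in> D_roots n" for v
    using that weyl_act_proj[of "mat 1" v] weyl_proj_T[of "mat 1"] by (simp add: weyl_one act_T)
  show "weyl_act (w \<otimes>\<^bsub>weyl_group G T\<^esub> w') v = weyl_act w (weyl_act w' v)"
    if "w \<in> carrier (weyl_group G T)" "w' \<in> carrier (weyl_group G T)" "v \<in> D_roots n" for w w' v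
    using that by (auto simp: weyl_carrier weyl_mult weyl_act_proj act_mult act_root)
  show "weyl_act w (\<lambda>k. v k + v' k) = (\<lambda>k. weyl_act w v k + weyl_act w v' k)"
    if "w \<in> carrier (weyl_group G T)" "v \<in> D_roots n" "v' \<in> D_roots n" "(\<lambda>k. v k + v' k) \<in> D_roots n" for w v v'
    using that by (auto simp: weyl_carrier weyl_act_proj act_add)
  show "weyl_act w (- v) = - weyl_act w v" if "w \<in> carrier (weyl_group G T)" "v \<in> D_roots n" for w v
    using that by (auto simp: weyl_carrier weyl_act_proj act_uminus D_roots_uminus)
  show "weyl_act (srefl i) v = root_refl n (simple n i) v" if "i \<in> {1..n}" "v \<in> D_roots n" for i v
    using that srefl_proj[OF that(1)] by (simp add: weyl_act_proj act_sigma)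
  show "w = \<one>\<^bsub>weyl_group G T\<^esub>"
    if w: "w \<in> carrier (weyl_group G T)"
      and perm: "\<And>i. i \<in> {1..n} \<Longrightarrow> weyl_act w (simple n i) \<in> simple n ` {1..n}" for w
  proof -
    obtain g where g: "g \<in> N" "w = weyl_proj T g" using w by (auto simp: weyl_carrier)
    then have "g \<in> T" using perm by (intro weyl_rigid) (auto simp: weyl_act_proj)
    then show ?thesis using g by (simp add: weyl_proj_T weyl_one)
  qed
qed

lemma weyl_word_eq: "weyl_word G T srefl is = W.word is"
  by (simp add: weyl_word_def W.word_def)

lemma reduced_word_eq: "reduced_word G T n srefl is \<longleftrightarrow> W.reduced is"
  by (simp add: reduced_word_def weyl_word_eq W.reduced_iff_minimal)

lemma word_proj:
  assumes "set is \<subseteq> {1..n}" "\<And>i. i \<in> {1..n} \<Longrightarrow> f i \<in> N \<and> weyl_proj T (f i) = srefl i"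
  shows "foldr (\<lambda>i g. f i ** g) is (mat 1) \<in> N
    \<and> weyl_proj T (foldr (\<lambda>i g. f i ** g) is (mat 1)) = W.word is"
  using assms(1)
proof (induction "is")
  case Nil
  then show ?case by (simp add: weyl_proj_T weyl_one)
next
  case (Cons i "is")
  then show ?case using assms(2)[of i] weyl_mult[of "f i" "foldr (\<lambda>i g. f i ** g) is (mat 1)"] by auto
qed

section \<open>Root subgroups\<close>

lemma u_param: "v \<in> D_roots n \<Longrightarrow> root_parametrization G T (rt v) (range (u v)) (u v)"
  using realization by (simp add: realization_def)

lemma u_add: "v \<in> D_roots n \<Longrightarrow> u v (x + y) = u v x ** u v y"
  and u_G: "v \<in> D_roots n \<Longrightarrow> u v x \<in> G"
  and u_T: "v \<in> D_roots n \<Longrightarrow> t \<in> T \<Longrightarrow> conj_by t (u v x) = u v (rt v t * x)"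
  using u_param[of v] unfolding root_parametrization_def Ga_iso_def conj_by_def by auto

lemma u_inject: "v \<in> D_roots n \<Longrightarrow> u v x = u v y \<longleftrightarrow> x = y"
proof -
  assume v: "v \<in> D_roots n"
  obtain f where "\<And>x. f (u v x) = x"
    using u_param[OF v] unfolding root_parametrization_def Ga_iso_def by blast
  then show ?thesis by metis
qed

lemma u_invertible [simp]: "v \<in> D_roots n \<Longrightarrow> invertible (u v x)"
  using G_closed(1) u_G by blast

lemma u_zero: "v \<in> D_roots n \<Longrightarrow> u v 0 = mat 1"
  using u_add[of v 0 0] matrix_inv_cancel(2)[of "u v 0" "u v 0"] by simp

lemma u_uminus: "v \<in> D_roots n \<Longrightarrow> u v (- x) = matrix_inv (u v x)"
  by (rule matrix_inv_unique[symmetric]) (simp_all flip: u_add add: u_zero)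

text \<open>The value of \<open>v\<close> at its coroot is the square of the argument, and every scalar is a square.\<close>

lemma rt_surj: "v \<in> D_roots n \<Longrightarrow> q \<noteq> 0 \<Longrightarrow> \<exists>t\<in>T. rt v t = q"
proof -
  assume v: "v \<in> D_roots n" and q: "q \<noteq> 0"
  obtain y where y: "y ^ 2 = q" using nth_root_exists[of 2 q] by auto
  then have "y \<noteq> 0" using q by auto
  then show ?thesis using v y
    by (intro bexI[of _ "cor v y"]) (auto simp: rt_cor D_roots_norm power_int_def)
qed

text \<open>By uniqueness of root subgroups conjugation maps the one of \<open>v\<close> onto that of \<open>act g v\<close>. In terms of
  the parametrizations this is a map of the additive group that commutes with all scalars, because
  the torus acts through the roots, which take all nonzero values.\<close>

lemma root_subgroup_transport:
  assumes g: "g \<in> N" and v: "v \<in> D_roots n"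
  shows "\<exists>c. c \<noteq> 0 \<and> (\<forall>x. conj_by g (u v x) = u (act g v) (c * x))"
proof -
  let ?w = "act g v"
  have w: "?w \<in> D_roots n" by (rule act_root[OF g v])
  have pull: "rt v (conj_by (matrix_inv g) t) = rt ?w t" if "t \<in> T" for t
    using rt_act[OF g v, of "conj_by (matrix_inv g) t"] g that by simp
  have "root_parametrization G T (rt ?w) (conj_by g ` range (u v)) (\<lambda>x. conj_by g (u v x))"
    by (rule root_parametrization_conj_by[OF G_subgroup T_subgroup N_G[OF g] _ u_param[OF v]])
      (use g pull in auto)
  then have im: "conj_by g ` range (u v) = range (u ?w)"
    using realization w unfolding realization_def is_root_subgroup_def by blast
  have "\<exists>y. conj_by g (u v x) = u ?w y" for x using im by blast
  then obtain \<phi> where \<phi>: "\<And>x. conj_by g (u v x) = u ?w (\<phi> x)" by metis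
  \<comment> \<open>The torus element \<open>t\<close> scales by \<open>q\<close> after conjugation, and its conjugate \<open>?s\<close> does so before.\<close>
  have hom: "\<phi> (q * x) = q * \<phi> x" if "q \<noteq> 0" for q x
  proof -
    obtain t where t: "t \<in> T" "rt ?w t = q" using rt_surj[OF w \<open>q \<noteq> 0\<close>] by blast
    let ?s = "conj_by (matrix_inv g) t"
    have s: "?s \<in> T" using g t by simp
    have "u ?w (\<phi> (q * x)) = conj_by g (conj_by ?s (u v x))"
      using u_T[OF v s, of x] pull[OF t(1)] t \<phi>[of "q * x"] by simp
    also have "\<dots> = conj_by (g ** ?s) (u v x)" using g s by (simp add: conj_by_conj_by)
    also have "g ** ?s = t ** g" using g by (simp add: conj_by_def matrix_mul_assoc)
    also have "conj_by (t ** g) (u v x) = conj_by t (u ?w (\<phi> x))"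
      using g t \<phi>[of x] by (simp flip: conj_by_conj_by)
    also have "\<dots> = u ?w (q * \<phi> x)" using u_T[OF w t(1)] t by simp
    finally show ?thesis using u_inject[OF w] by simp
  qed
  have "u ?w (\<phi> 0) = u ?w 0"
    unfolding \<phi>[symmetric] u_zero[OF v] u_zero[OF w] using g by simp
  then have z: "\<phi> 0 = 0" unfolding u_inject[OF w] .
  have lin: "\<phi> x = \<phi> 1 * x" for x
  proof (cases "x = 0")
    case True
    then show ?thesis by (simp only: z mult_zero_right)
  next
    case False
    then have "\<phi> (x * 1) = x * \<phi> 1" by (rule hom)
    then have "\<phi> x = x * \<phi> 1" by (simp only: mult_1_right)
    then show ?thesis by (simp only: mult.commute)
  qed
  have "\<phi> 1 \<noteq> 0"
  proof
    assume "\<phi> 1 = 0"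
    then have "conj_by g (u v 1) = conj_by g (u v 0)" by (simp only: \<phi> z)
    then show False using g u_inject[OF v, of 1 0] by simp
  qed
  moreover have "conj_by g (u v x) = u ?w (\<phi> 1 * x)" for x by (simp only: \<phi> lin[of x])
  ultimately show ?thesis by blast
qed

lemma exists_generic_scalar: "\<exists>q::'f. q \<noteq> 0 \<and> q \<noteq> 1 \<and> q + 1 \<noteq> 0 \<and> q ^ 2 + q + 1 \<noteq> 0"
proof -
  \<comment> \<open>The excluded scalars are the roots of a nonzero polynomial over an infinite field.\<close>
  define p :: "'f poly" where "p = [:0, 1:] * [:-1, 1:] * [:1, 1:] * [:1, 1, 1:]"
  have "p \<noteq> 0" by (simp add: p_def)
  then have "finite {x. poly p x = 0}" by (rule poly_roots_finite)
  then have "{x. poly p x = 0} \<noteq> UNIV" using infinite_UNIV_alg_closed_field by metis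
  then obtain q where "poly p q \<noteq> 0" by blast
  moreover have "poly p q = q * (q - 1) * (q + 1) * (q ^ 2 + q + 1)"
    by (simp add: p_def algebra_simps power2_eq_square)
  ultimately show ?thesis by (intro exI[of _ q]) auto
qed

text \<open>If \<open>u\<^sub>v(x) = u\<^sub>-\<^sub>v(z)\<close>, conjugation by the torus gives \<open>u\<^sub>v(q x) = u\<^sub>-\<^sub>v(z / q)\<close> for all \<open>q \<noteq> 0\<close>. Here
  \<open>q x\<close> is additive in \<open>q\<close>, while \<open>z / q\<close> is not, unless \<open>z = 0\<close>.\<close>

lemma opposite_root_subgroups:
  assumes v: "v \<in> D_roots n" and eq: "u v x = u (- v) z"
  shows "z = 0"
proof -
  note v' = D_roots_uminus[OF v]
  obtain q :: 'f where q: "q \<noteq> 0" "q + 1 \<noteq> 0" "q ^ 2 + q + 1 \<noteq> 0" using exists_generic_scalar by blast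
  have scale: "u v (r * x) = u (- v) (inverse r * z)" if r: "r \<noteq> 0" for r
  proof -
    obtain t where t: "t \<in> T" "rt v t = r" using rt_surj[OF v r] by blast
    then show ?thesis using arg_cong[OF eq, of "conj_by t"] u_T[OF v t(1)] u_T[OF v' t(1)] rt_uminus[OF v t(1)] by simp
  qed
  \<comment> \<open>The parameter \<open>1 + q\<close> on the left is reached by addition and by scaling.\<close>
  have "u (- v) (z + inverse q * z) = u v x ** u v (q * x)" using eq scale[OF q(1)] u_add[OF v'] by simp
  also have "\<dots> = u v ((q + 1) * x)" using u_add[OF v, of x "q * x"] by (simp add: algebra_simps)
  also have "\<dots> = u (- v) (inverse (q + 1) * z)" by (rule scale[OF q(2)])
  finally have "z + inverse q * z = inverse (q + 1) * z" using u_inject[OF v'] by simp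
  then have "(z + inverse q * z) * q * (q + 1) = inverse (q + 1) * z * q * (q + 1)" by simp
  moreover have "(z + inverse q * z) * q = z * (q + 1)" using q by (simp add: field_simps)
  moreover have "inverse (q + 1) * z * q * (q + 1) = z * q" using q by simp
  ultimately have "z * (q + 1) * (q + 1) = z * q" by simp
  then have "z * (q ^ 2 + q + 1) = 0" by (simp add: algebra_simps power2_eq_square)
  then show ?thesis using q by simp
qed

section \<open>Braid relations between the Tits lifts\<close>

text \<open>Inner products of roots are determined by which sums of two roots are roots.\<close>

lemma act_dot:
  assumes g: "g \<in> N" and v: "v \<in> D_roots n" and w: "w \<in> D_roots n"
  shows "dot n (act g v) (act g w) = dot n v w"
proof -
  note r = act_root[OF g v] act_root[OF g w]
  have m: "dot n (act g v) (act g w) = -1" if "dot n v w = -1" and v: "v \<in> D_roots n" for v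
  proof -
    have "(\<lambda>k. v k + w k) \<in> D_roots n" using that w by (simp add: D_roots_add_iff)
    from act_root[OF g this] act_add[OF g v w this] show ?thesis
      using act_root[OF g v] r by (simp add: D_roots_add_iff)
  qed
  have mi: "dot n v w = -1" if "dot n (act g v) (act g w) = -1" and v: "v \<in> D_roots n" for v
  proof -
    note r = act_root[OF g v] act_root[OF g w]
    have gi: "matrix_inv g \<in> N" using g by simp
    have s: "(\<lambda>k. act g v k + act g w k) \<in> D_roots n" using that r by (simp add: D_roots_add_iff)
    have "act (matrix_inv g) (\<lambda>k. act g v k + act g w k) = (\<lambda>k. v k + w k)"
      using act_add[OF gi r s] act_inj[OF g v] act_inj[OF g w] by simp
    then have "(\<lambda>k. v k + w k) \<in> D_roots n" using act_root[OF gi s] by simp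
    then show ?thesis using v w by (simp add: D_roots_add_iff)
  qed
  have p: "dot n v w = -1 \<longleftrightarrow> dot n (act g v) (act g w) = -1" using m mi v by blast
  have q: "dot n v w = 1 \<longleftrightarrow> dot n (act g v) (act g w) = 1"
    using m[of "- v"] mi[of "- v"] D_roots_uminus[OF v] act_uminus[OF g v] by (auto simp: dot_uminus_left)
  consider "v = w" | "v = - w" | "v \<noteq> w" "v \<noteq> - w" by blast
  then show ?thesis
  proof cases
    case 1
    then show ?thesis using r w by (simp add: D_roots_norm)
  next
    case 2
    then show ?thesis using r w by (simp add: act_uminus[OF g w] dot_uminus_left D_roots_norm)
  next
    case 3
    have ne: "act g v \<noteq> act g w" "act g v \<noteq> act g (- w)"
      using act_inj[OF g v] act_inj[OF g w] act_inj[OF g D_roots_uminus[OF w]] 3 by metis+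
    have "- v \<noteq> w" using 3 by auto
    then have "dot n v w \<le> 1" "dot n (- v) w \<le> 1"
      using 3 D_roots_dot_le_1[OF v w] D_roots_dot_le_1[OF D_roots_uminus[OF v] w] by auto
    moreover have "- act g v \<noteq> act g w"
    proof
      assume h: "- act g v = act g w"
      have "act g v = - act g w" unfolding h[symmetric] by (simp add: fun_eq_iff)
      then show False using ne act_uminus[OF g w] by simp
    qed
    then have "dot n (act g v) (act g w) \<le> 1" "dot n (- act g v) (act g w) \<le> 1"
      using ne D_roots_dot_le_1[OF r] D_roots_dot_le_1[OF D_roots_uminus[OF r(1)] r(2)] by auto
    ultimately show ?thesis using p q by (simp add: dot_uminus_left) linarith
  qed
qed

lemma act_refl:
  assumes g: "g \<in> N" and v: "v \<in> D_roots n" and w: "w \<in> D_roots n"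
  shows "act g (root_refl n v w) = root_refl n (act g v) (act g w)"
proof (rule act_eqI[OF g])
  note r = act_root[OF g v] act_root[OF g w]
  show "root_refl n (act g v) (act g w) \<in> D_roots n" using r by (rule refl_root)
  fix t assume t: "t \<in> T"
  then have "conj_by g t \<in> T" using g by simp
  then show "rt (root_refl n (act g v) (act g w)) (conj_by g t) = rt (root_refl n v w) t"
    using rt_refl[OF r(2,1), of "conj_by g t"] rt_refl[OF w v t] rt_act[OF g v t] rt_act[OF g w t]
      act_dot[OF g w v] by simp
qed

lemma sigma_eq:
  "v \<in> D_roots n \<Longrightarrow> x \<noteq> 0 \<Longrightarrow> u v x ** u (- v) (- inverse x) ** u v x = cor v x ** sigma u v"
  using realization by (simp add: realization_def)

text \<open>Conjugation by \<open>g\<close> gives \<open>u\<^sub>w(c) u\<^sub>-\<^sub>w(-c') u\<^sub>w(c)\<close> with scalars \<open>c, c'\<close> from the two root subgroups, where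
  \<open>w = act g v\<close>. If \<open>c' = 1 / c\<close>, this is \<open>w\<^sup>\<or>(c) \<sigma>\<^sub>w\<close>. In any case both elements act on the roots as
  the reflection in \<open>w\<close>, so their quotient \<open>y\<close> lies in \<open>T\<close>. On the other hand \<open>y\<close> is a conjugate
  of \<open>u\<^sub>-\<^sub>w(d)\<close> with \<open>d = 1 / c - c'\<close>, and invariance of \<open>y\<close> under the torus forces \<open>d = 0\<close>.\<close>

lemma conj_by_sigma_transport:
  assumes g: "g \<in> N" and v: "v \<in> D_roots n"
  shows "\<exists>c. c \<noteq> 0 \<and> conj_by g (sigma u v) = cor (act g v) c ** sigma u (act g v)"
proof -
  let ?w = "act g v"
  have w: "?w \<in> D_roots n" by (rule act_root[OF g v])
  note v' = D_roots_uminus[OF v] and w' = D_roots_uminus[OF w]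
  obtain c where c: "c \<noteq> 0" "\<And>x. conj_by g (u v x) = u ?w (c * x)"
    using root_subgroup_transport[OF g v] by blast
  obtain c' where c': "\<And>x. conj_by g (u (- v) x) = u (- ?w) (c' * x)"
    using root_subgroup_transport[OF g v'] act_uminus[OF g v] by auto
  define P where "P = conj_by g (sigma u v)"
  define M where "M = cor ?w c ** sigma u ?w"
  have P: "P = u ?w c ** u (- ?w) (- c') ** u ?w c"
    using g c(2)[of 1] c'[of "-1"] by (simp add: P_def sigma_def conj_by_mult)
  have M: "M = u ?w c ** u (- ?w) (- inverse c) ** u ?w c"
    using sigma_eq[OF w c(1)] by (simp add: M_def)
  have PN: "P \<in> N" using g v by (simp add: P_def conj_by_def)
  have MN: "M \<in> N" using w c by (simp add: M_def T_N)
  define y where "y = P ** matrix_inv M"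
  define d where "d = inverse c - c'"
  have yN: "y \<in> N" using PN MN by (simp add: y_def)
  have actP: "act P x = root_refl n ?w x" if x: "x \<in> D_roots n" for x
  proof -
    let ?x = "act (matrix_inv g) x"
    have xr: "?x \<in> D_roots n" using g x by (intro act_root) auto
    have "act P x = act g (act (sigma u v) ?x)"
      using g v x xr by (simp add: P_def conj_by_def act_mult act_root)
    also have "\<dots> = root_refl n ?w (act g ?x)" using act_refl[OF g v xr] act_sigma[OF v xr] by simp
    also have "act g ?x = x" using act_inj[of "matrix_inv g" x] g x by simp
    finally show ?thesis .
  qed
  have actM: "act M x = root_refl n ?w x" if x: "x \<in> D_roots n" for x
    using x w c by (simp add: M_def act_mult act_T T_N act_sigma refl_root)
  have yT: "y \<in> T"
  proof (rule act_trivial_imp_T[OF yN])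
    fix i assume i: "i \<in> {1..n}"
    let ?x = "act (matrix_inv M) (simple n i)"
    have xr: "?x \<in> D_roots n" using MN i by (intro act_root) auto
    have "act y (simple n i) = act P ?x" using PN MN i by (simp add: y_def act_mult)
    also have "\<dots> = act M ?x" by (simp add: actP[OF xr] actM[OF xr])
    also have "\<dots> = simple n i" using act_inj[of "matrix_inv M" "simple n i"] MN i by simp
    finally show "act y (simple n i) = simple n i" .
  qed
  have Pd: "P = u ?w c ** u (- ?w) d ** u ?w (- c) ** M"
  proof -
    have "u ?w c ** u (- ?w) d ** u ?w (- c) ** M
        = u ?w c ** u (- ?w) d ** (u ?w (- c) ** u ?w c) ** u (- ?w) (- inverse c) ** u ?w c"
      by (simp only: M matrix_mul_assoc)
    also have "\<dots> = u ?w c ** (u (- ?w) d ** u (- ?w) (- inverse c)) ** u ?w c"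
      using w by (simp add: u_zero matrix_mul_assoc flip: u_add)
    also have "\<dots> = P" using w' by (simp add: P d_def flip: u_add)
    finally show ?thesis by simp
  qed
  have yd: "y = u ?w c ** u (- ?w) d ** u ?w (- c)"
    unfolding y_def using Pd matrix_inv_cancel(3)[of M] MN by (metis N_invertible)
  \<comment> \<open>Moving the right factor of \<open>y\<close> past \<open>y\<close> itself, which lies in \<open>T\<close>, leaves one factor from each
    of the two opposite root subgroups.\<close>
  define e where "e = c - rt ?w y * c"
  have ye: "y = u ?w e ** u (- ?w) d"
  proof -
    have "y ** u ?w c = u ?w (rt ?w y * c) ** y"
      using u_T[OF w yT, of c] yT matrix_inv_cancel(4)[of y "y ** u ?w c"] by (simp add: conj_by_def)
    moreover have "y ** u ?w c = u ?w c ** u (- ?w) d"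
      using w by (subst yd) (simp add: u_uminus)
    ultimately have "u ?w (- (rt ?w y * c)) ** (u ?w (rt ?w y * c) ** y)
        = u ?w (- (rt ?w y * c)) ** (u ?w c ** u (- ?w) d)" by simp
    then show ?thesis using w by (simp add: matrix_mul_assoc u_zero e_def flip: u_add)
  qed
  \<comment> \<open>Conjugation by the torus scales the two factors by \<open>q\<close> and \<open>1 / q\<close> but fixes \<open>y\<close>.\<close>
  have "d = 0"
  proof -
    obtain q :: 'f where q: "q \<noteq> 0" "q \<noteq> 1" using exists_generic_scalar by blast
    obtain t where t: "t \<in> T" "rt ?w t = q" using rt_surj[OF w q(1)] by blast
    have "y = conj_by t y" using t yT by simp
    also have "\<dots> = u ?w (q * e) ** u (- ?w) (inverse q * d)"
      unfolding ye using t u_T[OF w t(1)] u_T[OF w' t(1)] rt_uminus[OF w t(1)] by (simp add: conj_by_mult)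
    finally have "u ?w (- (q * e)) ** (u ?w e ** u (- ?w) d) ** u (- ?w) (- d)
        = u ?w (- (q * e)) ** (u ?w (q * e) ** u (- ?w) (inverse q * d)) ** u (- ?w) (- d)"
      using ye by simp
    then have "u ?w (- (q * e)) ** u ?w e ** (u (- ?w) d ** u (- ?w) (- d))
        = u ?w (- (q * e)) ** u ?w (q * e) ** (u (- ?w) (inverse q * d) ** u (- ?w) (- d))"
      by (simp only: matrix_mul_assoc)
    then have "u ?w (- (q * e) + e) = u (- ?w) (inverse q * d - d)"
      using w w' by (simp add: u_zero flip: u_add)
    then have "inverse q * d - d = 0" by (rule opposite_root_subgroups[OF w])
    then show "d = 0" using q by (simp add: field_simps)
  qed
  then have "P = M" using P M d_def by simp
  then show ?thesis using c by (auto simp: P_def M_def)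
qed

text \<open>The realization at \<open>x = -1\<close> says that \<open>\<sigma>\<^sup>-\<^sup>1 = v\<^sup>\<or>(-1) \<sigma>\<close>.\<close>

lemma sigma_square: "v \<in> D_roots n \<Longrightarrow> sigma u v ** sigma u v = cor v (- 1)"
proof -
  assume v: "v \<in> D_roots n"
  note v' = D_roots_uminus[OF v]
  have "cor v (- 1) ** sigma u v = u v (- 1) ** u (- v) 1 ** u v (- 1)"
    using sigma_eq[OF v, of "-1"] by simp
  also have "\<dots> = matrix_inv (sigma u v)"
    using v v' by (simp add: sigma_def matrix_inv_mult invertible_mult u_uminus[OF v] u_uminus[OF v'] matrix_mul_assoc)
  finally have "cor v (- 1) ** sigma u v ** sigma u v = mat 1" using v by simp
  moreover have "cor v (- 1) ** cor v (- 1) = mat 1" using v cor_mult[of v "-1" "-1"] cor_one[of v] by simp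
  then have "sigma u v ** sigma u v = cor v (- 1) ** (cor v (- 1) ** sigma u v ** sigma u v)"
    by (simp add: matrix_mul_assoc)
  ultimately show ?thesis by simp
qed

text \<open>The two orders of the product differ by values of both coroots, which are independent.\<close>

lemma sigma_commute:
  assumes i: "i \<in> {1..n}" and j: "j \<in> {1..n}" and ij: "i \<noteq> j" "\<not> adj n i j"
  shows "sig i ** sig j = sig j ** sig i"
proof -
  have one: "\<exists>c. c \<noteq> 0 \<and> sig j ** sig i = coroot i c ** (sig i ** sig j)"
    if i: "i \<in> {1..n}" and j: "j \<in> {1..n}" and ij: "i \<noteq> j" "\<not> adj n i j" for i j
  proof -
    have "dot n (simple n i) (simple n j) = 0" using that rank by (simp add: cartan_D)
    then have a: "act (sig j) (simple n i) = simple n i" using i j by (simp add: act_sigma root_refl_def)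
    obtain c where c: "c \<noteq> 0" "conj_by (sig j) (sig i) = coroot i c ** sig i"
      using conj_by_sigma_transport[of "sig j" "simple n i"] i j a by auto
    then have "conj_by (sig j) (sig i) ** sig j = coroot i c ** (sig i ** sig j)" by (simp add: matrix_mul_assoc)
    then show ?thesis using c(1) j by (auto simp: conj_by_def)
  qed
  obtain c where c: "c \<noteq> 0" "sig j ** sig i = coroot i c ** (sig i ** sig j)" using one[OF i j ij] by blast
  obtain c' where c': "c' \<noteq> 0" "sig i ** sig j = coroot j c' ** (sig j ** sig i)"
    using one[OF j i] ij by (auto simp: adj_sym)
  have "sig j ** sig i = coroot i c ** coroot j c' ** (sig j ** sig i)" using c(2) c'(2) by (metis matrix_mul_assoc)
  then have "coroot i c ** coroot j c' ** (sig j ** sig i) ** matrix_inv (sig j ** sig i)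
      = sig j ** sig i ** matrix_inv (sig j ** sig i)" by simp
  moreover have "invertible (sig j ** sig i)" using i j by (intro invertible_mult) auto
  ultimately have "coroot i c ** coroot j c' = mat 1" by simp
  then have "c = 1" using coroots_independent[OF i j ij(1) c(1) c'(1)] by simp
  then show ?thesis using c(2) i by (simp add: cor_one)
qed

text \<open>The product \<open>\<sigma>\<^sub>i \<sigma>\<^sub>j\<close> takes \<open>\<alpha>\<^sub>i\<close> to \<open>\<alpha>\<^sub>j\<close>, so conjugation by it turns \<open>\<sigma>\<^sub>i\<close> into \<open>\<alpha>\<^sub>j\<^sup>\<or>(c) \<sigma>\<^sub>j\<close>. This is the
  braid relation up to \<open>\<alpha>\<^sub>j\<^sup>\<or>(c)\<close>. With \<open>i\<close> and \<open>j\<close> exchanged the error is a value of the other coroot,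
  and the two are independent.\<close>

lemma sigma_braid:
  assumes i: "i \<in> {1..n}" and j: "j \<in> {1..n}" and ij: "adj n i j"
  shows "sig i ** (sig j ** sig i) = sig j ** (sig i ** sig j)"
proof -
  have one: "\<exists>c. c \<noteq> 0 \<and> sig i ** (sig j ** sig i) = coroot j c ** (sig j ** (sig i ** sig j))"
    if i: "i \<in> {1..n}" and j: "j \<in> {1..n}" and ij: "adj n i j" for i j
  proof -
    have "i \<noteq> j" using that rank by (auto simp: adj_def)
    then have d: "dot n (simple n i) (simple n j) = -1" "dot n (simple n j) (simple n i) = -1"
      "dot n (simple n i) (simple n i) = 2" using that rank by (auto simp: cartan_D adj_sym)
    have a: "act (sig i ** sig j) (simple n i) = simple n j"
      using i j by (simp add: act_mult act_sigma refl_root)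
        (unfold root_refl_def dot_diff_scale_left d, simp add: d)
    obtain c where c: "c \<noteq> 0" "conj_by (sig i ** sig j) (sig i) = coroot j c ** sig j"
      using conj_by_sigma_transport[of "sig i ** sig j" "simple n i"] i j a by auto
    have "invertible (sig i ** sig j)" using i j by (intro invertible_mult) auto
    moreover have "conj_by (sig i ** sig j) (sig i) ** (sig i ** sig j) = coroot j c ** sig j ** (sig i ** sig j)"
      using c by simp
    ultimately have "sig i ** sig j ** sig i = coroot j c ** sig j ** (sig i ** sig j)" by (simp add: conj_by_def)
    then show ?thesis using c(1) by (auto simp: matrix_mul_assoc)
  qed
  have ne: "j \<noteq> i" using ij i j rank by (auto simp: adj_def)
  obtain c where c: "c \<noteq> 0" "sig i ** (sig j ** sig i) = coroot j c ** (sig j ** (sig i ** sig j))"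
    using one[OF i j ij] by blast
  obtain c' where c': "c' \<noteq> 0" "sig j ** (sig i ** sig j) = coroot i c' ** (sig i ** (sig j ** sig i))"
    using one[OF j i] ij by (auto simp: adj_sym)
  let ?s = "sig i ** (sig j ** sig i)"
  have "?s = coroot j c ** coroot i c' ** ?s" using c(2) c'(2) by (metis matrix_mul_assoc)
  then have "coroot j c ** coroot i c' ** ?s ** matrix_inv ?s = ?s ** matrix_inv ?s" by simp
  moreover have "invertible ?s" using i j by (intro invertible_mult) auto
  ultimately have "coroot j c ** coroot i c' = mat 1" by simp
  then have "c = 1" using coroots_independent[OF j i ne c(1) c'(1)] by simp
  then show ?thesis using c(2) j by (simp add: cor_one)
qed

section \<open>The torus parts of a section\<close>

lemma alpha_nonzero [simp]: "i \<in> {1..n} \<Longrightarrow> t \<in> T \<Longrightarrow> alpha i t \<noteq> 0"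
  by (intro rt_nonzero) auto

lemma sig_mult_T: "i \<in> {1..n} \<Longrightarrow> t \<in> T \<Longrightarrow> sig i ** t = t ** coroot i (inverse (alpha i t)) ** sig i"
proof -
  assume i: "i \<in> {1..n}" and t: "t \<in> T"
  have "sig i ** t = conj_by (sig i) t ** sig i" using i by (simp add: conj_by_def)
  also have "conj_by (sig i) t = t ** coroot i (inverse (alpha i t))" by (rule conj_by_sigma) (use i t in auto)
  finally show ?thesis .
qed

text \<open>The torus parts of a product of lifts are collected on the left.\<close>

lemma product_expansion:
  assumes i: "i \<in> {1..n}" and t: "t \<in> T" "t' \<in> T"
  shows "t ** sig i ** (t' ** g) = t ** t' ** coroot i (inverse (alpha i t')) ** (sig i ** g)"
proof -
  have "t ** sig i ** (t' ** g) = t ** (sig i ** t') ** g" by (simp only: matrix_mul_assoc)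
  also have "\<dots> = t ** t' ** coroot i (inverse (alpha i t')) ** (sig i ** g)"
    unfolding sig_mult_T[OF i t(2)] by (simp only: matrix_mul_assoc)
  finally show ?thesis .
qed

lemma cor_inverse_mult: "v \<in> D_roots n \<Longrightarrow> x \<noteq> 0 \<Longrightarrow> cor v (inverse x) ** cor v x = mat 1"
  using cor_mult[of v "inverse x" x, symmetric] by (simp only: left_inverse cor_one) simp

text \<open>The two products have the torus parts \<open>t\<^sub>i s\<^sub>i(t\<^sub>j)\<close> and \<open>t\<^sub>j s\<^sub>j(t\<^sub>i)\<close>, so
  \<open>\<alpha>\<^sub>i\<^sup>\<or>(\<alpha>\<^sub>i(t\<^sub>j)) = \<alpha>\<^sub>j\<^sup>\<or>(\<alpha>\<^sub>j(t\<^sub>i))\<close>.\<close>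

lemma commute_equation:
  assumes i: "i \<in> {1..n}" and j: "j \<in> {1..n}" and ij: "i \<noteq> j" "\<not> adj n i j"
    and t: "ti \<in> T" "tj \<in> T"
    and eq: "ti ** sig i ** (tj ** sig j) = tj ** sig j ** (ti ** sig i)"
  shows "alpha j ti = 1"
proof -
  let ?A = "alpha i tj" and ?B = "alpha j ti"
  have AB: "?A \<noteq> 0" "?B \<noteq> 0" using i j t by auto
  have "ti ** tj ** coroot i (inverse ?A) ** (sig i ** sig j)
      = tj ** ti ** coroot j (inverse ?B) ** (sig i ** sig j)"
    using eq unfolding product_expansion[OF i t] product_expansion[OF j t(2,1)] sigma_commute[OF j i ij(1)[symmetric] ij(2)[unfolded adj_sym[of n i]]] .
  moreover have "invertible (sig i ** sig j)" using i j by (intro invertible_mult) auto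
  ultimately have "ti ** tj ** coroot i (inverse ?A) = tj ** ti ** coroot j (inverse ?B)"
    using matrix_right_cancel by blast
  then have "ti ** tj ** coroot i (inverse ?A) = ti ** tj ** coroot j (inverse ?B)"
    using T_commute[OF t] by simp
  then have "coroot i (inverse ?A) = coroot j (inverse ?B)" using matrix_left_cancel[of "ti ** tj"] t by simp
  then have "coroot i (inverse ?A) ** coroot j ?B = coroot j (inverse ?B) ** coroot j ?B" by simp
  then have "coroot i (inverse ?A) ** coroot j ?B = mat 1"
    using cor_mult[of "simple n j" "inverse ?B" ?B] cor_one[of "simple n j"] j AB by simp
  then show ?thesis using coroots_independent[OF i j ij(1), of "inverse ?A" ?B] AB by simp
qed

text \<open>The two sides have the torus parts \<open>t\<^sub>i s\<^sub>i(t\<^sub>j s\<^sub>j(t\<^sub>i))\<close> and \<open>t\<^sub>j s\<^sub>j(t\<^sub>i s\<^sub>i(t\<^sub>j))\<close>; after cancelling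
  the common factors one coroot value is left with each of \<open>t\<^sub>i\<close> and \<open>t\<^sub>j\<close>.\<close>

lemma braid_equation:
  assumes i: "i \<in> {1..n}" and j: "j \<in> {1..n}" and ij: "adj n i j"
    and t: "ti \<in> T" "tj \<in> T"
    and eq: "ti ** sig i ** (tj ** sig j ** (ti ** sig i)) = tj ** sig j ** (ti ** sig i ** (tj ** sig j))"
  shows "ti ** coroot i (inverse (alpha i ti * alpha j ti)) = tj ** coroot j (inverse (alpha i tj * alpha j tj))"
proof -
  have half: "t ** sig i ** (t' ** sig j ** (t ** sig i))
      = t ** t' ** t ** coroot j (inverse (alpha j t))
          ** coroot i (inverse (alpha i t * alpha i t' * alpha j t)) ** (sig i ** (sig j ** sig i))"
    if i: "i \<in> {1..n}" and j: "j \<in> {1..n}" and ij: "adj n i j" and t: "t \<in> T" "t' \<in> T" for i j t t'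
  proof -
    let ?B = "alpha j t"
    let ?X = "t' ** t ** coroot j (inverse ?B)"
    have ne: "i \<noteq> j" using ij i j rank by (auto simp: adj_def)
    have B: "?B \<noteq> 0" using t j by simp
    have X: "?X \<in> T" using t j B by simp
    have aX: "alpha i ?X = alpha i t * alpha i t' * ?B"
      using t i j B ne ij alpha_coroot[OF j i, of "inverse ?B"] by (simp add: rt_mult)
    have "t ** sig i ** (t' ** sig j ** (t ** sig i)) = t ** sig i ** (?X ** (sig j ** sig i))"
      by (simp only: product_expansion[OF j t(2,1)])
    also have "\<dots> = t ** ?X ** coroot i (inverse (alpha i t * alpha i t' * ?B)) ** (sig i ** (sig j ** sig i))"
      unfolding product_expansion[OF i t(1) X] aX ..
    finally show ?thesis by (simp only: matrix_mul_assoc)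
  qed
  let ?A = "alpha i tj" and ?B = "alpha j ti" and ?C = "alpha i ti" and ?D = "alpha j tj"
  have nz: "?A \<noteq> 0" "?B \<noteq> 0" "?C \<noteq> 0" "?D \<noteq> 0" using i j t by auto
  let ?ci = "coroot i" and ?cj = "coroot j"
  have ij': "adj n j i" using ij adj_sym by blast
  have "invertible (sig i ** (sig j ** sig i))" using i j by (intro invertible_mult) auto
  then have 1: "ti ** tj ** ti ** ?cj (inverse ?B) ** ?ci (inverse (?C * ?A * ?B))
      = tj ** ti ** tj ** ?ci (inverse ?A) ** ?cj (inverse (?D * ?B * ?A))"
    using eq half[OF i j ij t] half[OF j i ij' t(2,1)] sigma_braid[OF i j ij]
    by (simp add: matrix_right_cancel)
  have split1: "?ci (inverse (?C * ?A * ?B)) = ?ci (inverse (?C * ?B)) ** ?ci (inverse ?A)"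
    using cor_mult[of "simple n i" "inverse (?C * ?B)" "inverse ?A"] i nz by (simp add: mult_ac)
  have split2: "?cj (inverse (?D * ?B * ?A)) = ?cj (inverse (?A * ?D)) ** ?cj (inverse ?B)"
    using cor_mult[of "simple n j" "inverse (?A * ?D)" "inverse ?B"] j nz by (simp add: mult_ac)
  \<comment> \<open>The factor common to both sides.\<close>
  let ?Y = "ti ** tj ** ?cj (inverse ?B) ** ?ci (inverse ?A)"
  have Y: "?Y \<in> T" "?ci (inverse ?A) \<in> T" "?cj (inverse ?B) \<in> T"
    "?ci (inverse (?C * ?B)) \<in> T" "?cj (inverse (?A * ?D)) \<in> T" using t i j nz by auto
  have "ti ** tj ** ti ** ?cj (inverse ?B) ** ?ci (inverse (?C * ?A * ?B))
      = ?Y ** (ti ** ?ci (inverse (?C * ?B)))"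
    unfolding split1 using t Y by (simp add: T_ac)
  moreover have "tj ** ti ** tj ** ?ci (inverse ?A) ** ?cj (inverse (?D * ?B * ?A))
      = ?Y ** (tj ** ?cj (inverse (?A * ?D)))"
    unfolding split2 using t Y by (simp add: T_ac)
  ultimately have "?Y ** (ti ** ?ci (inverse (?C * ?B))) = ?Y ** (tj ** ?cj (inverse (?A * ?D)))"
    using 1 by simp
  then show ?thesis using matrix_left_cancel Y(1) T_closed(1) by blast
qed

text \<open>Let \<open>r\<^sub>i\<^sub>j = r\<^sub>j\<^sub>i\<close> be the common value in the equation for the edge \<open>i, j\<close>. A third node is orthogonal
  to \<open>i\<close> or to \<open>j\<close>, as the diagram has no triangles, and therefore trivial on \<open>r\<^sub>i\<^sub>j\<close>. On \<open>\<alpha>\<^sub>j\<close> and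
  \<open>\<alpha>\<^sub>i\<close> the values are \<open>M\<^sub>i\<^sub>j\<close> and its inverse. Evaluating \<open>\<alpha>\<^sub>k(r\<^sub>i\<^sub>j) = 1\<close> for another neighbour \<open>k\<close> of
  \<open>i\<close> gives \<open>M\<^sub>i\<^sub>j M\<^sub>i\<^sub>k = 1\<close>, so up to inversion \<open>M\<close> is constant along the chain, and at the
  branch node the three equations give \<open>M = 1\<close>. Hence all \<open>r\<^sub>i\<^sub>j\<close> are central, and then \<open>r\<^sub>i\<^sub>j\<close> does
  not depend on \<open>j\<close> either.\<close>

lemma section_torus_parts:
  assumes t: "\<And>i. i \<in> {1..n} \<Longrightarrow> t i \<in> T"
    and orth: "\<And>i j. i \<in> {1..n} \<Longrightarrow> j \<in> {1..n} \<Longrightarrow> i \<noteq> j \<Longrightarrow> \<not> adj n i j \<Longrightarrow> alpha j (t i) = 1"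
    and edge: "\<And>i j. i \<in> {1..n} \<Longrightarrow> j \<in> {1..n} \<Longrightarrow> adj n i j \<Longrightarrow>
      t i ** coroot i (inverse (alpha i (t i) * alpha j (t i)))
        = t j ** coroot j (inverse (alpha i (t j) * alpha j (t j)))"
  shows "\<exists>z. central z \<and> (\<forall>i\<in>{1..n}. \<exists>e. e \<noteq> 0 \<and> t i = z ** coroot i e)"
proof -
  define B where "B i j = alpha j (t i)" for i j
  define r where "r i j = t i ** coroot i (inverse (B i i * B i j))" for i j
  \<comment> \<open>The value of \<open>\<alpha>\<^sub>j\<close> at \<open>r i j\<close> for adjacent \<open>i, j\<close>.\<close>
  define M where "M i j = B i j * B i j * B i i" for i j
  have B0: "B i j \<noteq> 0" if "i \<in> {1..n}" "j \<in> {1..n}" for i j using that t[OF that(1)] by (simp add: B_def)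
  have ne: "i \<noteq> j" if "i \<in> {1..n}" "adj n i j" for i j using that rank by (auto simp: adj_def)
  have r_sym: "r i j = r j i" if "i \<in> {1..n}" "j \<in> {1..n}" "adj n i j" for i j
    using edge[OF that] by (simp add: r_def B_def mult.commute)
  have rT: "r i j \<in> T" if "i \<in> {1..n}" "j \<in> {1..n}" for i j
    using t[OF that(1)] that B0 by (simp add: r_def)
  have ar: "alpha k (r i j) = B i k * (if k = i then inverse (B i i * B i j) ^ 2 else if adj n k i then B i i * B i j else 1)"
    if "i \<in> {1..n}" "j \<in> {1..n}" "k \<in> {1..n}" for i j k
    using that t[OF that(1)] B0[of i i] B0[of i j] alpha_coroot[of i k "inverse (B i i * B i j)"]
    by (simp add: r_def rt_mult B_def)
  have ar_far: "alpha k (r i j) = 1" if k: "k \<in> {1..n}" "k \<noteq> i" "k \<noteq> j" and ij: "i \<in> {1..n}" "j \<in> {1..n}" "adj n i j" for i j k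
  proof -
    have "\<not> (adj n k i \<and> adj n k j)" using ij k rank unfolding adj_def atLeastAtMost_iff by linarith
    then show ?thesis
    proof (cases "adj n k i")
      case False
      then show ?thesis using ar[of i j k] ij k orth[of i k] adj_sym[of n i k] by (simp add: B_def)
    next
      case True
      then have "\<not> adj n k j" using \<open>\<not> (adj n k i \<and> adj n k j)\<close> by simp
      then show ?thesis using ar[of j i k] r_sym[OF ij] ij k orth[of j k] adj_sym[of n j k] by (simp add: B_def)
    qed
  qed
  have ar_j: "alpha j (r i j) = M i j" if ij: "i \<in> {1..n}" "j \<in> {1..n}" "adj n i j" for i j
    using ar[of i j j] ij ne[OF ij(1,3)] adj_sym[of n i j] by (simp add: M_def mult_ac)
  have ar_i: "alpha i (r i j) * M i j = 1" if ij: "i \<in> {1..n}" "j \<in> {1..n}" for i j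
    using ar[of i j i] ij B0[of i i] B0[of i j] by (simp add: M_def power2_eq_square field_simps)
  have M_flip: "M i j * M j i = 1" if ij: "i \<in> {1..n}" "j \<in> {1..n}" "adj n i j" for i j
    using ar_i[OF ij(1,2)] ar_j[OF ij(2,1)] r_sym[OF ij] ij(3) adj_sym[of n i j] by (simp add: mult.commute)
  have two: "B i j * B i k * B i i = 1"
    if "i \<in> {1..n}" "j \<in> {1..n}" "k \<in> {1..n}" "adj n i j" "adj n i k" "j \<noteq> k" for i j k
    using ar[of i j k] ar_far[of k i j] that ne[of i k] adj_sym[of n i k] by (simp add: mult_ac)
  have MM: "M i j * M i k = 1"
    if "i \<in> {1..n}" "j \<in> {1..n}" "k \<in> {1..n}" "adj n i j" "adj n i k" "j \<noteq> k" for i j k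
  proof -
    have "M i j * M i k = (B i j * B i k * B i i) * (B i j * B i k * B i i)" by (simp add: M_def mult_ac)
    then show ?thesis using two[OF that] by simp
  qed
  have same: "r i j = r i k"
    if "i \<in> {1..n}" "j \<in> {1..n}" "k \<in> {1..n}" "adj n i j" "adj n i k" "j \<noteq> k" "M i j = 1" for i j k
  proof -
    have "(B i j * B i i) * B i j = (B i j * B i i) * B i k"
      using two[OF that(1-6)] that(7) by (simp add: M_def mult_ac)
    then have "B i j = B i k" using B0[OF that(1,1)] B0[OF that(1,2)] by simp
    then show ?thesis by (simp add: r_def)
  qed
  have nodes: "n - 3 \<in> {1..n}" "n - 2 \<in> {1..n}" "n - 1 \<in> {1..n}" "n \<in> {1..n}" using rank by auto
  have branch: "adj n (n - 2) (n - 3)" "adj n (n - 2) (n - 1)" "adj n (n - 2) n"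
    using rank unfolding adj_def by linarith+
  have dist: "n - 3 \<noteq> n - 1" "n - 3 \<noteq> n" "n - 1 \<noteq> n" using rank by linarith+
  let ?b = "n - 2"
  \<comment> \<open>At the branch node the three products of two neighbouring values agree, so the values do.\<close>
  have Mb: "M ?b (n - 3) = 1"
  proof -
    have e: "B ?b (n - 3) * B ?b (n - 1) * B ?b ?b = 1" "B ?b (n - 3) * B ?b n * B ?b ?b = 1"
      "B ?b (n - 1) * B ?b n * B ?b ?b = 1"
      using two nodes branch dist by blast+
    have "B ?b (n - 3) * (B ?b n * B ?b ?b) = B ?b (n - 1) * (B ?b n * B ?b ?b)" using e(2,3) by (simp add: mult_ac)
    then have "B ?b (n - 3) = B ?b (n - 1)" using B0[OF nodes(2,2)] B0[OF nodes(2,4)] by simp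
    then show ?thesis using e(1) by (simp add: M_def)
  qed
  define z where "z = r ?b (n - 3)"
  \<comment> \<open>From the branch node the result spreads to node 1.\<close>
  have chain: "M (Suc i) i = 1 \<and> r (Suc i) i = z" if i: "1 \<le> i" "i \<le> n - 3" for i
    using i(2,1)
  proof (induction i rule: inc_induct)
    case base
    have "Suc (n - 3) = n - 2" using rank by simp
    then show ?case using Mb by (simp add: z_def)
  next
    case (step i)
    let ?j = "Suc i" and ?k = "Suc (Suc i)"
    have IH: "M ?k ?j = 1" "r ?k ?j = z" using step by auto
    have mem: "i \<in> {1..n}" "?j \<in> {1..n}" "?k \<in> {1..n}" using step by auto
    have a: "adj n ?j ?k" "adj n ?j i" "adj n ?k ?j" using step rank unfolding adj_def by linarith+
    have Mj: "M ?j ?k = 1" using M_flip[OF mem(2,3) a(1)] IH by simp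
    have "M ?j i = 1" using MM[OF mem(2,3,1) a(1,2)] Mj by simp
    moreover have "r ?j i = z"
      using same[OF mem(2,3,1) a(1,2) _ Mj] r_sym[OF mem(2,3) a(1)] IH by simp
    ultimately show ?case by simp
  qed
  have Mleaf: "r k ?b = z" if k: "k = n - 1 \<or> k = n" for k
  proof -
    have mem: "k \<in> {1..n}" "adj n ?b k" "n - 3 \<noteq> k" using k nodes branch dist by auto
    have "r k ?b = r ?b k" using r_sym[OF nodes(2) mem(1,2)] by simp
    also have "\<dots> = r ?b (n - 3)" using same[OF nodes(2,1) mem(1) branch(1) mem(2,3) Mb] by simp
    finally show ?thesis by (simp add: z_def)
  qed
  have cz: "central z" unfolding central_def
  proof (intro conjI ballI)
    show "z \<in> T" using rT nodes by (simp add: z_def)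
    fix k assume k: "k \<in> {1..n}"
    have i1: "alpha (n - 3) z = 1" using ar_j[OF nodes(2,1) branch(1)] Mb by (simp add: z_def)
    have i2: "alpha (n - 2) z = 1" using ar_i[OF nodes(2,1)] Mb by (simp add: z_def)
    show "alpha k z = 1"
      using i1 i2 ar_far[OF k _ _ nodes(2,1) branch(1)] unfolding z_def by blast
  qed
  have "\<exists>j\<in>{1..n}. r i j = z" if i: "i \<in> {1..n}" for i
  proof -
    have "i = 1 \<or> (\<exists>k. i = Suc k \<and> 1 \<le> k \<and> k \<le> n - 3) \<or> i = n - 1 \<or> i = n"
      using i by (cases i) auto
    then consider "i = 1" | k where "i = Suc k" "1 \<le> k" "k \<le> n - 3" | "i = n - 1 \<or> i = n" by blast
    then show ?thesis
    proof cases
      case 1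
      have "adj n 1 2" "2 \<in> {1..n}" "1 \<in> {1..n}" "Suc 1 = 2" using rank by (auto simp: adj_def)
      moreover have "1 \<le> n - 3" using rank by linarith
      then have "r (Suc 1) 1 = z" using chain[OF order_refl] by blast
      ultimately have "r 1 2 = z" using r_sym[of 1 2] by (simp only:)
      then show ?thesis using 1 \<open>2 \<in> {1..n}\<close> by auto
    next
      case 2
      then have "k \<in> {1..n}" by auto
      then show ?thesis using chain[of k] 2 by blast
    next
      case 3
      then show ?thesis using Mleaf nodes by blast
    qed
  qed
  then have "\<exists>e. e \<noteq> 0 \<and> t i = z ** coroot i e" if i: "i \<in> {1..n}" for i
  proof -
    obtain j where j: "j \<in> {1..n}" "r i j = z" using \<open>\<And>i. i \<in> {1..n} \<Longrightarrow> \<exists>j\<in>{1..n}. r i j = z\<close>[OF i] by blast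
    let ?x = "B i i * B i j"
    have x: "?x \<noteq> 0" using B0 i j by simp
    have "z ** coroot i ?x = t i ** (coroot i (inverse ?x) ** coroot i ?x)"
      using j(2) by (simp add: r_def matrix_mul_assoc)
    also have "coroot i (inverse ?x) ** coroot i ?x = mat 1"
      by (rule cor_inverse_mult) (use i x in auto)
    finally show ?thesis using x by (intro exI[of _ ?x]) simp
  qed
  then show ?thesis using cz by blast
qed

section \<open>Sections and the orders of their values\<close>

lemma section_simple:
  assumes S: "is_section G T n srefl S" and i: "i \<in> {1..n}"
  shows "S (srefl i) \<in> N" "weyl_proj T (S (srefl i)) = srefl i"
  using S W.s_closed[OF i] by (auto simp: is_section_def N_def)

lemma section_word:
  assumes "is_section G T n srefl S" "W.reduced is"
  shows "S (W.word is) = foldr (\<lambda>i g. S (srefl i) ** g) is (mat 1)"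
  using assms by (simp add: is_section_def reduced_word_eq weyl_word_eq)

lemma section_parts:
  assumes S: "is_section G T n srefl S"
  shows "\<exists>c e. c ^ 2 = 1 \<and> (\<forall>i\<in>{1..n}. e i \<noteq> 0 \<and> S (srefl i) = zc c ** coroot i (e i) ** sig i)"
proof -
  have "\<forall>i\<in>{1..n}. \<exists>t\<in>T. S (srefl i) = t ** sig i"
    using section_simple[OF S] srefl_proj by (auto intro!: weyl_proj_eqD)
  then obtain t where t: "\<And>i. i \<in> {1..n} \<Longrightarrow> t i \<in> T" "\<And>i. i \<in> {1..n} \<Longrightarrow> S (srefl i) = t i ** sig i"
    by metis
  have "\<exists>z. central z \<and> (\<forall>i\<in>{1..n}. \<exists>e. e \<noteq> 0 \<and> t i = z ** coroot i e)"
  proof (rule section_torus_parts[OF t(1)])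
    fix i j assume ij: "i \<in> {1..n}" "j \<in> {1..n}" "i \<noteq> j" "\<not> adj n i j"
    have "W.word [i, j] = W.word [j, i]" using W.s_comm[OF ij] ij by simp
    then have "S (srefl i) ** S (srefl j) = S (srefl j) ** S (srefl i)"
      using section_word[OF S W.reduced_pair[of i j]] section_word[OF S W.reduced_pair[of j i]] ij by simp
    then show "alpha j (t i) = 1"
      using commute_equation[OF ij t(1)[OF ij(1)] t(1)[OF ij(2)]] t(2)[OF ij(1)] t(2)[OF ij(2)] by simp
  next
    fix i j assume ij: "i \<in> {1..n}" "j \<in> {1..n}" "adj n i j"
    then have ji: "adj n j i" using adj_sym by blast
    have "W.word [i, j, i] = W.word [j, i, j]" using W.s_braid[OF ij] ij by simp
    then have "S (srefl i) ** (S (srefl j) ** S (srefl i)) = S (srefl j) ** (S (srefl i) ** S (srefl j))"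
      using section_word[OF S W.reduced_triple[OF ij]] section_word[OF S W.reduced_triple[OF ij(2,1) ji]] by simp
    then show "t i ** coroot i (inverse (alpha i (t i) * alpha j (t i)))
        = t j ** coroot j (inverse (alpha i (t j) * alpha j (t j)))"
      using braid_equation[OF ij t(1)[OF ij(1)] t(1)[OF ij(2)]] t(2)[OF ij(1)] t(2)[OF ij(2)] by simp
  qed
  then obtain z where z: "central z" "\<forall>i\<in>{1..n}. \<exists>e. e \<noteq> 0 \<and> t i = z ** coroot i e" by blast
  then obtain e where e: "\<And>i. i \<in> {1..n} \<Longrightarrow> e i \<noteq> 0" "\<And>i. i \<in> {1..n} \<Longrightarrow> t i = z ** coroot i (e i)" by metis
  obtain c where "c ^ 2 = 1" "z = zc c" using central_is_zc[OF z(1)] by blast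
  then show ?thesis using e t(2) by (intro exI[of _ c] exI[of _ e]) auto
qed

lemma zc_T [simp]: "c ^ 2 = 1 \<Longrightarrow> zc c \<in> T" and alpha_zc: "c ^ 2 = 1 \<Longrightarrow> j \<in> {1..n} \<Longrightarrow> alpha j (zc c) = 1"
  using central_zc by (auto simp: central_def)

lemma zc_coroot_inject:
  assumes c: "c ^ 2 = 1" "c' ^ 2 = 1" and i: "i \<in> {1..n}" and e: "e \<noteq> 0" "e' \<noteq> 0"
    and eq: "zc c ** coroot i e = zc c' ** coroot i e'"
  shows "c = c'"
proof -
  obtain k where k: "k \<in> {1..n}" "k \<noteq> i" "adj n k i" using exists_adjacent[OF i] by blast
  have "alpha k (zc c ** coroot i e) = inverse e" "alpha k (zc c' ** coroot i e') = inverse e'"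
    using c i e k alpha_coroot[OF i k(1)] by (simp_all add: rt_mult alpha_zc)
  then have "e = e'" using eq by simp
  then have "zc c = zc c'" using eq matrix_right_cancel[of "coroot i e'"] i e by simp
  then show ?thesis using zc_inject c by blast
qed

text \<open>The central factor contributes \<open>z\<^sup>2 = 1\<close>, and \<open>\<alpha>\<^sub>i\<^sup>\<or>(e) s\<^sub>i(\<alpha>\<^sub>i\<^sup>\<or>(e)) = 1\<close>, so what is left is \<open>\<sigma>\<^sub>i\<^sup>2\<close>.\<close>

lemma section_square:
  assumes c: "c ^ 2 = 1" and i: "i \<in> {1..n}" and e: "e \<noteq> 0"
  shows "(zc c ** coroot i e ** sig i) ** (zc c ** coroot i e ** sig i) = coroot i (- 1)"
proof -
  let ?t = "zc c ** coroot i e"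
  have t: "?t \<in> T" using c i e by simp
  have a: "alpha i ?t = e * e" using c i e alpha_coroot[OF i i e] by (simp add: rt_mult alpha_zc power2_eq_square)
  have m: "zc c \<in> T" "coroot i e \<in> T" "coroot i (inverse (e * e)) \<in> T" using c i e by auto
  have "(?t ** sig i) ** (?t ** sig i) = ?t ** ?t ** coroot i (inverse (e * e)) ** coroot i (- 1)"
    unfolding product_expansion[OF i t t] a using i by (simp add: sigma_square)
  also have "?t ** ?t ** coroot i (inverse (e * e)) = (zc c ** zc c) ** (coroot i e ** coroot i e ** coroot i (inverse (e * e)))"
    using m by (simp add: T_ac)
  also have "coroot i e ** coroot i e ** coroot i (inverse (e * e)) = coroot i (e * e * inverse (e * e))"
    using i e cor_mult[of "simple n i" "e * e" "inverse (e * e)"] cor_mult[of "simple n i" e e] by simp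
  also have "e * e * inverse (e * e) = 1" using e by (intro right_inverse) simp
  also have "zc c ** zc c ** coroot i 1 = mat 1"
    using i c by (simp add: zc_square cor_one)
  finally show ?thesis by simp
qed

lemma coroot_minus_one:
  assumes char: "CHAR('f) \<noteq> 2" and i: "i \<in> {1..n}"
  shows "coroot i (- 1) \<noteq> mat 1"
proof
  assume "coroot i (- 1) = mat 1"
  then have m1: "(- 1 :: 'f) = 1" using coroot_eq_one[OF i, of "-1"] by simp
  have "(1::'f) + - 1 = 0" by (rule add.right_inverse)
  then have "of_nat 2 = (0::'f)" unfolding m1 by simp
  then have d: "CHAR('f) dvd 2" by (simp only: of_nat_eq_0_iff_char_dvd)
  then have "CHAR('f) \<le> 2" by (rule dvd_imp_le) simp
  moreover have "CHAR('f) \<noteq> 0"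
  proof
    assume "CHAR('f) = 0"
    with d have "0 dvd (2::nat)" by (simp only:)
    then show False by simp
  qed
  ultimately show False using char CHAR_not_1[where 'a = 'f] by linarith
qed

lemma section_order:
  assumes S: "is_section G T n srefl S" and i: "i \<in> {1..n}"
  shows "elt_order G (S (srefl i)) = (if CHAR('f) = 2 then 2 else 4)"
    and "S (srefl i) ** S (srefl i) = coroot i (- 1)"
proof -
  let ?g = "S (srefl i)"
  show sq: "?g ** ?g = coroot i (- 1)" using section_parts[OF S] section_square i by fastforce
  have gG: "?g \<in> G" using section_simple[OF S i] N_G by blast
  have gr: "Group.group (grp G)" by (rule group.subgroup_imp_group[OF GL_group G_subgroup])
  have p2: "?g [^]\<^bsub>grp G\<^esub> (2::nat) = ?g ** ?g"
    by (simp add: numeral_2_eq_2 nat_pow_def)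
  have p4: "?g [^]\<^bsub>grp G\<^esub> (4::nat) = mat 1"
  proof -
    have "?g [^]\<^bsub>grp G\<^esub> (4::nat) = ?g ** ?g ** (?g ** ?g)"
      by (simp add: eval_nat_numeral nat_pow_def matrix_mul_assoc)
    then show ?thesis using sq cor_mult[of "simple n i" "-1" "-1"] cor_one[of "simple n i"] i by simp
  qed
  have gm: "?g \<in> carrier (grp G)" using gG by simp
  have dvd: "?g [^]\<^bsub>grp G\<^esub> k = mat 1 \<longleftrightarrow> group.ord (grp G) ?g dvd k" for k :: nat
    using group.pow_eq_id[OF gr gm, of k] by simp
  show "elt_order G ?g = (if CHAR('f) = 2 then 2 else 4)"
  proof (cases "CHAR('f) = 2")
    case True
    have two: "(2::'f) = 0" using of_nat_CHAR[where 'a = 'f] True by simp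
    then have m1: "(- 1 :: 'f) = 1" by (simp add: eq_neg_iff_add_eq_0 [symmetric] neg_eq_iff_add_eq_0)
    have "coroot i (- 1) = mat 1" unfolding m1 using i by (simp add: cor_one)
    then have "group.ord (grp G) ?g dvd 2" using dvd[of 2] p2 sq by simp
    moreover have "group.ord (grp G) ?g \<noteq> 1"
    proof
      assume "group.ord (grp G) ?g = 1"
      then have "?g [^]\<^bsub>grp G\<^esub> (1::nat) = mat 1" using dvd[of 1] by simp
      then have "?g = mat 1" by (simp add: nat_pow_def)
      then have "srefl i = T" using section_simple(2)[OF S i] weyl_proj_T[of "mat 1"] by simp
      then have "sig i \<in> T" using sigma_reflection[of "simple n i"] i by auto
      then have "act (sig i) (simple n i) = simple n i" using act_T i by simp
      then have "- simple n i = simple n i" using act_sigma[of "simple n i" "simple n i"] refl_self[of "simple n i" n] i by simp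
      then have "dot n (- simple n i) (simple n i) = 2" using D_roots_norm[of "simple n i" n] i by simp
      then show False using D_roots_norm[of "simple n i" n] i by (simp add: dot_uminus_left)
    qed
    ultimately have "group.ord (grp G) ?g = 2" using prime_nat_iff two_is_prime_nat by blast
    then show ?thesis using True by (simp add: elt_order_def numeral_eq_enat)
  next
    case False
    have "\<not> group.ord (grp G) ?g dvd 2"
    proof
      assume "group.ord (grp G) ?g dvd 2"
      then have "coroot i (- 1) = mat 1" using dvd[of 2] p2 sq by simp
      then show False using coroot_minus_one[OF False i] by simp
    qed
    moreover have "group.ord (grp G) ?g dvd 4" using dvd[of 4] p4 by simp
    moreover have "k = 4" if "k dvd 4" "\<not> k dvd 2" for k :: nat
    proof -
      have "k \<le> 4" using that(1) by (rule dvd_imp_le) simp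
      then have "k = 0 \<or> k = 1 \<or> k = 2 \<or> k = 3 \<or> k = 4" by linarith
      then show ?thesis using that by auto
    qed
    ultimately have "group.ord (grp G) ?g = 4" by blast
    then show ?thesis using False by (simp add: elt_order_def numeral_eq_enat)
  qed
qed

text \<open>Every element of the Weyl group has a reduced word, so sections are determined by their values at
  the simple reflections. The conjugating element covers uniqueness and conjugacy at once.\<close>

lemma section_determined:
  assumes S: "is_section G T n srefl S" "is_section G T n srefl S'"
    and t: "t \<in> T" and eq: "\<And>i. i \<in> {1..n} \<Longrightarrow> conj_by t (S (srefl i)) = S' (srefl i)"
    and w: "w \<in> carrier (weyl_group G T)"
  shows "conj_by t (S w) = S' w"
proof -
  obtain "is" where is': "W.reduced is" "W.word is = w" using W.exists_reduced[OF w] by blast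
  have "set is \<subseteq> {1..n}" using is' by (simp add: W.reduced_def)
  then have "conj_by t (foldr (\<lambda>i g. S (srefl i) ** g) is (mat 1)) = foldr (\<lambda>i g. S' (srefl i) ** g) is (mat 1)"
    by (induction "is") (use t eq in \<open>auto simp: conj_by_mult\<close>)
  then show ?thesis using section_word[OF S(1) is'(1)] section_word[OF S(2) is'(1)] is' by simp
qed

lemma section_ext:
  assumes S: "is_section G T n srefl S" "is_section G T n srefl S'"
    and eq: "\<And>i. i \<in> {1..n} \<Longrightarrow> S (srefl i) = S' (srefl i)"
  shows "S = S'"
proof (rule extensionalityI)
  show "S \<in> extensional (carrier (weyl_group G T))" "S' \<in> extensional (carrier (weyl_group G T))"
    using S by (auto simp: is_section_def PiE_def)
  show "S w = S' w" if "w \<in> carrier (weyl_group G T)" for w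
    using section_determined[OF S, of "mat 1" w] eq that by simp
qed

text \<open>The value at \<open>w\<close> is the product of the lifts along some reduced word. By Matsumoto's theorem and the
  braid relations the choice of the word does not matter.\<close>

lemma tits_section_exists:
  "\<exists>S. is_section G T n srefl S \<and> (\<forall>i\<in>{1..n}. S (srefl i) = sig i)"
proof -
  define P where "P is = foldr (\<lambda>i g. sig i ** g) is (mat 1)" for "is"
  define S where "S = (\<lambda>w\<in>carrier (weyl_group G T). P (SOME is. W.reduced is \<and> W.word is = w))"
  have sigN: "sig i \<in> N \<and> weyl_proj T (sig i) = srefl i" if "i \<in> {1..n}" for i using that srefl_proj by simp
  have SP: "S (W.word is) = P is" if is': "W.reduced is" for "is"
  proof -
    define js where "js = (SOME js. W.reduced js \<and> W.word js = W.word is)"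
    have js: "W.reduced js \<and> W.word js = W.word is" unfolding js_def by (rule someI[of _ "is"]) (use is' in simp)
    have "W.word is \<in> carrier (weyl_group G T)" using is' by (auto simp: W.reduced_def)
    then have "S (W.word is) = P js" by (simp add: S_def js_def)
    also have "\<dots> = P is" unfolding P_def
    proof (rule W.matsumoto)
      show "sig i ** (sig j ** x) = sig j ** (sig i ** x)"
        if "i \<in> {1..n}" "j \<in> {1..n}" "i \<noteq> j" "\<not> adj n i j" for i j x
        using sigma_commute[OF that] by (simp add: matrix_mul_assoc)
      show "sig i ** (sig j ** (sig i ** x)) = sig j ** (sig i ** (sig j ** x))"
        if "i \<in> {1..n}" "j \<in> {1..n}" "adj n i j" for i j x
        using arg_cong[OF sigma_braid[OF that], of "\<lambda>y. y ** x"] by (simp add: matrix_mul_assoc)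
    qed (use js is' in auto)
    finally show ?thesis .
  qed
  have wp: "P is \<in> N \<and> weyl_proj T (P is) = W.word is" if "W.reduced is" for "is"
    unfolding P_def using that sigN by (intro word_proj) (auto simp: W.reduced_def)
  have Ssimple: "S (srefl i) = sig i" if "i \<in> {1..n}" for i
    using SP[OF W.reduced_single[OF that]] that by (simp add: P_def)
  have "is_section G T n srefl S"
    unfolding is_section_def
  proof (intro conjI ballI allI impI)
    have *: "S w \<in> N \<and> weyl_proj T (S w) = w" if "w \<in> carrier (weyl_group G T)" for w
    proof -
      obtain "is" where "W.reduced is" "W.word is = w"
        using W.exists_reduced[OF \<open>w \<in> carrier (weyl_group G T)\<close>] by blast
      then show ?thesis using SP[of "is"] wp[of "is"] by auto
    qed
    show "S \<in> carrier (weyl_group G T) \<rightarrow>\<^sub>E torus_normalizer G T"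
      using * by (auto simp: N_def S_def PiE_def)
    show "weyl_proj T (S w) = w" if "w \<in> carrier (weyl_group G T)" for w using * that by blast
    fix "is" assume "reduced_word G T n srefl is"
    then have r: "W.reduced is" by (simp add: reduced_word_eq)
    then have "set is \<subseteq> {1..n}" by (simp add: W.reduced_def)
    then have "foldr (\<lambda>i g. S (srefl i) ** g) is (mat 1) = P is"
      unfolding P_def by (induction "is") (use Ssimple in auto)
    then show "S (weyl_word G T srefl is) = foldr (\<lambda>i g. S (srefl i) ** g) is (mat 1)"
      using SP[OF r] by (simp add: weyl_word_eq)
  qed
  then show ?thesis using Ssimple by blast
qed

lemma tits_section_props:
  "is_section G T n srefl (tits_section G T n srefl sig)"
proof -
  obtain S where S: "is_section G T n srefl S \<and> (\<forall>i\<in>{1..n}. S (srefl i) = sig i)" using tits_section_exists by blast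
  have "tits_section G T n srefl sig = S"
    unfolding tits_section_def
  proof (rule the_equality)
    show "S' = S" if "is_section G T n srefl S' \<and> (\<forall>i\<in>{1..n}. S' (srefl i) = sig i)" for S'
      using section_ext[of S' S] S that by simp
  qed (use S in blast)
  then show ?thesis using S by simp
qed

lemma conj_by_T_section_value:
  assumes t: "t \<in> T" and i: "i \<in> {1..n}" and c: "c ^ 2 = 1" and e: "e \<noteq> 0"
  shows "conj_by t (zc c ** coroot i e ** sig i) = zc c ** coroot i (e * alpha i t) ** sig i"
proof -
  let ?x = "zc c ** coroot i e"
  have x: "?x \<in> T" using c i e by simp
  have m: "zc c \<in> T" "coroot i e \<in> T" "coroot i (alpha i t) \<in> T" "matrix_inv t \<in> T" using c i e t by auto
  have "conj_by t (?x ** sig i) = t ** ?x ** (sig i ** matrix_inv t)" by (simp add: conj_by_def matrix_mul_assoc)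
  also have "sig i ** matrix_inv t = matrix_inv t ** coroot i (alpha i t) ** sig i"
    using sig_mult_T[OF i m(4)] t i by (simp add: rt_inv)
  also have "t ** ?x ** (matrix_inv t ** coroot i (alpha i t) ** sig i)
      = (t ** ?x ** matrix_inv t) ** coroot i (alpha i t) ** sig i" by (simp only: matrix_mul_assoc)
  also have "t ** ?x ** matrix_inv t = ?x" using T_conj_by[OF t x] by (simp only: conj_by_def)
  also have "?x ** coroot i (alpha i t) = zc c ** coroot i (e * alpha i t)"
    using cor_mult[of "simple n i" e "alpha i t"] i e t by (simp add: matrix_mul_assoc)
  finally show ?thesis .
qed

section \<open>Coordinates and conjugacy\<close>

text \<open>The values at the nodes of the chain are prescribed by recursion, the one at node \<open>n - 1\<close> by a square
  root, and the one at the branch node by the last coordinate. The value at node \<open>n\<close> is then adjusted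
  by the coweight \<open>\<omega>\<^sub>n\<close>, which does not affect the other simple roots.\<close>

lemma alpha_surj:
  assumes f: "\<And>i. i \<in> {1..n} \<Longrightarrow> f i \<noteq> 0"
  shows "\<exists>t\<in>T. \<forall>i\<in>{1..n}. alpha i t = f i"
proof -
  have c0: "chain f k \<noteq> 0" if "k \<le> n" for k
    using that f by (intro chain_nonzero) auto
  obtain r where r: "r ^ 2 = chain f (n - 2) * f (n - 1)" using nth_root_exists[of 2] by auto
  have r0: "r \<noteq> 0" using r c0[of "n - 2"] f[of "n - 1"] rank by auto
  define y where "y i = (if i \<le> n - 2 then chain f i else if i = n - 1 then r
    else chain f (n - 2) ^ 2 / (chain f (n - 3) * r * f (n - 2)))" for i
  have y_vals: "i \<le> n - 2 \<Longrightarrow> y i = chain f i" "y (n - 1) = r"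
    "y n = chain f (n - 2) ^ 2 / (chain f (n - 3) * r * f (n - 2))" for i
  proof -
    have "\<not> n - 1 \<le> n - 2" "\<not> n \<le> n - 2" "n \<noteq> n - 1" using rank by linarith+
    then show "i \<le> n - 2 \<Longrightarrow> y i = chain f i" "y (n - 1) = r"
      "y n = chain f (n - 2) ^ 2 / (chain f (n - 3) * r * f (n - 2))"
      by (simp_all only: y_def if_True if_False simp_thms)
  qed
  have nv: "nonvanishing y" unfolding nonvanishing_def
    using c0 r0 f[of "n - 2"] rank by (auto simp: y_def)
  have low: "alpha j (kappa y) = f j" if "j \<in> {1..n}" "j \<noteq> n" for j
  proof -
    consider "j = 1" | "2 \<le> j" "j \<le> n - 3" | "j = n - 2" | "j = n - 1"
      using \<open>j \<in> {1..n}\<close> \<open>j \<noteq> n\<close> D_node_cases[OF \<open>j \<in> {1..n}\<close>]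
      by (metis Suc_1 atLeastAtMost_iff le_antisym not_less_eq_eq)
    then show ?thesis
    proof cases
      case 1
      then show ?thesis using alpha_kappa(1)[OF nv] rank f[of 1] by (simp add: y_vals numeral_2_eq_2)
    next
      case 2
      obtain k where k: "j = Suc k" using 2 by (cases j) auto
      have "f j \<noteq> 0" "chain f j \<noteq> 0" "chain f k \<noteq> 0" using f[of j] c0[of j] c0[of k] 2 k by auto
      then show ?thesis using alpha_kappa(2)[OF nv 2] 2 k by (simp add: y_vals)
    next
      case 3
      have "f j \<noteq> 0" "chain f (n - 2) \<noteq> 0" "chain f (n - 3) \<noteq> 0"
        using f[of j] c0[of "n - 2"] c0[of "n - 3"] that by auto
      then show ?thesis using alpha_kappa(3)[OF nv] 3 r0 y_vals by simp
    next
      case 4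
      then show ?thesis using alpha_kappa(4)[OF nv] r r0 y_vals c0[of "n - 2"] by simp
    qed
  qed
  define q where "q = f n / alpha n (kappa y)"
  have n: "n \<in> {1..n}" using rank by simp
  have an: "alpha n (kappa y) \<noteq> 0" using rt_nonzero[of "simple n n" "kappa y"] nv n by simp
  then have q: "q \<noteq> 0" using f[OF n] by (simp add: q_def)
  have omT: "om q \<in> T" using om_cocharacter q by (rule cocharacter_mem)
  have "alpha i (kappa y ** om q) = f i" if i: "i \<in> {1..n}" for i
    using rt_mult[of "simple n i" "kappa y" "om q"] i nv omT alpha_om[OF i q] low[OF i] an
    by (auto simp: q_def)
  then show ?thesis using nv omT by (intro bexI[of _ "kappa y ** om q"]) auto
qed

lemma torus_elt_kappa:
  assumes "\<And>i. i \<in> {2..n} \<Longrightarrow> x i \<noteq> 0"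
  shows "torus_elt n T cor om x = om (x 1) ** kappa (\<lambda>i. if i = 1 then 1 else x i)"
proof -
  interpret Tg: comm_group "grp T" by (rule T_comm_group)
  have "{1..n} = insert 1 {2..n}" using rank by auto
  then have "kappa (\<lambda>i. if i = 1 then 1 else x i)
      = finprod (grp T) (\<lambda>i. coroot i (if i = 1 then 1 else x i)) (insert 1 {2..n})" by (simp add: kappa_def)
  also have "\<dots> = coroot 1 1 ** finprod (grp T) (\<lambda>i. coroot i (if i = 1 then 1 else x i)) {2..n}"
    using assms rank by (subst Tg.finprod_insert) auto
  also have "finprod (grp T) (\<lambda>i. coroot i (if i = 1 then 1 else x i)) {2..n}
      = finprod (grp T) (\<lambda>i. coroot i (x i)) {2..n}"
    using assms by (intro Tg.finprod_cong) (auto simp: simp_implies_def)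
  finally show ?thesis using rank by (simp add: torus_elt_def cor_one)
qed

text \<open>The coordinates of the first torus part are those of \<open>z\<^sub>c \<alpha>\<^sub>1\<^sup>\<or>(1 / y)\<close>, because \<open>\<alpha>\<^sub>1\<^sup>\<or>\<close> is \<open>2 \<omega>\<^sub>n\<close> minus a
  combination of the other simple coroots.\<close>

lemma torus_elt_first:
  assumes y: "y \<noteq> 0" and c: "c \<noteq> 0"
  shows "torus_elt n T cor om (section_coord n (y ^ 2) (y ^ 3) c d 1) = zc c ** coroot 1 (inverse y)"
proof -
  let ?x = "section_coord n (y ^ 2) (y ^ 3) c d 1"
  let ?z = "\<lambda>i. if i \<in> {n - 1, n} then c else 1"
  have iy: "inverse (y ^ 2) * y ^ 3 = y" using y by (simp add: field_simps eval_nat_numeral)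
  have x1: "?x 1 = inverse y ^ 2" by (simp add: section_coord_def power_inverse)
  have val: "?x k = y ^ omega_coeff k * ?z k" if k: "k \<in> {2..n}" for k
  proof -
    have kn: "k \<in> {1..n}" "k \<noteq> 1" using k by auto
    have dist: "\<not> n - 1 \<le> n - 2" "\<not> n \<le> n - 2" "n \<noteq> n - 1" "n - 1 \<noteq> 1" "n \<noteq> 1" using rank by linarith+
    have "k \<le> n - 2 \<or> k = n - 1 \<or> k = n" using k by auto
    then consider "k \<le> n - 2" | "k = n - 1" | "k = n" by blast
    then show ?thesis
    proof cases
      case 1
      then have "k \<noteq> n - 1" "k \<noteq> n" using rank by linarith+
      moreover have "?x k = y ^ k"
      proof (cases "even k")
        case True
        then show ?thesis using 1 kn by (simp add: section_coord_def flip: power_mult)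
      next
        case False
        then have k3: "3 \<le> k" using k by (cases "k = 2") auto
        then have "even (k - 3)" using False by simp
        then have "3 + 2 * ((k - 3) div 2) = k" using k3 by simp
        then have "y ^ 3 * (y ^ 2) ^ ((k - 3) div 2) = y ^ k" by (simp flip: power_mult power_add)
        then show ?thesis using 1 kn False by (simp add: section_coord_def)
      qed
      ultimately show ?thesis using 1 by simp
    next
      case 2
      have "?x (n - 1) = c * (inverse (y ^ 2) * y ^ 3) ^ ((n - 2) div 2)"
        unfolding section_coord_def using dist by (simp only: if_True if_False simp_thms)
      then show ?thesis unfolding 2 iy omega_coeff_simps by simp
    next
      case 3
      have "?x n = c * (inverse (y ^ 2) * y ^ 3) ^ (n div 2)"
        unfolding section_coord_def using dist by (simp only: if_True if_False simp_thms)
      then show ?thesis unfolding 3 iy omega_coeff_simps by simp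
    qed
  qed
  have nv: "nonvanishing (\<lambda>k. inverse y ^ omega_coeff k)" "nonvanishing (\<lambda>k. if k = 1 then 1 else ?x k)"
    using y c val by (auto simp: nonvanishing_def)
  have "torus_elt n T cor om ?x = om (inverse y ^ 2) ** kappa (\<lambda>k. if k = 1 then 1 else ?x k)"
    by (subst torus_elt_kappa, use y c val in simp) (simp only: x1)
  also have "\<dots> = kappa (\<lambda>k. inverse y ^ omega_coeff k * (if k = 1 then 1 else ?x k))"
    using om_square[of "inverse y"] y kappa_mult[OF nv] by simp
  also have "\<dots> = kappa (\<lambda>k. ?z k * (if k = 1 then inverse y else 1))"
  proof (rule kappa_cong)
    fix k assume k: "k \<in> {1..n}"
    show "inverse y ^ omega_coeff k * (if k = 1 then 1 else ?x k) = ?z k * (if k = 1 then inverse y else 1)"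
    proof (cases "k = 1")
      case True
      have "omega_coeff 1 = 1" "1 \<notin> {n - 1, n}" using rank by auto
      then show ?thesis using True by simp
    next
      case False
      then have "?x k = y ^ omega_coeff k * ?z k" using val k by simp
      moreover have "inverse y ^ omega_coeff k * y ^ omega_coeff k = 1"
        using y by (simp flip: power_mult_distrib)
      ultimately show ?thesis using False by (simp add: mult.assoc[symmetric])
    qed
  qed (use y c in \<open>auto simp: nonvanishing_def\<close>)
  also have "\<dots> = zc c ** kappa (\<lambda>k. if k = 1 then inverse y else 1)"
    unfolding zc_def using y by (intro kappa_mult zc_nonvanishing c) (auto simp: nonvanishing_def)
  also have "\<dots> = zc c ** coroot 1 (inverse y)"
    using kappa_single[of 1 "inverse y"] y rank by simp
  finally show ?thesis .
qed

lemma torus_elt_other: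
  assumes i: "i \<in> {2..n}" and c: "c \<noteq> 0" and d: "d i \<noteq> 0"
  shows "torus_elt n T cor om (section_coord n a b c d i)
      = zc c ** coroot i (if i \<in> {n - 1, n} then d i / c else d i)"
proof -
  let ?x = "section_coord n a b c d i"
  let ?e = "if i \<in> {n - 1, n} then d i / c else d i"
  let ?z = "\<lambda>i. if i \<in> {n - 1, n} then c else 1"
  have i1: "i \<noteq> 1" "i \<in> {1..n}" "1 \<notin> {n - 1, n}" using i rank by auto
  have xk: "?x k = (if k = i then d i else ?z k)" for k using i1 by (simp add: section_coord_def)
  have x1: "?x 1 = 1" using i1 by (simp add: xk)
  have e: "?e \<noteq> 0" using c d by simp
  have "torus_elt n T cor om ?x = om (?x 1) ** kappa (\<lambda>k. if k = 1 then 1 else ?x k)"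
    by (rule torus_elt_kappa) (use c d in \<open>simp add: xk\<close>)
  also have "\<dots> = kappa (\<lambda>k. if k = 1 then 1 else ?x k)"
    unfolding x1 cocharacter_one[OF om_cocharacter] by simp
  also have "\<dots> = kappa (\<lambda>k. ?z k * (if k = i then ?e else 1))"
    by (rule kappa_cong) (use c d i1 in \<open>auto simp: nonvanishing_def xk\<close>)
  also have "\<dots> = zc c ** kappa (\<lambda>k. if k = i then ?e else 1)"
    unfolding zc_def using e by (intro kappa_mult zc_nonvanishing c) (auto simp: nonvanishing_def)
  also have "\<dots> = zc c ** coroot i ?e" using kappa_single[OF i1(2) e] by simp
  finally show ?thesis .
qed

text \<open>The coordinates listed for sections are those of \<open>z\<^sub>c \<alpha>\<^sub>i\<^sup>\<or>(e\<^sub>i)\<close>. The curve \<open>a\<^sup>3 = b\<^sup>2\<close> is parametrized by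
  \<open>a = y\<^sup>2\<close>, \<open>b = y\<^sup>3\<close> with \<open>y = 1 / e\<^sub>1\<close>, and for \<open>i \<ge> 2\<close> the free coordinate absorbs the factor \<open>c\<close>
  at the two leaves.\<close>

lemma has_c_value_iff:
  "has_c_value n T cor om srefl sig S c \<longleftrightarrow>
     c ^ 2 = 1 \<and> (\<exists>e. \<forall>i\<in>{1..n}. e i \<noteq> 0 \<and> S (srefl i) = zc c ** coroot i (e i) ** sig i)"
proof
  assume h: "has_c_value n T cor om srefl sig S c"
  then obtain a b d where c: "c ^ 2 = 1" and ab: "a \<noteq> 0" "b \<noteq> 0" "a ^ 3 = b ^ 2" and d: "\<And>i. i \<in> {2..n} \<Longrightarrow> d i \<noteq> 0"
    and S: "\<And>i. i \<in> {1..n} \<Longrightarrow> S (srefl i) = torus_elt n T cor om (section_coord n a b c d i) ** sig i"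
    unfolding has_c_value_def by blast
  have c0: "c \<noteq> 0" using c by auto
  define y where "y = b / a"
  have y: "y \<noteq> 0" "a = y ^ 2" "b = y ^ 3"
    using ab by (auto simp: y_def power_divide eval_nat_numeral field_simps)
  define e where "e i = (if i = 1 then inverse y else if i \<in> {n - 1, n} then d i / c else d i)" for i
  have "e i \<noteq> 0 \<and> S (srefl i) = zc c ** coroot i (e i) ** sig i" if i: "i \<in> {1..n}" for i
  proof (cases "i = 1")
    case True
    then show ?thesis using S[OF i] torus_elt_first[OF y(1) c0, of d] y by (simp add: e_def)
  next
    case False
    then have i2: "i \<in> {2..n}" using i by auto
    show ?thesis using S[OF i] torus_elt_other[of i c d a b, OF i2 c0 d[OF i2]] d[OF i2] c0 False by (simp add: e_def)
  qed
  then show "c ^ 2 = 1 \<and> (\<exists>e. \<forall>i\<in>{1..n}. e i \<noteq> 0 \<and> S (srefl i) = zc c ** coroot i (e i) ** sig i)" using c by blast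
next
  assume "c ^ 2 = 1 \<and> (\<exists>e. \<forall>i\<in>{1..n}. e i \<noteq> 0 \<and> S (srefl i) = zc c ** coroot i (e i) ** sig i)"
  then obtain e where c: "c ^ 2 = 1" and e: "\<And>i. i \<in> {1..n} \<Longrightarrow> e i \<noteq> 0"
    and S: "\<And>i. i \<in> {1..n} \<Longrightarrow> S (srefl i) = zc c ** coroot i (e i) ** sig i" by blast
  have c0: "c \<noteq> 0" using c by auto
  define y where "y = inverse (e 1)"
  have y: "y \<noteq> 0" using e[of 1] rank by (simp add: y_def)
  define d where "d i = (if i \<in> {n - 1, n} then e i * c else e i)" for i
  have d: "\<forall>i\<in>{2..n}. d i \<noteq> 0" using e c0 by (auto simp: d_def)
  have "S (srefl i) = torus_elt n T cor om (section_coord n (y ^ 2) (y ^ 3) c d i) ** sig i" if i: "i \<in> {1..n}" for i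
  proof (cases "i = 1")
    case True
    then show ?thesis using S[OF i] torus_elt_first[OF y c0, of d] by (simp add: y_def)
  next
    case False
    then have i2: "i \<in> {2..n}" using i by auto
    have "(if i \<in> {n - 1, n} then d i / c else d i) = e i" using c0 by (simp add: d_def)
    then show ?thesis using S[OF i] torus_elt_other[OF i2 c0, of d "y ^ 2" "y ^ 3"] d i2 by simp
  qed
  moreover have "(y ^ 2) ^ 3 = (y ^ 3) ^ 2" by (simp flip: power_mult)
  ultimately show "has_c_value n T cor om srefl sig S c"
    unfolding has_c_value_def using c y d by (intro conjI exI[of _ "y ^ 2"] exI[of _ "y ^ 3"] exI[of _ d]) auto
qed

lemma has_c_value_unique:
  assumes S: "is_section G T n srefl S"
  shows "\<exists>!c. has_c_value n T cor om srefl sig S c"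
proof -
  have i: "1 \<in> {1..n}" using rank by simp
  have "\<exists>c. has_c_value n T cor om srefl sig S c" using section_parts[OF S] unfolding has_c_value_iff by blast
  moreover have "c = c'" if h: "has_c_value n T cor om srefl sig S c" "has_c_value n T cor om srefl sig S c'" for c c'
  proof -
    obtain e e' where c: "c ^ 2 = 1" "c' ^ 2 = 1" "e \<noteq> 0" "e' \<noteq> 0"
      "zc c ** coroot 1 e ** sig 1 = zc c' ** coroot 1 e' ** sig 1"
      using h i unfolding has_c_value_iff by metis
    have "zc c ** coroot 1 e = zc c' ** coroot 1 e'" using c(5) matrix_right_cancel[of "sig 1"] i by simp
    then show "c = c'" by (rule zc_coroot_inject[OF c(1,2) i c(3,4)])
  qed
  ultimately show ?thesis by blast
qed

text \<open>Conjugation by \<open>t\<close> multiplies \<open>e\<^sub>i\<close> by \<open>\<alpha>\<^sub>i(t)\<close> and fixes the central factor.\<close>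

lemma T_conjugate_iff:
  assumes S: "is_section G T n srefl S" "is_section G T n srefl S'"
    and c: "has_c_value n T cor om srefl sig S c" "has_c_value n T cor om srefl sig S' c'"
  shows "T_conjugate G T S S' \<longleftrightarrow> c = c'"
proof -
  obtain e where c2: "c ^ 2 = 1" and e: "\<And>i. i \<in> {1..n} \<Longrightarrow> e i \<noteq> 0"
    "\<And>i. i \<in> {1..n} \<Longrightarrow> S (srefl i) = zc c ** coroot i (e i) ** sig i" using c(1) unfolding has_c_value_iff by blast
  obtain e' where c2': "c' ^ 2 = 1" and e': "\<And>i. i \<in> {1..n} \<Longrightarrow> e' i \<noteq> 0"
    "\<And>i. i \<in> {1..n} \<Longrightarrow> S' (srefl i) = zc c' ** coroot i (e' i) ** sig i" using c(2) unfolding has_c_value_iff by blast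
  show ?thesis
  proof
    assume "T_conjugate G T S S'"
    then obtain t where t: "t \<in> T" "\<And>w. w \<in> carrier (weyl_group G T) \<Longrightarrow> conj_by t (S w) = S' w"
      unfolding T_conjugate_def conj_by_def by blast
    have i: "1 \<in> {1..n}" using rank by simp
    have "conj_by t (S (srefl 1)) = S' (srefl 1)" using t(2) W.s_closed[OF i] by blast
    then have "zc c ** coroot 1 (e 1 * alpha 1 t) ** sig 1 = zc c' ** coroot 1 (e' 1) ** sig 1"
      unfolding e(2)[OF i] e'(2)[OF i] conj_by_T_section_value[OF t(1) i c2 e(1)[OF i]] .
    then have "zc c ** coroot 1 (e 1 * alpha 1 t) = zc c' ** coroot 1 (e' 1)"
      using matrix_right_cancel[of "sig 1"] i by simp
    then show "c = c'" using e(1)[OF i] e'(1)[OF i] alpha_nonzero[OF i t(1)]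
      by (intro zc_coroot_inject[OF c2 c2' i]) auto
  next
    assume cc: "c = c'"
    obtain t where t: "t \<in> T" "\<And>i. i \<in> {1..n} \<Longrightarrow> alpha i t = e' i / e i"
      using alpha_surj[of "\<lambda>i. e' i / e i"] e e' by auto
    have "conj_by t (S (srefl i)) = S' (srefl i)" if i: "i \<in> {1..n}" for i
      unfolding e(2)[OF i] e'(2)[OF i] conj_by_T_section_value[OF t(1) i c2 e(1)[OF i]]
      using t(2)[OF i] e(1)[OF i] cc by simp
    then have "conj_by t (S w) = S' w" if "w \<in> carrier (weyl_group G T)" for w
      using section_determined[OF S t(1)] that by blast
    then show "T_conjugate G T S S'" unfolding T_conjugate_def conj_by_def using t(1) by blast
  qed
qed

lemma section_order_profile:
  assumes "is_section G T n srefl S"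
  shows "order_profile G n srefl S = (\<lambda>i\<in>{1..n}. if CHAR('f) = 2 then 2 else 4)"
  unfolding order_profile_def by (intro restrict_ext section_order(1)[OF assms])

lemma sections_optimal:
  assumes S: "is_section G T n srefl S"
  shows "optimal G T n srefl S"
proof -
  have "section_profiles G T n srefl = {order_profile G n srefl S}"
    using S section_order_profile by (auto simp: section_profiles_def)
  moreover have "\<not> profile_less n P P" for P using rank by (auto simp: profile_less_def)
  ultimately show ?thesis using S by (auto simp: optimal_def)
qed

end

theorem proposition3p14:
  fixes n :: nat
    and G T :: "('f::alg_closed_field ^ 'm::finite ^ 'm) set"
    and rt :: "(nat \<Rightarrow> int) \<Rightarrow> 'f ^ 'm ^ 'm \<Rightarrow> 'f"
    and cor u :: "(nat \<Rightarrow> int) \<Rightarrow> 'f \<Rightarrow> 'f ^ 'm ^ 'm"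
    and om :: "'f \<Rightarrow> 'f ^ 'm ^ 'm"
    and s :: "nat \<Rightarrow> ('f ^ 'm ^ 'm) set"
    and \<sigma> :: "nat \<Rightarrow> 'f ^ 'm ^ 'm"
    and Tits :: "('f ^ 'm ^ 'm) set \<Rightarrow> 'f ^ 'm ^ 'm"
  assumes n: "6 \<le> n" "even n"
    and G: "linear_algebraic_group G" "zariski_connected G" "reductive G" "almost_simple G"
    and T: "maximal_torus G T"
    and centralizer: "{g \<in> G. \<forall>t\<in>T. g ** t = t ** g} = T"
    and type: "type_D n G T rt cor"
    and om: "fundamental_coweight n T rt cor n om"
    and lattice: "cocharacters_generated n T cor om"
    and realization: "realization n G T rt cor u"
    and s: "s = (\<lambda>i. reflection G T (rt (simple n i)) (cor (simple n i)))"
    and \<sigma>: "\<sigma> = (\<lambda>i. sigma u (simple n i))"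
    and Tits: "Tits = tits_section G T n s \<sigma>"
  shows "optimal G T n s Tits
    \<and> (CHAR('f) \<noteq> 2 \<longrightarrow> (\<forall>i\<in>{1..n}. Tits (s i) ** Tits (s i) \<noteq> mat 1))
    \<and> (CHAR('f) \<noteq> 2 \<longrightarrow> (\<forall>S. is_section G T n s S \<longrightarrow> (\<forall>i\<in>{1..n}. elt_order G (S (s i)) = 4)))
    \<and> (\<forall>S S'. is_section G T n s S \<and> is_section G T n s S'
          \<longrightarrow> order_profile G n s S = order_profile G n s S')
    \<and> (\<forall>S. is_section G T n s S \<longrightarrow> (\<exists>!c. has_c_value n T cor om s \<sigma> S c))
    \<and> (\<forall>S S' c c'. is_section G T n s S \<and> is_section G T n s S'
          \<and> has_c_value n T cor om s \<sigma> S c \<and> has_c_value n T cor om s \<sigma> S' c'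
          \<longrightarrow> (T_conjugate G T S S' \<longleftrightarrow> c = c'))"
proof -
  interpret half_spin_group n G T rt cor u om
    by unfold_locales (fact n G(1) T centralizer type om lattice realization)+
  have Tits_section: "is_section G T n s Tits"
    unfolding Tits s \<sigma> by (rule tits_section_props)
  show ?thesis
  proof (intro conjI impI allI ballI)
    show "optimal G T n s Tits" using sections_optimal Tits_section unfolding s by blast
    fix i assume char: "CHAR('f) \<noteq> 2" and i: "i \<in> {1..n}"
    then show "Tits (s i) ** Tits (s i) \<noteq> mat 1"
      using section_order(2)[OF Tits_section[unfolded s] i] coroot_minus_one unfolding s by simp
  next
    fix S i assume "CHAR('f) \<noteq> 2" "is_section G T n s S" "i \<in> {1..n}"
    then show "elt_order G (S (s i)) = 4" using section_order(1) unfolding s by simp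
  next
    fix S S' assume "is_section G T n s S \<and> is_section G T n s S'"
    then show "order_profile G n s S = order_profile G n s S'"
      using section_order_profile[of S] section_order_profile[of S'] unfolding s by simp
  next
    fix S assume "is_section G T n s S"
    then show "\<exists>!c. has_c_value n T cor om s \<sigma> S c" unfolding s \<sigma> by (rule has_c_value_unique)
  next
    fix S S' c c' assume "is_section G T n s S \<and> is_section G T n s S'
      \<and> has_c_value n T cor om s \<sigma> S c \<and> has_c_value n T cor om s \<sigma> S' c'"
    then show "T_conjugate G T S S' = (c = c')" unfolding s \<sigma> using T_conjugate_iff by blast
  qed
qed

end
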